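(* Let $p>0$. Assume $h:(0,\infty)\to\mathbb{R}$ is $C^2$, positive and decreasing, with $\lim_{y\to\infty}h(y)=h_\infty>0$, $\int_0^1 h(y)\,dy<\infty$ and $\sup_{y>0}\left[y|h'(y)|+y^2|h''(y)|\right]<\infty$. Assume in addition that $yh''(y)+h'(y)\ge0$ for $y>0$ and that the function $y\mapsto y^2h''(y)$ is decreasing on $(0,\infty)$. Assume the functional $I(\cdot)$ satisfies properties (a), (b), (c), (d) of the context, and that the initial data $\xi(\cdot,0):(0,\infty)\to\mathbb{R}$ is $C^2$, non-negative, decreasing, with $\|\xi(\cdot,0)\|_{2,\infty}<\infty$ and $pI(\zeta)+[dI(\zeta),\zeta-yD\zeta]>0$ for $\zeta=\xi(\cdot,0)$. Let $\xi(\cdot,t)$, $t\ge0$, be the (unique, global in time) solution with initial data $\xi(\cdot,0)$ of $$\frac{\partial \xi(y,t)}{\partial t}-h(y)-\frac{\partial \xi(y,t)}{\partial y}+\rho(\xi(\cdot,t))\left[\xi(y,t)-y\frac{\partial\xi(y,t)}{\partial y}\right]=0,\quad y>0,\ t>0,$$ $$\rho(\zeta)=\frac{I(\zeta)+[dI(\zeta),h+D\zeta]}{pI(\zeta)+[dI(\zeta),\zeta-yD\zeta]},$$ and let $$\xi_p(y)=(p+y)\int_y^\infty\frac{p\,h(y')}{(p+y')^2}\,dy',\qquad y>0 .$$ Then for any $q>p$ there exists a constant $C_q$ such that $$\|\xi(\cdot,t)-\xi_p(\cdot)\|_{2,\infty}\le C_q e^{-t/q}\qquad\text{for all } t\ge0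 .$$
   Context: Notation: $D=d/dy$; $[f,g]=\int_0^\infty f(y)g(y)\,dy$; "decreasing" means non-increasing. For $C^m$ functions $\zeta:(0,\infty)\to\mathbb{R}$, $\|\zeta\|_{m,\infty}=\sup_{0<y<\infty}\sum_{k=0}^m y^k\left|\frac{d^k\zeta(y)}{dy^k}\right|$. $I(\cdot)$ is a positive differentiable functional on continuous non-negative functions $\zeta:(0,\infty)\to\mathbb{R}$; its gradient at $\zeta$ is a function $dI(\zeta):(0,\infty)\to\mathbb{R}$ with directional derivatives $\frac{d}{d\varepsilon}I(\zeta+\varepsilon\phi)|_{\varepsilon=0}=[dI(\zeta),\phi]$. The quantity $\rho(\zeta)$ is defined for non-negative $\zeta$ with $\|\zeta\|_{1,\infty}<\infty$ whose denominator is positive. Under the stated hypotheses the initial value problem has a unique global solution, with $\sup_{t\ge0}\|\xi(\cdot,t)\|_{2,\infty}<\infty$ and with the denominator of $\rho(\xi(\cdot,t))$ bounded below by a positive constant for $t\ge0$. Properties of $I$: (a) There exists $\varepsilon_0>0$ such that $I(\zeta)$ is independent of the values $\zeta(y)$ for $0<y<\varepsilon_0$. (b) For every continuous non-negative $\zeta$ the gradient $dI(\zeta)$ is an integrable function, and there is a constant $C$ with $\|dI(\zeta_1)-dI(\zeta_2)\|_{L^1(0,\infty)}\le C\|\zeta_1-\zeta_2\|_{L^\infty(0,\infty)}$ for all such $\zeta_1,\zeta_2$. (c) For any $M\ge0$ there exists $c_M>0$ such that $I(\zeta)\ge c_M$ whenever $\zeta$ is non-negative and $\|\zeta\|_\infty\le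 M$. (d) $dI(\zeta)$ is a non-positive function for all continuous non-negative $\zeta$, and $\inf_{\zeta}\{I(\zeta)+[dI(\zeta),h]\}>0$, the infimum being over all continuous non-negative $\zeta:(0,\infty)\to\mathbb{R}$. *)

theory Defs
  imports "HOL-Analysis.Analysis"
begin

text \<open>
  A function on the half-line \<open>(0,\<infinity>)\<close> is represented by a total function on the reals whose values on
  \<open>(-\<infinity>,0]\<close> are irrelevant.
\<close>

definition C_pos :: "nat \<Rightarrow> (real \<Rightarrow> real) \<Rightarrow> bool" where
  "C_pos m f \<longleftrightarrow>
     (\<forall>k<m. (deriv ^^ k) f differentiable_on {0<..}) \<and> continuous_on {0<..} ((deriv ^^ m) f)"

text \<open>
  The norm \<open>\<parallel>\<zeta>\<parallel>\<^bsub>m,\<infinity>\<^esub>\<close> is extended-real-valued, so that an infinite supremum is not mistaken for a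
  number. The case \<open>m = 0\<close> is the supremum norm on \<open>(0,\<infinity>)\<close>.
\<close>

definition wnorm :: "nat \<Rightarrow> (real \<Rightarrow> real) \<Rightarrow> ereal" where
  "wnorm m \<zeta> = (SUP y\<in>{0<..}. ereal (\<Sum>k\<le>m. y ^ k * \<bar>(deriv ^^ k) \<zeta> y\<bar>))"

abbreviation sup_norm :: "(real \<Rightarrow> real) \<Rightarrow> ereal" where
  "sup_norm \<equiv> wnorm 0"

definition pairing :: "(real \<Rightarrow> real) \<Rightarrow> (real \<Rightarrow> real) \<Rightarrow> real" where
  "pairing f g = (LBINT y:{0<..}. f y * g y)"

definition nonneg_cont :: "(real \<Rightarrow> real) set" where
  "nonneg_cont = {\<zeta>. continuous_on {0<..} \<zeta> \<and> (\<forall>y>0. 0 \<le> \<zeta> y)}"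

text \<open>
  \<open>I\<close> lives on a convex set rather than on a vector space, so the directional derivative is taken
  along those \<open>\<epsilon>\<close> for which \<open>\<zeta> + \<epsilon>\<phi>\<close> stays in the set: it is two-sided where both signs are
  admissible, one-sided at the boundary, and no condition if only \<open>\<epsilon> = 0\<close> is admissible.
  Directions are bounded, the gradient being an integrable function.
\<close>

definition is_gradient ::
    "((real \<Rightarrow> real) \<Rightarrow> real) \<Rightarrow> ((real \<Rightarrow> real) \<Rightarrow> real \<Rightarrow> real) \<Rightarrow> bool" where
  "is_gradient I dI \<longleftrightarrow>
     (\<forall>\<zeta>\<in>nonneg_cont. \<forall>\<phi>. continuous_on {0<..} \<phi> \<longrightarrow> sup_norm \<phi> < \<infinity> \<longrightarrow>
        ((\<lambda>\<epsilon>. I (\<lambda>y. \<zeta> y + \<epsilon> * \<phi> y)) has_real_derivative pairing (dI \<zeta>) \<phi>)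
          (at 0 within {\<epsilon>. (\<lambda>y. \<zeta> y + \<epsilon> * \<phi> y) \<in> nonneg_cont}))"

definition positive_functional :: "((real \<Rightarrow> real) \<Rightarrow> real) \<Rightarrow> bool" where
  "positive_functional I \<longleftrightarrow> (\<forall>\<zeta>\<in>nonneg_cont. 0 < I \<zeta>)"

definition property_a :: "((real \<Rightarrow> real) \<Rightarrow> real) \<Rightarrow> bool" where
  "property_a I \<longleftrightarrow>
     (\<exists>\<epsilon>0>0. \<forall>\<zeta>1\<in>nonneg_cont. \<forall>\<zeta>2\<in>nonneg_cont. (\<forall>y\<ge>\<epsilon>0. \<zeta>1 y = \<zeta>2 y) \<longrightarrow> I \<zeta>1 = I \<zeta>2)"

text \<open>
  The constant \<open>C\<close> may be taken positive; this keeps the product \<open>C \<cdot> \<infinity>\<close> from being \<open>0\<close> when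
  \<open>\<zeta>1 - \<zeta>2\<close> is unbounded.
\<close>

definition property_b :: "((real \<Rightarrow> real) \<Rightarrow> real \<Rightarrow> real) \<Rightarrow> bool" where
  "property_b dI \<longleftrightarrow>
     (\<forall>\<zeta>\<in>nonneg_cont. set_integrable lborel {0<..} (dI \<zeta>)) \<and>
     (\<exists>C>0. \<forall>\<zeta>1\<in>nonneg_cont. \<forall>\<zeta>2\<in>nonneg_cont.
        ereal (LBINT y:{0<..}. \<bar>dI \<zeta>1 y - dI \<zeta>2 y\<bar>) \<le> ereal C * sup_norm (\<lambda>y. \<zeta>1 y - \<zeta>2 y))"

definition property_c :: "((real \<Rightarrow> real) \<Rightarrow> real) \<Rightarrow> bool" where
  "property_c I \<longleftrightarrow>
     (\<forall>M\<ge>0. \<exists>c>0. \<forall>\<zeta>\<in>nonneg_cont. sup_norm \<zeta> \<le> ereal M \<longrightarrow> c \<le> I \<zeta>)"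

text \<open>
  Non-positivity of the gradient is required almost everywhere, the gradient being an element of
  \<open>L\<^sup>1\<close>. The infimum is taken in the extended reals.
\<close>

definition property_d ::
    "(real \<Rightarrow> real) \<Rightarrow> ((real \<Rightarrow> real) \<Rightarrow> real) \<Rightarrow> ((real \<Rightarrow> real) \<Rightarrow> real \<Rightarrow> real) \<Rightarrow> bool" where
  "property_d h I dI \<longleftrightarrow>
     (\<forall>\<zeta>\<in>nonneg_cont. AE y in lborel. 0 < y \<longrightarrow> dI \<zeta> y \<le> 0) \<and>
     0 < (INF \<zeta>\<in>nonneg_cont. ereal (I \<zeta> + pairing (dI \<zeta>) h))"

definition rho_denom ::
    "real \<Rightarrow> ((real \<Rightarrow> real) \<Rightarrow> real) \<Rightarrow> ((real \<Rightarrow> real) \<Rightarrow> real \<Rightarrow> real) \<Rightarrow> (real \<Rightarrow> real) \<Rightarrow> real" where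
  "rho_denom p I dI \<zeta> = p * I \<zeta> + pairing (dI \<zeta>) (\<lambda>y. \<zeta> y - y * deriv \<zeta> y)"

definition rho ::
    "real \<Rightarrow> (real \<Rightarrow> real) \<Rightarrow> ((real \<Rightarrow> real) \<Rightarrow> real) \<Rightarrow> ((real \<Rightarrow> real) \<Rightarrow> real \<Rightarrow> real) \<Rightarrow>
      (real \<Rightarrow> real) \<Rightarrow> real" where
  "rho p h I dI \<zeta> = (I \<zeta> + pairing (dI \<zeta>) (\<lambda>y. h y + deriv \<zeta> y)) / rho_denom p I dI \<zeta>"

text \<open>
  Classical solutions, with \<open>\<xi> t\<close> the profile \<open>\<xi>(\<cdot>,t)\<close>. The first two conditions keep the profile in
  the domain of \<^const>\<open>rho\<close> and make its norm with \<open>m = 2\<close> meaningful.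
\<close>

definition global_solution ::
    "real \<Rightarrow> (real \<Rightarrow> real) \<Rightarrow> ((real \<Rightarrow> real) \<Rightarrow> real) \<Rightarrow> ((real \<Rightarrow> real) \<Rightarrow> real \<Rightarrow> real) \<Rightarrow>
      (real \<Rightarrow> real \<Rightarrow> real) \<Rightarrow> bool" where
  "global_solution p h I dI \<xi> \<longleftrightarrow>
     (\<forall>t\<ge>0. C_pos 2 (\<xi> t) \<and> (\<forall>y>0. 0 \<le> \<xi> t y)) \<and>
     (\<forall>t\<ge>0. wnorm 1 (\<xi> t) < \<infinity> \<and> 0 < rho_denom p I dI (\<xi> t)) \<and>
     continuous_on ({0..} \<times> {0<..}) (\<lambda>(t, y). \<xi> t y) \<and>
     (\<forall>t>0. \<forall>y>0. (\<lambda>s. \<xi> s y) differentiable (at t) \<and>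
        deriv (\<lambda>s. \<xi> s y) t - h y - deriv (\<xi> t) y
          + rho p h I dI (\<xi> t) * (\<xi> t y - y * deriv (\<xi> t) y) = 0)"

definition xi_stat :: "real \<Rightarrow> (real \<Rightarrow> real) \<Rightarrow> real \<Rightarrow> real" where
  "xi_stat p h y = (p + y) * (LBINT y':{y<..}. p * h y' / (p + y')\<^sup>2)"

end

theory Submission
  imports Defs
begin

text \<open>
  The factor \<open>\<rho>\<close> is chosen so that \<open>d/dt I(\<xi>(t)) = (p \<rho>(t) - 1) I(\<xi>(t))\<close>. Since \<open>I\<close> is bounded above and
  below along the solution, \<open>v(t) = exp (\<integral>\<^sub>0\<^sup>t (\<rho> - 1/p))\<close> stays between two positive constants. Solving the
  transport equation along characteristics turns \<open>v' / v = \<rho> - 1/p\<close> into a Volterra equation, whose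
  right-hand side pairs \<open>- dI(\<xi>(t)) \<ge> 0\<close> with \<open>G = \<xi>/p - (1 + y/p) D\<xi> - h\<close>.

  Up to terms of order \<open>exp (- t/p)\<close>, \<open>G\<close> is an integral of \<open>v(s)/v(t) - 1\<close> over the past against a weight
  between two positive multiples of \<open>exp (- (t - s)/p)\<close>; that the weight is positive uses that \<open>y\<^sup>2 h''\<close>
  is decreasing and that \<open>\<rho> \<ge> 0\<close>. By a maximum principle \<open>v\<close> then converges. Consequently the Volterra equation
  is asymptotically the one linearized at the stationary profile. Its kernel is monotone because
  \<open>y h'' + h' \<ge> 0\<close>, so that a second maximum principle, for \<open>W(t) = \<integral>\<^sub>0\<^sup>t exp (s/p) (\<rho> - 1/p)\<close>, shows that
  \<open>W\<close> grows slower than every exponential. Hence \<open>\<rho> - 1/p = O(exp (- t/q))\<close> for every \<open>q > p\<close>, and the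
  difference \<open>\<xi> - \<xi>\<^sub>p\<close>, which solves a transport equation with a source proportional to \<open>\<rho> - 1/p\<close>, decays at
  the same rate.
\<close>

section \<open>Scalar comparison arguments\<close>

text \<open>The initial profile need not be close to the stationary one, so linearization cannot
  come first: the sign of a variational weight has to replace smallness. Only after \<open>v\<close>
  has converged is the linearized kernel a good approximation, and then with an error
  \<open>\<epsilon> * integral {0..t} (\<lambda>s. \<bar>w s\<bar>)\<close> whose
  \<open>\<epsilon>\<close> tends to zero at no known rate. This is where the rate 1/p is given up
  for every 1/q with q > p; the initial data, transported along characteristics, contribute at order
  exp (- t/p).

  Non-negativity of \<open>\<rho>\<close> comes from property (d) once the profile is known to stay
  decreasing, because then both the gradient and the slope of the profile are non-positive.

  The source \<open>h\<close> and the slopes of a solution may blow up at y = 0, so unweighted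
  bounds hold only away from 0. Property (a) and the sign of \<open>dI\<close> make the gradient
  vanish below some \<open>e0\<close>, and whatever is paired with it matters only for y \<ge>
  \<open>e0\<close>. This is the origin of the factors \<open>1/e0\<close> and \<open>h e0\<close>
  in the constants.\<close>

lemma first_zero:
  fixes u :: "real \<Rightarrow> real"
  assumes "continuous_on {a..b} u" "u a < 0" "t1 \<in> {a..b}" "0 \<le> u t1"
  obtains t where "a < t" "t \<le> b" "u t = 0" "\<And>s. a \<le> s \<Longrightarrow> s < t \<Longrightarrow> u s < 0"
proof -
  let ?Z = "{s \<in> {a..b}. 0 \<le> u s}"
  have "closed ?Z"
    using continuous_on_closed_Collect_le[OF continuous_on_const assms(1)] by simp
  then have "compact ?Z"
    unfolding compact_eq_bounded_closed by (auto intro: bounded_subset[of "{a..b}"])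
  moreover have "?Z \<noteq> {}" using assms by auto
  ultimately obtain t where t: "t \<in> ?Z" "\<And>s. s \<in> ?Z \<Longrightarrow> t \<le> s"
    using compact_attains_inf[of ?Z] by blast
  have neg: "u s < 0" if "a \<le> s" "s < t" for s
    using t(2)[of s] t(1) that by (auto simp: not_le[symmetric])
  have "a < t" using t assms(2) by (cases "t = a") auto
  moreover have "u t = 0"
  proof (rule ccontr)
    assume "u t \<noteq> 0"
    then have "0 < u t" using t by auto
    have "continuous_on {a..t} u"
      using assms(1) t(1) by (auto intro: continuous_on_subset)
    then obtain s where "a \<le> s" "s \<le> t" "u s = 0"
      using IVT'[of u a 0 t] assms(2) \<open>0 < u t\<close> \<open>a < t\<close> by force
    then show False using neg[of s] \<open>0 < u t\<close> by (cases "s = t") auto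
  qed
  ultimately show thesis using that t neg by auto
qed

lemma left_deriv_nonneg:
  fixes u :: "real \<Rightarrow> real"
  assumes "(u has_real_derivative d) (at t)" "u t = 0" "a < t" "\<And>s. a \<le> s \<Longrightarrow> s < t \<Longrightarrow> u s \<le> 0"
  shows "0 \<le> d"
proof (rule ccontr)
  assume "\<not> 0 \<le> d"
  then obtain e where e: "e > 0" "\<And>k. 0 < k \<Longrightarrow> k < e \<Longrightarrow> u t < u (t - k)"
    using DERIV_neg_dec_left[OF assms(1)] by auto
  define k where "k = min (e/2) (t - a)"
  have "0 < k" "k < e" "a \<le> t - k" using e assms(3) by (auto simp: k_def)
  then show False using e(2)[of k] assms(4)[of "t - k"] assms(2) by auto
qed

lemma exp_weight_integral:
  fixes p :: real
  assumes "0 < p" "0 \<le> a" "a \<le> b"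
  shows "((\<lambda>s. exp (-(t - s)/p)) has_integral p * (exp (-(t-b)/p) - exp (-(t-a)/p))) {a..b}"
proof -
  have "((\<lambda>s. exp (-(t - s)/p)) has_integral p * exp (-(t-b)/p) - p * exp (-(t-a)/p)) {a..b}"
  proof (rule fundamental_theorem_of_calculus)
    show "((\<lambda>s. p * exp (-(t-s)/p)) has_vector_derivative exp (-(t - x)/p)) (at x within {a..b})" for x
      unfolding has_real_derivative_iff_has_vector_derivative[symmetric]
      using assms by (auto intro!: derivative_eq_intros simp: field_simps)
  qed (use assms in auto)
  then show ?thesis by (simp add: algebra_simps)
qed

text \<open>\<open>W\<close> is compared with the barrier \<open>M * exp (\<eta> * t)\<close>. At a
  first touching time \<open>\<bar>W\<bar>\<close> is at its running maximum, so the first bound on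
  \<open>w\<close> applies there. The integral of \<open>\<bar>w\<bar>\<close> in it is controlled
  by the second bound, which holds at all times and needs only the barrier for
  \<open>W\<close>.\<close>

lemma volterra_growth:
  fixes W w :: "real \<Rightarrow> real"
  assumes W0: "W 0 = 0"
    and W_deriv: "\<And>t. 0 < t \<Longrightarrow> (W has_real_derivative w t) (at t)"
    and W_cont: "continuous_on {0..} W" and w_cont: "continuous_on {0..} w"
    and D: "0 \<le> D"
    and max_principle: "\<And>\<epsilon>. 0 < \<epsilon> \<Longrightarrow> \<exists>K\<ge>0. \<forall>t\<ge>0.
        ((\<forall>s\<in>{0..t}. \<bar>W s\<bar> \<le> \<bar>W t\<bar>) \<longrightarrow> sgn (W t) * w t \<le> K + \<epsilon> * integral {0..t} (\<lambda>s. \<bar>w s\<bar>)) \<and>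
        (\<forall>m. (\<forall>s\<in>{0..t}. \<bar>W s\<bar> \<le> m) \<longrightarrow> \<bar>w t\<bar> \<le> K + D * m + \<epsilon> * integral {0..t} (\<lambda>s. \<bar>w s\<bar>))"
    and eta: "0 < \<eta>"
  obtains M where "0 \<le> M" "\<And>t. 0 \<le> t \<Longrightarrow> \<bar>w t\<bar> \<le> M * exp (\<eta> * t)"
proof -
  \<comment> \<open>The bound \<eta>/2 lets the integral term be absorbed when \<open>w\<close> is
    estimated in a weighted supremum; the other bound keeps \<open>2 * (\<epsilon> * D)\<close>
    below half of \<eta>^2 at the touching time.\<close>
  define \<epsilon> where "\<epsilon> = min (\<eta>/2) (\<eta>\<^sup>2 / (4 * (D + 1)))"
  have "\<epsilon> \<le> \<eta>/2" unfolding \<epsilon>_def by (rule min.cobounded1)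
  then have eps: "0 < \<epsilon>" "\<epsilon> \<le> \<eta>/2" using D eta by (auto simp: \<epsilon>_def zero_less_divide_iff)
  have "\<epsilon> \<le> \<eta>\<^sup>2 / (4 * (D + 1))" by (simp add: \<epsilon>_def)
  then have "4 * \<epsilon> * (D + 1) \<le> \<eta>\<^sup>2" using D by (simp add: field_simps)
  then have epsD: "4 * (\<epsilon> * D) \<le> \<eta> * \<eta>" using eps by (simp add: algebra_simps power2_eq_square)
  obtain K where K: "K \<ge> 0"
    and max1: "\<And>t. 0 \<le> t \<Longrightarrow> \<forall>s\<in>{0..t}. \<bar>W s\<bar> \<le> \<bar>W t\<bar> \<Longrightarrow> sgn (W t) * w t \<le> K + \<epsilon> * integral {0..t} (\<lambda>s. \<bar>w s\<bar>)"
    and max2: "\<And>t m. 0 \<le> t \<Longrightarrow> \<forall>s\<in>{0..t}. \<bar>W s\<bar> \<le> m \<Longrightarrow> \<bar>w t\<bar> \<le> K + D * m + \<epsilon> * integral {0..t} (\<lambda>s. \<bar>w s\<bar>)"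
    using max_principle[OF eps(1)] by blast
  \<comment> \<open>Touching the barrier will force \<open>M * \<eta> \<le> 4 * K\<close>; the
    summand 1 makes this fail.\<close>
  define M where "M = 4 * K / \<eta> + 1"
  have M: "0 < M" using K eta by (simp add: M_def add_nonneg_pos)
  \<comment> \<open>The factor 2 comes from absorbing \<beta>/2 in
    \<open>\<beta> \<le> K + D * M + \<beta>/2\<close> below.\<close>
  define B where "B = 2 * (K + D * M)"
  have int_exp: "((\<lambda>s. B' * exp (\<eta> * s)) has_integral B' * (exp (\<eta> * t) - 1) / \<eta>) {0..t}" if "0 \<le> t" for t B'
  proof -
    have "((\<lambda>s. B' * exp (\<eta> * s)) has_integral B' * exp (\<eta> * t) / \<eta> - B' * exp (\<eta> * 0) / \<eta>) {0..t}"
      by (rule fundamental_theorem_of_calculus)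
        (use eta that in \<open>auto simp: has_real_derivative_iff_has_vector_derivative[symmetric] intro!: derivative_eq_intros\<close>)
    then show ?thesis by (simp add: algebra_simps diff_divide_distrib)
  qed
  have w_int: "(\<lambda>s. \<bar>w s\<bar>) integrable_on {0..t}" for t
    by (intro integrable_continuous_interval continuous_on_rabs continuous_on_subset[OF w_cont]) auto
  have int_le: "integral {0..t} (\<lambda>s. \<bar>w s\<bar>) \<le> B' * exp (\<eta> * t) / \<eta>"
    if "0 \<le> t" "0 \<le> B'" "\<And>s. s \<in> {0..t} \<Longrightarrow> \<bar>w s\<bar> \<le> B' * exp (\<eta> * s)" for t B'
  proof -
    have "integral {0..t} (\<lambda>s. \<bar>w s\<bar>) \<le> B' * (exp (\<eta> * t) - 1) / \<eta>"
      by (rule has_integral_le[OF integrable_integral[OF w_int] int_exp]) (use that in auto)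
    also have "\<dots> \<le> B' * exp (\<eta> * t) / \<eta>" using eta that by (intro divide_right_mono mult_left_mono) auto
    finally show ?thesis .
  qed
  have w_bound: "\<bar>w s\<bar> \<le> B * exp (\<eta> * s)"
    if s: "0 \<le> s" "s \<le> \<tau>" and Wb: "\<And>s. 0 \<le> s \<Longrightarrow> s \<le> \<tau> \<Longrightarrow> \<bar>W s\<bar> \<le> M * exp (\<eta> * s)" for s \<tau>
  proof -
    have "continuous_on {0..\<tau>} (\<lambda>s. \<bar>w s\<bar> * exp (- \<eta> * s))"
      by (intro continuous_intros continuous_on_subset[OF w_cont]) auto
    moreover have "{0..\<tau>} \<noteq> {}" using s by auto
    ultimately obtain x where x: "x \<in> {0..\<tau>}" "\<And>z. z \<in> {0..\<tau>} \<Longrightarrow> \<bar>w z\<bar> * exp (- \<eta> * z) \<le> \<bar>w x\<bar> * exp (- \<eta> * x)"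
      using continuous_attains_sup[OF compact_Icc] by blast
    \<comment> \<open>The weighted supremum of \<open>\<bar>w\<bar>\<close> over
      \<open>{0..\<tau>}\<close> is attained at \<open>x\<close>, so the pointwise bound at
      \<open>x\<close> closes on \<open>\<beta>\<close> itself.\<close>
    define \<beta> where "\<beta> = \<bar>w x\<bar> * exp (- \<eta> * x)"
    have wz: "\<bar>w z\<bar> \<le> \<beta> * exp (\<eta> * z)" if "z \<in> {0..\<tau>}" for z
      using x(2)[OF that] by (simp add: \<beta>_def exp_minus field_simps)
    have wx: "\<bar>w x\<bar> = \<beta> * exp (\<eta> * x)" by (simp add: \<beta>_def exp_minus)
    have "\<beta> \<ge> 0" by (simp add: \<beta>_def)
    have "\<bar>w x\<bar> \<le> K + D * (M * exp (\<eta> * x)) + \<epsilon> * integral {0..x} (\<lambda>s. \<bar>w s\<bar>)"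
    proof (rule max2)
      show "\<forall>s\<in>{0..x}. \<bar>W s\<bar> \<le> M * exp (\<eta> * x)"
      proof
        fix s assume "s \<in> {0..x}"
        then have "\<bar>W s\<bar> \<le> M * exp (\<eta> * s)" using Wb x by auto
        also have "\<dots> \<le> M * exp (\<eta> * x)" using \<open>s \<in> {0..x}\<close> M eta by auto
        finally show "\<bar>W s\<bar> \<le> M * exp (\<eta> * x)" .
      qed
    qed (use x in auto)
    also have "\<dots> \<le> K * exp (\<eta> * x) + D * (M * exp (\<eta> * x)) + (\<eta>/2) * (\<beta> * exp (\<eta> * x) / \<eta>)"
    proof (intro add_mono order_refl mult_mono)
      show "K \<le> K * exp (\<eta> * x)" using K eta x mult_left_mono[of 1 "exp (\<eta> * x)" K] by auto
      show "integral {0..x} (\<lambda>s. \<bar>w s\<bar>) \<le> \<beta> * exp (\<eta> * x) / \<eta>"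
        by (rule int_le) (use x \<open>\<beta> \<ge> 0\<close> wz in auto)
    qed (use eps eta \<open>\<beta> \<ge> 0\<close> in \<open>auto intro!: integral_nonneg w_int\<close>)
    also have "\<dots> = (K + D * M + \<beta>/2) * exp (\<eta> * x)" using eta by (simp add: field_simps)
    finally have "\<beta> \<le> K + D * M + \<beta>/2" by (simp add: wx)
    then have "\<beta> \<le> B" by (simp add: B_def)
    have "\<bar>w s\<bar> \<le> \<beta> * exp (\<eta> * s)" using wz s by auto
    also have "\<dots> \<le> B * exp (\<eta> * s)" using \<open>\<beta> \<le> B\<close> by auto
    finally show ?thesis .
  qed
  have "\<bar>W t\<bar> < M * exp (\<eta> * t)" if t: "0 \<le> t" for t
  proof (rule ccontr)
    assume neg: "\<not> ?thesis"
    define u where "u = (\<lambda>s. \<bar>W s\<bar> - M * exp (\<eta> * s))"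
    have "continuous_on {0..t} u" unfolding u_def
      by (intro continuous_intros continuous_on_subset[OF W_cont]) auto
    moreover have "u 0 < 0" using M W0 by (simp add: u_def)
    moreover have "0 \<le> u t" using neg by (simp add: u_def)
    ultimately obtain \<tau> where \<tau>: "0 < \<tau>" "u \<tau> = 0" "\<And>s. 0 \<le> s \<Longrightarrow> s < \<tau> \<Longrightarrow> u s < 0"
      using first_zero[of 0 t u t] t by auto
    have Wb: "\<bar>W s\<bar> \<le> M * exp (\<eta> * s)" if "0 \<le> s" "s \<le> \<tau>" for s
      using \<tau>(2) \<tau>(3)[of s] that by (cases "s = \<tau>") (auto simp: u_def)
    have W\<tau>: "\<bar>W \<tau>\<bar> = M * exp (\<eta> * \<tau>)" using \<tau>(2) by (simp add: u_def)
    define \<sigma> where "\<sigma> = sgn (W \<tau>)"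
    have \<sigma>: "\<sigma> * W \<tau> = \<bar>W \<tau>\<bar>" "\<bar>\<sigma>\<bar> \<le> 1" by (auto simp: \<sigma>_def sgn_if)
    have sW: "\<sigma> * W s \<le> \<bar>W s\<bar>" for s
      by (auto simp: \<sigma>_def sgn_if)
    have "0 \<le> \<sigma> * w \<tau> - M * (\<eta> * exp (\<eta> * \<tau>))"
    proof (rule left_deriv_nonneg[where u = "\<lambda>s. \<sigma> * W s - M * exp (\<eta> * s)" and t = \<tau> and a = 0])
      show "((\<lambda>s. \<sigma> * W s - M * exp (\<eta> * s)) has_real_derivative \<sigma> * w \<tau> - M * (\<eta> * exp (\<eta> * \<tau>))) (at \<tau>)"
        by (auto intro!: derivative_eq_intros W_deriv \<tau>)
      show "\<sigma> * W s - M * exp (\<eta> * s) \<le> 0" if "0 \<le> s" "s < \<tau>" for s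
        using \<tau>(3)[OF that] sW[of s] by (auto simp: u_def)
    qed (use \<sigma> W\<tau> \<tau> in auto)
    moreover have "\<sigma> * w \<tau> \<le> K + \<epsilon> * integral {0..\<tau>} (\<lambda>s. \<bar>w s\<bar>)"
      unfolding \<sigma>_def
    proof (rule max1)
      show "\<forall>s\<in>{0..\<tau>}. \<bar>W s\<bar> \<le> \<bar>W \<tau>\<bar>"
      proof
        fix s assume s: "s \<in> {0..\<tau>}"
        then have "\<bar>W s\<bar> \<le> M * exp (\<eta> * s)" using Wb by auto
        also have "\<dots> \<le> M * exp (\<eta> * \<tau>)" using s M eta by auto
        finally show "\<bar>W s\<bar> \<le> \<bar>W \<tau>\<bar>" by (simp add: W\<tau>)
      qed
    qed (use \<tau> in auto)
    moreover have "K + \<epsilon> * integral {0..\<tau>} (\<lambda>s. \<bar>w s\<bar>) \<le> K * exp (\<eta> * \<tau>) + \<epsilon> * (B * exp (\<eta> * \<tau>) / \<eta>)"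
    proof (intro add_mono mult_left_mono)
      show "K \<le> K * exp (\<eta> * \<tau>)" using K eta \<tau> mult_left_mono[of 1 "exp (\<eta> * \<tau>)" K] by auto
      show "integral {0..\<tau>} (\<lambda>s. \<bar>w s\<bar>) \<le> B * exp (\<eta> * \<tau>) / \<eta>"
        by (rule int_le) (use \<tau> w_bound Wb K D M in \<open>auto simp: B_def\<close>)
    qed (use eps in auto)
    ultimately have "M * \<eta> * exp (\<eta> * \<tau>) \<le> (K + \<epsilon> * B / \<eta>) * exp (\<eta> * \<tau>)" by (simp add: algebra_simps)
    then have "M * \<eta> \<le> K + \<epsilon> * B / \<eta>" by simp
    then have "M * \<eta> * \<eta> \<le> K * \<eta> + 2 * \<epsilon> * K + 2 * (\<epsilon> * D) * M"
      using eta by (simp add: field_simps B_def)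
    also have "\<dots> \<le> K * \<eta> + \<eta> * K + (\<eta> * \<eta> / 2) * M"
      using eps K M epsD by (intro add_mono mult_right_mono) auto
    finally have "\<eta> * (M * \<eta>) \<le> \<eta> * (4 * K)" by (simp add: algebra_simps)
    then have "M * \<eta> \<le> 4 * K" using eta by simp
    moreover have "M * \<eta> = 4 * K + \<eta>" using eta by (simp add: M_def distrib_right)
    ultimately show False using eta by simp
  qed
  then have "\<bar>w t\<bar> \<le> B * exp (\<eta> * t)" if "0 \<le> t" for t
    by (rule w_bound[OF that order_refl less_imp_le])
  moreover have "0 \<le> B" using K D M by (simp add: B_def)
  ultimately show thesis using that by blast
qed

section \<open>Convergence from a maximum principle with exponentially fading memory\<close>

lemma exp_weighted_le:
  fixes f :: "real \<Rightarrow> real" and p \<delta> :: real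
  assumes "0 < p" "0 \<le> T" "T \<le> t" "continuous_on {0..t} f" "0 \<le> V" "0 \<le> \<delta>"
    and "\<And>s. 0 \<le> s \<Longrightarrow> s \<le> T \<Longrightarrow> f s \<le> V" "\<And>s. T \<le> s \<Longrightarrow> s \<le> t \<Longrightarrow> f s \<le> \<delta>"
  shows "integral {0..t} (\<lambda>s. exp (-(t-s)/p) * f s) \<le> p * V * exp (-(t-T)/p) + p * \<delta>"
proof -
  have int: "(\<lambda>s. exp (-(t-s)/p) * f s) integrable_on {0..t}"
    using assms by (intro integrable_continuous_interval continuous_intros) auto
  have int0: "(\<lambda>s. exp (-(t-s)/p) * f s) integrable_on {0..T}"
    and int1: "(\<lambda>s. exp (-(t-s)/p) * f s) integrable_on {T..t}"
    using assms(2,3) by (intro integrable_subinterval_real[OF int]; auto)+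
  have "integral {0..t} (\<lambda>s. exp (-(t-s)/p) * f s)
      = integral {0..T} (\<lambda>s. exp (-(t-s)/p) * f s) + integral {T..t} (\<lambda>s. exp (-(t-s)/p) * f s)"
    using Henstock_Kurzweil_Integration.integral_combine[OF assms(2,3) int] by simp
  also have "integral {0..T} (\<lambda>s. exp (-(t-s)/p) * f s) \<le> V * (p * (exp (-(t-T)/p) - exp (-(t-0)/p)))"
    by (rule has_integral_le[OF integrable_integral[OF int0] has_integral_mult_right[OF exp_weight_integral]])
      (use assms in \<open>auto simp: mult.commute[of V]\<close>)
  also have "integral {T..t} (\<lambda>s. exp (-(t-s)/p) * f s) \<le> \<delta> * (p * (exp (-(t-t)/p) - exp (-(t-T)/p)))"
    by (rule has_integral_le[OF integrable_integral[OF int1] has_integral_mult_right[OF exp_weight_integral]])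
      (use assms in \<open>auto simp: mult.commute[of \<delta>]\<close>)
  also have "V * (p * (exp (-(t-T)/p) - exp (-(t-0)/p))) \<le> p * V * exp (-(t-T)/p)"
    using assms by (simp add: algebra_simps)
  also have "\<delta> * (p * (exp (-(t-t)/p) - exp (-(t-T)/p))) \<le> p * \<delta>"
    using assms by (simp add: algebra_simps)
  finally show ?thesis by simp
qed

lemma eventually_exp_small:
  fixes p c :: real
  assumes "0 < p" "0 < c"
  shows "eventually (\<lambda>t. C * exp (-(t - T)/p) \<le> c) at_top"
proof -
  have "filterlim (\<lambda>t. - T + t) at_top at_top"
    by (rule filterlim_tendsto_add_at_top[OF tendsto_const filterlim_ident])
  then have "filterlim (\<lambda>t. (1/p) * (t - T)) at_top at_top"
    using assms by (intro filterlim_tendsto_pos_mult_at_top[OF tendsto_const]) auto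
  then have "filterlim (\<lambda>t. -(t - T)/p) at_bot at_top"
    by (simp add: filterlim_uminus_at_bot minus_divide_left)
  then have "((\<lambda>t. exp (-(t - T)/p)) \<longlongrightarrow> 0) at_top"
    by (rule filterlim_compose[OF exp_at_bot])
  then have "((\<lambda>t. C * exp (-(t - T)/p)) \<longlongrightarrow> 0) at_top"
    by (rule tendsto_mult_right_zero)
  then have "eventually (\<lambda>t. C * exp (-(t - T)/p) < c) at_top"
    using assms by (intro order_tendstoD(2))
  then show ?thesis by (rule eventually_mono) simp
qed

text \<open>Liminf and limsup are formed in \<open>ereal\<close>, where they always exist; the bound
  on \<open>v\<close> makes them real, and the lack of a limit separates them.\<close>

lemma oscillation_limits:
  fixes v :: "real \<Rightarrow> real"
  assumes "\<And>t. 0 \<le> t \<Longrightarrow> \<bar>v t\<bar> \<le> V" "\<nexists>l. (v \<longlongrightarrow> l) at_top"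
  obtains l L where "l < L"
    "\<And>\<epsilon>. 0 < \<epsilon> \<Longrightarrow> eventually (\<lambda>t. l - \<epsilon> < v t) at_top"
    "\<And>\<epsilon>. 0 < \<epsilon> \<Longrightarrow> frequently (\<lambda>t. v t < l + \<epsilon>) at_top"
    "\<And>\<epsilon>. 0 < \<epsilon> \<Longrightarrow> frequently (\<lambda>t. L - \<epsilon> < v t) at_top"
proof -
  let ?v = "\<lambda>t. ereal (v t)"
  have ev: "eventually (\<lambda>t. \<bar>v t\<bar> \<le> V) at_top"
    using assms(1) by (auto simp: eventually_at_top_linorder)
  have lo: "ereal (-V) \<le> Liminf at_top ?v"
    by (rule Liminf_bounded) (use ev in \<open>auto elim!: eventually_mono\<close>)
  have hi: "Limsup at_top ?v \<le> ereal V"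
    by (rule Limsup_bounded) (use ev in \<open>auto elim!: eventually_mono\<close>)
  have le: "Liminf at_top ?v \<le> Limsup at_top ?v"
    by (rule Liminf_le_Limsup) simp
  obtain l where l: "Liminf at_top ?v = ereal l"
    using lo hi le by (cases "Liminf at_top ?v") auto
  obtain L where L: "Limsup at_top ?v = ereal L"
    using lo hi le by (cases "Limsup at_top ?v") auto
  note lL = l L
  have "l \<noteq> L"
  proof
    assume "l = L"
    then have "(?v \<longlongrightarrow> ereal l) at_top"
      using lL by (intro Liminf_eq_Limsup) auto
    then show False using assms(2) by auto
  qed
  then have 1: "l < L" using le lL by auto
  have 2: "eventually (\<lambda>t. l - \<epsilon> < v t) at_top" if "0 < \<epsilon>" for \<epsilon>
    using less_LiminfD[of "ereal (l - \<epsilon>)" at_top ?v] lL that by auto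
  have 3: "frequently (\<lambda>t. v t < l + \<epsilon>) at_top" if "0 < \<epsilon>" for \<epsilon>
  proof (rule ccontr)
    assume "\<not> ?thesis"
    then have "ereal (l + \<epsilon>) \<le> Liminf at_top ?v"
      by (intro Liminf_bounded) (auto simp: frequently_def not_less)
    then show False using lL that by auto
  qed
  have 4: "frequently (\<lambda>t. L - \<epsilon> < v t) at_top" if "0 < \<epsilon>" for \<epsilon>
  proof (rule ccontr)
    assume "\<not> ?thesis"
    then have "Limsup at_top ?v \<le> ereal (L - \<epsilon>)"
      by (intro Limsup_bounded) (auto simp: frequently_def not_less)
    then show False using lL that by auto
  qed
  show thesis by (rule that[OF 1 2 3 4])
qed

lemma frequently_at_top_ge:
  fixes Q :: "real \<Rightarrow> bool"
  assumes "frequently Q at_top"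
  obtains t where "T \<le> t" "Q t"
proof -
  have "frequently (\<lambda>t. T \<le> t \<and> Q t) at_top"
    by (rule frequently_mp[OF eventually_mono[OF eventually_ge_at_top[of T]] assms]) auto
  then show thesis using that by (auto dest: frequently_ex)
qed

text \<open>If \<open>v\<close> oscillated, it would fall to a level near its lower limit l. At a
  time of falling there, the failure of \<open>incr\<close> says that nearly all of the
  exponentially weighted past lies near l. A later climb to l + d/3 would then meet a past lying
  almost entirely below, which \<open>decr\<close> forbids.\<close>

lemma max_principle_convergence:
  fixes v v' :: "real \<Rightarrow> real"
  assumes v_deriv: "\<And>t. 0 < t \<Longrightarrow> (v has_real_derivative v' t) (at t)"
    and v_cont: "continuous_on {0..} v" and v_bound: "\<And>t. 0 \<le> t \<Longrightarrow> \<bar>v t\<bar> \<le> V"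
    and pos: "0 < p" "0 < c" "0 \<le> C"
    and decr: "\<And>t. 0 < t \<Longrightarrow>
      C * integral {0..t} (\<lambda>s. exp (-(t-s)/p) * max 0 (v s - v t)) + C * exp (-t/p)
        \<le> c * integral {0..t} (\<lambda>s. exp (-(t-s)/p) * max 0 (v t - v s)) \<Longrightarrow> v' t \<le> 0"
    and incr: "\<And>t. 0 < t \<Longrightarrow>
      C * integral {0..t} (\<lambda>s. exp (-(t-s)/p) * max 0 (v t - v s)) + C * exp (-t/p)
        \<le> c * integral {0..t} (\<lambda>s. exp (-(t-s)/p) * max 0 (v s - v t)) \<Longrightarrow> 0 \<le> v' t"
  shows "\<exists>l. (v \<longlongrightarrow> l) at_top"
proof (rule ccontr)
  assume no_limit: "\<not> ?thesis"
  obtain l L where lL: "l < L"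
    and low: "\<And>\<epsilon>. 0 < \<epsilon> \<Longrightarrow> eventually (\<lambda>t. l - \<epsilon> < v t) at_top"
    and freq_low: "\<And>\<epsilon>. 0 < \<epsilon> \<Longrightarrow> frequently (\<lambda>t. v t < l + \<epsilon>) at_top"
    and freq_high: "\<And>\<epsilon>. 0 < \<epsilon> \<Longrightarrow> frequently (\<lambda>t. L - \<epsilon> < v t) at_top"
    by (rule oscillation_limits[OF v_bound no_limit]) (assumption | rule that)+
  have cont[continuous_intros]: "continuous_on S v" if "S \<subseteq> {0..}" for S
    using v_cont that by (rule continuous_on_subset)
  have V: "0 \<le> V" using v_bound[of 0] by auto
  define d where "d = L - l"
  \<comment> \<open>\<open>Kp\<close> and \<open>K\<close> are the multiples of \<epsilon> that
    bound \<open>?Jp\<close> and \<open>?Jp + ?Jm\<close> at the time \<open>t1\<close> of descent;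
    \<open>N\<close> collects the coefficients of \<epsilon> in the final comparison inside
    \<open>not_above\<close>.\<close>
  define Kp where "Kp = C / c * (2 * p + 2)"
  define K where "K = Kp + 2 * p + 1"
  define N where "N = C * Kp + C + c * K + c * p / 2"
  have Kp: "0 \<le> Kp" using pos by (simp add: Kp_def)
  have K: "0 < K" using Kp pos by (simp add: K_def)
  have N: "0 < N" using Kp K pos by (simp add: N_def add_nonneg_pos)
  define \<epsilon> where "\<epsilon> = min (d/12) (c * d * p / 6 / N)"
  have d: "0 < d" using lL by (simp add: d_def)
  have eps: "0 < \<epsilon>" using d pos N by (auto simp: \<epsilon>_def)
  have eps_d: "\<epsilon> \<le> d/12" unfolding \<epsilon>_def by (rule min.cobounded1)
  have "\<epsilon> \<le> c * d * p / 6 / N" unfolding \<epsilon>_def by (rule min.cobounded2)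
  then have eps_N: "\<epsilon> * N \<le> c * d * p / 6" using N by (simp add: pos_le_divide_eq)
  obtain T0 where T0: "\<And>t. T0 \<le> t \<Longrightarrow> l - \<epsilon> < v t"
    using low[OF eps] by (auto simp: eventually_at_top_linorder)
  define T where "T = max T0 0"
  have T: "0 \<le> T" "\<And>t. T \<le> t \<Longrightarrow> l - \<epsilon> < v t" using T0 by (auto simp: T_def)
  \<comment> \<open>The bound 1/2 ensures that the weight has mass at least p/2 on
    \<open>{0..t}\<close>.\<close>
  have "eventually (\<lambda>t. 2 * V * p * exp (-(t - T)/p) \<le> \<epsilon> \<and> exp (-t/p) \<le> min \<epsilon> (1/2)) at_top"
    using eventually_exp_small[OF pos(1) eps] eventually_exp_small[OF pos(1), of "min \<epsilon> (1/2)" 1 0] eps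
    by (intro eventually_conj) auto
  then obtain T1 where T1: "\<And>t. t \<ge> T1 \<Longrightarrow> 2 * V * p * exp (-(t - T)/p) \<le> \<epsilon>" "\<And>t. t \<ge> T1 \<Longrightarrow> exp (-t/p) \<le> min \<epsilon> (1/2)"
    unfolding eventually_at_top_linorder by blast
  define T' where "T' = max T1 (T + 1)"
  have T': "T' \<ge> T" "T' > 0"
    "\<And>t. t \<ge> T' \<Longrightarrow> 2 * V * p * exp (-(t - T)/p) \<le> \<epsilon>" "\<And>t. t \<ge> T' \<Longrightarrow> exp (-t/p) \<le> min \<epsilon> (1/2)"
    using T1 T by (auto simp: T'_def)
  obtain ta where ta: "T' \<le> ta" "L - \<epsilon> < v ta"
    by (rule frequently_at_top_ge[OF freq_high[OF eps]])
  obtain tb where tb: "ta \<le> tb" "v tb < l + \<epsilon>"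
    by (rule frequently_at_top_ge[OF freq_low[OF eps]])
  have "l + \<epsilon> < L - \<epsilon>" using eps_d d by (simp add: d_def)
  then have "ta < tb" using ta tb by (cases "ta = tb") auto
  let ?Z = "{s \<in> {ta..tb}. l + \<epsilon> \<le> v s}"
  have "continuous_on {ta..tb} v" using ta T' by (intro cont) auto
  then have "closed ?Z"
    using continuous_on_closed_Collect_le[OF continuous_on_const, of "{ta..tb}" v "l + \<epsilon>"] by auto
  then have "compact ?Z"
    unfolding compact_eq_bounded_closed by (auto intro: bounded_subset[of "{ta..tb}"])
  moreover have "?Z \<noteq> {}" using ta tb \<open>l + \<epsilon> < L - \<epsilon>\<close> by force
  \<comment> \<open>From the last time at level l + \<epsilon> or above, the value drops until
    \<open>tb\<close>. The mean value theorem then yields a time \<open>t1\<close> of negative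
    derivative that already lies below the level.\<close>
  ultimately obtain tc where tc: "tc \<in> ?Z" "\<And>s. s \<in> ?Z \<Longrightarrow> s \<le> tc"
    using compact_attains_sup[of ?Z] by blast
  have "tc < tb" using tc tb by (cases "tc = tb") auto
  have "\<exists>z. z > tc \<and> z < tb \<and> v tb - v tc = (tb - tc) * v' z"
  proof (rule MVT2[OF \<open>tc < tb\<close>, of v v'])
    fix x assume "tc \<le> x" "x \<le> tb"
    then show "(v has_real_derivative v' x) (at x)" using tc(1) ta T' by (intro v_deriv) auto
  qed
  then obtain t1 where t1: "tc < t1" "t1 < tb" "v tb - v tc = (tb - tc) * v' t1" by auto
  have "v tb - v tc < 0" using tc tb by auto
  then have v't1: "v' t1 < 0" using t1 \<open>tc < tb\<close> by (simp add: mult_less_0_iff)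
  have vt1: "v t1 < l + \<epsilon>" using tc(2)[of t1] tc(1) t1 by (auto simp: not_le[symmetric])
  have t1T: "t1 \<ge> T'" using t1 tc ta by auto
  then have t1pos: "0 < t1" using T' by auto
  let ?Jp = "integral {0..t1} (\<lambda>s. exp (-(t1-s)/p) * max 0 (v s - v t1))"
  let ?Jm = "integral {0..t1} (\<lambda>s. exp (-(t1-s)/p) * max 0 (v t1 - v s))"
  have "?Jm \<le> p * (2 * V) * exp (-(t1-T)/p) + p * (2 * \<epsilon>)"
  proof (rule exp_weighted_le)
    show "max 0 (v t1 - v s) \<le> 2 * V" if "0 \<le> s" for s
      using v_bound[of s] v_bound[of t1] that t1pos by auto
    show "max 0 (v t1 - v s) \<le> 2 * \<epsilon>" if "T \<le> s" for s
      using T(2)[OF that] vt1 eps by auto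
  qed (use pos T t1T T' V eps in \<open>auto intro!: continuous_intros\<close>)
  also have "\<dots> \<le> \<epsilon> + p * (2 * \<epsilon>)" using T'(3)[OF t1T] by (simp add: algebra_simps)
  finally have Jm: "?Jm \<le> (2 * p + 1) * \<epsilon>" by (simp add: algebra_simps)
  \<comment> \<open>Contraposition of \<open>incr\<close>: a falling \<open>v\<close> bounds the
    excess \<open>?Jp\<close> by the deficit \<open>?Jm\<close>, which is small because
    \<open>v\<close> has stayed above l - \<epsilon> since \<open>T\<close>.\<close>
  have "c * ?Jp < C * ?Jm + C * exp (-t1/p)"
    using incr[OF t1pos] v't1 by (cases "C * ?Jm + C * exp (-t1/p) \<le> c * ?Jp") auto
  also have "\<dots> \<le> C * ((2 * p + 1) * \<epsilon>) + C * \<epsilon>"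
    using Jm T'(4)[OF t1T] pos by (intro add_mono mult_left_mono) auto
  finally have "c * ?Jp \<le> C * ((2 * p + 2) * \<epsilon>)" by (simp add: algebra_simps)
  then have Jp: "?Jp \<le> Kp * \<epsilon>" using pos by (simp add: Kp_def field_simps)
  have not_above: "v' t \<le> 0" if t: "t1 < t" and ge: "l + d/3 \<le> v t" and mx: "\<And>s. t1 \<le> s \<Longrightarrow> s \<le> t \<Longrightarrow> v s \<le> v t" for t
  proof (rule decr)
    show "0 < t" using t t1pos by auto
    \<comment> \<open>The past before \<open>t1\<close> enters every term with the same factor
      \<open>?e\<close>, so the comparison does not depend on the time elapsed since
      \<open>t1\<close>.\<close>
    let ?e = "exp (-(t-t1)/p)"
    have split: "integral {0..t} (\<lambda>s. exp (-(t-s)/p) * f s)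
        = ?e * integral {0..t1} (\<lambda>s. exp (-(t1-s)/p) * f s) + integral {t1..t} (\<lambda>s. exp (-(t-s)/p) * f s)"
      if "continuous_on {0..t} f" for f :: "real \<Rightarrow> real"
    proof -
      have "integral {0..t} (\<lambda>s. exp (-(t-s)/p) * f s)
        = integral {0..t1} (\<lambda>s. exp (-(t-s)/p) * f s) + integral {t1..t} (\<lambda>s. exp (-(t-s)/p) * f s)"
        using t t1pos that pos
        by (intro Henstock_Kurzweil_Integration.integral_combine[symmetric] integrable_continuous_interval continuous_intros) auto
      also have "integral {0..t1} (\<lambda>s. exp (-(t-s)/p) * f s) = integral {0..t1} (\<lambda>s. ?e * (exp (-(t1-s)/p) * f s))"
        by (rule integral_cong) (simp add: exp_add[symmetric] mult.assoc[symmetric] add_divide_distrib[symmetric])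
      finally show ?thesis by simp
    qed
    have int1: "(\<lambda>s. exp (-(t1-s)/p) * f s) integrable_on {0..t1}" if "continuous_on {0..t1} f" for f :: "real \<Rightarrow> real"
      using that pos by (intro integrable_continuous_interval continuous_intros) auto
    \<comment> \<open>The running maximum at t removes the excess over \<open>{t1..t}\<close>; the
      deficit there is non-negative and is simply dropped in \<open>B\<close>.\<close>
    have "integral {t1..t} (\<lambda>s. exp (-(t-s)/p) * max 0 (v s - v t)) = integral {t1..t} (\<lambda>s. 0)"
      by (rule integral_cong) (use mx in auto)
    then have "integral {0..t} (\<lambda>s. exp (-(t-s)/p) * max 0 (v s - v t))
        = ?e * integral {0..t1} (\<lambda>s. exp (-(t1-s)/p) * max 0 (v s - v t))"
      using split[of "\<lambda>s. max 0 (v s - v t)"] continuous_on_max[OF continuous_on_const continuous_on_diff[OF cont continuous_on_const], of "{0..t}" 0 "v t"]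
      by auto
    also have "\<dots> \<le> ?e * ?Jp"
      using mx[of t1] t by (intro mult_left_mono integral_le int1 continuous_intros) auto
    also have "\<dots> \<le> ?e * (Kp * \<epsilon>)" using Jp by simp
    finally have A: "integral {0..t} (\<lambda>s. exp (-(t-s)/p) * max 0 (v s - v t)) \<le> ?e * (Kp * \<epsilon>)" .
    have B: "?e * ((d/3 - \<epsilon>) * (p/2) - K * \<epsilon>) \<le> integral {0..t} (\<lambda>s. exp (-(t-s)/p) * max 0 (v t - v s))"
    proof -
      have "(d/3 - \<epsilon>) * (p/2) - K * \<epsilon> \<le> (d/3 - \<epsilon>) * (p * (exp (-(t1-t1)/p) - exp (-(t1-0)/p))) - (?Jp + ?Jm)"
      proof (intro diff_mono mult_left_mono)
        show "p/2 \<le> p * (exp (-(t1-t1)/p) - exp (-(t1-0)/p))" using T'(4)[OF t1T] pos by (simp add: field_simps)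
        show "?Jp + ?Jm \<le> K * \<epsilon>" using Jp Jm by (simp add: K_def algebra_simps)
      qed (use eps_d d in auto)
      also have "\<dots> = integral {0..t1} (\<lambda>s. (d/3 - \<epsilon>) * exp (-(t1-s)/p)
          - (exp (-(t1-s)/p) * max 0 (v s - v t1) + exp (-(t1-s)/p) * max 0 (v t1 - v s)))"
        by (rule integral_unique[symmetric, OF has_integral_diff[OF has_integral_mult_right[OF exp_weight_integral]
            has_integral_add[OF integrable_integral[OF int1] integrable_integral[OF int1]]]])
          (use pos t1pos in \<open>auto intro!: continuous_intros\<close>)
      also have "\<dots> \<le> integral {0..t1} (\<lambda>s. exp (-(t1-s)/p) * max 0 (v t - v s))"
      proof (rule integral_le)
        fix s assume "s \<in> {0..t1}"
        have "(d/3 - \<epsilon>) - (max 0 (v s - v t1) + max 0 (v t1 - v s)) \<le> max 0 (v t - v s)"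
          using ge vt1 by (auto simp: max_def)
        from mult_left_mono[OF this, of "exp (-(t1-s)/p)"]
        show "(d/3 - \<epsilon>) * exp (-(t1-s)/p)
          - (exp (-(t1-s)/p) * max 0 (v s - v t1) + exp (-(t1-s)/p) * max 0 (v t1 - v s)) \<le> exp (-(t1-s)/p) * max 0 (v t - v s)"
          by (simp add: algebra_simps)
      qed (use pos in \<open>auto intro!: integrable_continuous_interval continuous_intros\<close>)
      finally have "?e * ((d/3 - \<epsilon>) * (p/2) - K * \<epsilon>) \<le> ?e * integral {0..t1} (\<lambda>s. exp (-(t1-s)/p) * max 0 (v t - v s))"
        by simp
      also have "\<dots> \<le> integral {0..t} (\<lambda>s. exp (-(t-s)/p) * max 0 (v t - v s))"
        using split[of "\<lambda>s. max 0 (v t - v s)"] t1pos pos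
          continuous_on_max[OF continuous_on_const continuous_on_diff[OF continuous_on_const cont], of "{0..t}" 0 "v t"]
        by (auto intro!: continuous_intros integral_nonneg integrable_continuous_interval)
      finally show ?thesis .
    qed
    have "C * integral {0..t} (\<lambda>s. exp (-(t-s)/p) * max 0 (v s - v t)) + C * exp (-t/p)
        \<le> C * (?e * (Kp * \<epsilon>)) + C * (?e * \<epsilon>)"
    proof (intro add_mono mult_left_mono A)
      have "exp (-t/p) = ?e * exp (-t1/p)" by (simp add: exp_add[symmetric] diff_divide_distrib)
      also have "\<dots> \<le> ?e * \<epsilon>" using T'(4)[OF t1T] by simp
      finally show "exp (-t/p) \<le> ?e * \<epsilon>" .
    qed (use pos in auto)
    also have "\<dots> = ?e * (C * (Kp * \<epsilon>) + C * \<epsilon>)" by (simp add: algebra_simps)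
    also have "\<dots> \<le> ?e * (c * ((d/3 - \<epsilon>) * (p/2) - K * \<epsilon>))"
      using eps_N by (intro mult_left_mono) (auto simp: N_def algebra_simps)
    also have "\<dots> \<le> c * integral {0..t} (\<lambda>s. exp (-(t-s)/p) * max 0 (v t - v s))"
      using mult_left_mono[OF B, of c] pos by (simp add: mult.left_commute)
    finally show "C * integral {0..t} (\<lambda>s. exp (-(t-s)/p) * max 0 (v s - v t)) + C * exp (-t/p)
        \<le> c * integral {0..t} (\<lambda>s. exp (-(t-s)/p) * max 0 (v t - v s))" .
  qed
  \<comment> \<open>A barrier of positive slope turns the weak inequality
    \<open>v' \<tau> \<le> 0\<close> at a touching time into a contradiction; afterwards the slope
    is sent to zero.\<close>
  have below: "v t < l + d/3 + \<eta> * (t - t1)" if \<eta>: "0 < \<eta>" and t: "t1 \<le> t" for \<eta> t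
  proof (rule ccontr)
    assume neg: "\<not> ?thesis"
    define u where "u = (\<lambda>s. v s - (l + d/3 + \<eta> * (s - t1)))"
    have "continuous_on {t1..t} u" unfolding u_def using t1pos by (intro continuous_intros) auto
    moreover have "u t1 < 0" using vt1 eps_d d by (simp add: u_def)
    ultimately obtain \<tau> where \<tau>: "t1 < \<tau>" "u \<tau> = 0" "\<And>s. t1 \<le> s \<Longrightarrow> s < \<tau> \<Longrightarrow> u s < 0"
      using first_zero[of t1 t u t] t neg by (auto simp: u_def)
    have "(u has_real_derivative v' \<tau> - \<eta>) (at \<tau>)"
      unfolding u_def using \<tau>(1) t1pos by (auto intro!: derivative_eq_intros v_deriv)
    then have "0 \<le> v' \<tau> - \<eta>"
      using \<tau>(3) by (intro left_deriv_nonneg[where u = u, OF _ \<tau>(2,1)]) (auto intro: less_imp_le)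
    moreover have "v' \<tau> \<le> 0"
    proof (rule not_above[OF \<tau>(1)])
      show "l + d/3 \<le> v \<tau>" using \<tau> \<eta> by (simp add: u_def)
      fix s assume s: "t1 \<le> s" "s \<le> \<tau>"
      show "v s \<le> v \<tau>"
      proof (cases "s = \<tau>")
        case False
        then have "v s \<le> l + d/3 + \<eta> * (s - t1)" using \<tau>(3)[of s] s by (auto simp: u_def)
        also have "\<dots> \<le> l + d/3 + \<eta> * (\<tau> - t1)" using s \<eta> by simp
        finally show ?thesis using \<tau>(2) by (simp add: u_def)
      qed simp
    qed
    ultimately show False using \<eta> by simp
  qed
  have le: "v t \<le> l + d/3" if "t1 \<le> t" for t
  proof (rule field_le_epsilon)
    fix e :: real assume "0 < e"
    define \<eta> where "\<eta> = e / (t - t1 + 1)"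
    have "0 < \<eta>" using \<open>0 < e\<close> that by (auto simp: \<eta>_def)
    moreover have "\<eta> * (t - t1) \<le> \<eta> * (t - t1 + 1)" using calculation by (intro mult_left_mono) auto
    ultimately show "v t \<le> l + d/3 + e" using below[of \<eta> t] that by (auto simp: \<eta>_def)
  qed
  obtain t where "t1 \<le> t" "L - \<epsilon> < v t"
    by (rule frequently_at_top_ge[OF freq_high[OF eps]])
  then have "L - \<epsilon> < l + d/3" using le[of t] by simp
  moreover have "L = l + d" by (simp add: d_def)
  ultimately have "d < d/3 + \<epsilon>" by simp
  also have "\<dots> \<le> d/3 + d/12" using eps_d by simp
  also have "\<dots> \<le> d" using d by simp
  finally show False by simp
qed

section \<open>The source term and the stationary profile\<close>

lemma inverse_square_tail:
  fixes p a :: real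
  assumes "0 < p + a"
  shows "has_bochner_integral lborel (\<lambda>x. indicator {a..} x *\<^sub>R (1 / (p + x)\<^sup>2)) (1 / (p + a))"
proof (rule has_bochner_integral_nn_integral)
  have "(\<integral>\<^sup>+x. ennreal (1 / (p + x)\<^sup>2) * indicator {a..} x \<partial>lborel) = ennreal (0 - (- 1 / (p + a)))"
  proof (rule nn_integral_FTC_atLeast)
    show "((\<lambda>x. - 1 / (p + x)) has_real_derivative 1 / (p + x)\<^sup>2) (at x)" if "a \<le> x" for x
      using assms that by (auto intro!: derivative_eq_intros simp: power2_eq_square)
    have "filterlim (\<lambda>x. p + x) at_top at_top"
      by (rule filterlim_tendsto_add_at_top[OF tendsto_const filterlim_ident])
    then show "((\<lambda>x. - 1 / (p + x)) \<longlongrightarrow> 0) at_top"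
      by (intro real_tendsto_divide_at_top[OF tendsto_const])
  qed auto
  also have "(\<lambda>x. ennreal (1 / (p + x)\<^sup>2) * indicator {a..} x) = (\<lambda>x. ennreal (indicator {a..} x *\<^sub>R (1 / (p + x)\<^sup>2)))"
    by (auto simp: indicator_def)
  finally show "(\<integral>\<^sup>+x. ennreal (indicator {a..} x *\<^sub>R (1 / (p + x)\<^sup>2)) \<partial>lborel) = ennreal (1 / (p + a))" by simp
qed (use assms in auto)

lemma set_integral_mono_subset:
  fixes f :: "'a \<Rightarrow> real"
  assumes "set_integrable M B f" "A \<subseteq> B" "A \<in> sets M" "\<And>x. x \<in> B \<Longrightarrow> 0 \<le> f x"
  shows "set_lebesgue_integral M A f \<le> set_lebesgue_integral M B f"
  unfolding set_lebesgue_integral_def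
  using set_integrable_subset[OF assms(1,3,2)] assms
  by (intro integral_mono) (auto simp: set_integrable_def indicator_def)

locale source =
  fixes p h_inf H :: real and h h1 h2 :: "real \<Rightarrow> real"
  assumes p_pos: "0 < p"
    and h_deriv: "\<And>y. 0 < y \<Longrightarrow> (h has_real_derivative h1 y) (at y)"
    and h1_deriv: "\<And>y. 0 < y \<Longrightarrow> (h1 has_real_derivative h2 y) (at y)"
    and h2_cont: "continuous_on {0<..} h2"
    and h_inf_pos: "0 < h_inf" and h_ge: "\<And>y. 0 < y \<Longrightarrow> h_inf \<le> h y"
    and h1_nonpos: "\<And>y. 0 < y \<Longrightarrow> h1 y \<le> 0"
    and h2_ineq: "\<And>y. 0 < y \<Longrightarrow> 0 \<le> y * h2 y + h1 y"
    and h2_decr: "antimono_on {0<..} (\<lambda>y. y\<^sup>2 * h2 y)"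
    and h1_bound: "\<And>y. 0 < y \<Longrightarrow> y * \<bar>h1 y\<bar> \<le> H"
    and h2_bound: "\<And>y. 0 < y \<Longrightarrow> y\<^sup>2 * \<bar>h2 y\<bar> \<le> H"
    and h_int: "set_integrable lborel {0<..1} h"
begin

lemma h_pos: "0 < y \<Longrightarrow> 0 < h y"
  using h_ge h_inf_pos by (meson less_le_trans)

lemma h2_nonneg: "0 < y \<Longrightarrow> 0 \<le> h2 y"
  using h2_ineq[of y] h1_nonpos[of y] by (smt (verit) mult_neg_pos mult.commute)

lemma H_nonneg: "0 \<le> H"
  using h1_bound[of 1] by auto

lemma h_antimono: "0 < x \<Longrightarrow> x \<le> y \<Longrightarrow> h y \<le> h x"
  by (rule DERIV_nonpos_imp_nonincreasing[of x y h]) (meson h_deriv h1_nonpos less_le_trans)+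

lemma h_cont: "continuous_on {0<..} h" and h1_cont: "continuous_on {0<..} h1"
  by (rule DERIV_continuous_on has_field_derivative_at_within[OF h_deriv] has_field_derivative_at_within[OF h1_deriv]; simp)+

section \<open>The stationary profile as a weighted tail integral of the source\<close>

definition dens :: "real \<Rightarrow> real" where "dens y = p * h y / (p + y)\<^sup>2"

lemma dens_cont: "continuous_on {0<..} dens"
  unfolding dens_def using p_pos by (auto intro!: continuous_intros h_cont)

lemma dens_nonneg: "0 < y \<Longrightarrow> 0 \<le> dens y"
  using h_pos[of y] p_pos by (simp add: dens_def)

lemma dens_meas: "S \<in> sets borel \<Longrightarrow> S \<subseteq> {0<..} \<Longrightarrow> set_borel_measurable lborel S dens"
  using borel_measurable_continuous_on_indicator[of S dens] continuous_on_subset[OF dens_cont]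
  by (simp add: set_borel_measurable_def)

lemma dens_le: "1 \<le> y \<Longrightarrow> dens y \<le> p * h 1 * (1 / (p + y)\<^sup>2)"
  using h_antimono[of 1 y] p_pos by (simp add: dens_def divide_right_mono)

lemma dens_int: "set_integrable lborel {0<..} dens"
proof -
  have "set_integrable lborel {0<..1} dens"
  proof (rule set_integrable_bound[OF set_integrable_mult_right[OF h_int, of "1/p"] dens_meas])
    have "norm (dens x) \<le> norm (1 / p * h x)" if "x \<in> {0<..1}" for x
    proof -
      have "p\<^sup>2 \<le> (p + x)\<^sup>2" using p_pos that by (intro power_mono) auto
      then have "p * h x / (p + x)\<^sup>2 \<le> p * h x / p\<^sup>2"
        using p_pos h_pos[of x] that by (intro divide_left_mono) auto
      then show ?thesis using dens_nonneg[of x] h_pos[of x] p_pos that by (simp add: dens_def power2_eq_square)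
    qed
    then show "AE x in lborel. x \<in> {0<..1} \<longrightarrow> norm (dens x) \<le> norm (1 / p * h x)" by auto
  qed auto
  moreover have "set_integrable lborel {1..} dens"
  proof (rule set_integrable_bound[OF set_integrable_mult_right[of "p * h 1"] dens_meas])
    show "set_integrable lborel {1..} (\<lambda>x. 1 / (p + x)\<^sup>2)"
      using inverse_square_tail[of p 1] p_pos by (auto simp: set_integrable_def has_bochner_integral_iff)
    have "norm (dens x) \<le> norm (p * h 1 * (1 / (p + x)\<^sup>2))" if "x \<in> {1..}" for x
      using dens_le[of x] dens_nonneg[of x] that abs_ge_self[of "p * h 1 * (1 / (p + x)\<^sup>2)"]
      unfolding real_norm_def by simp
    then show "AE x in lborel. x \<in> {1..} \<longrightarrow> norm (dens x) \<le> norm (p * h 1 * (1 / (p + x)\<^sup>2))" by auto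
  qed auto
  ultimately have "set_integrable lborel ({0<..1} \<union> {1..}) dens"
    by (rule set_integrable_Un) auto
  moreover have "{0<..1} \<union> {1..} = {0::real<..}" by auto
  ultimately show ?thesis by simp
qed

lemma dens_int_subset: "0 \<le> y \<Longrightarrow> S \<in> sets borel \<Longrightarrow> S \<subseteq> {y<..} \<Longrightarrow> set_integrable lborel S dens"
  by (rule set_integrable_subset[OF dens_int]) auto

definition tail :: "real \<Rightarrow> real" where "tail y = (LBINT x:{y<..}. dens x)"

lemma xi_stat_eq: "xi_stat p h y = (p + y) * tail y"
  by (simp add: xi_stat_def tail_def dens_def)

lemma tail_deriv:
  assumes "0 < y"
  shows "(tail has_real_derivative - dens y) (at y)"
proof -
  \<comment> \<open>Cutting at a fixed point reduces the unbounded domain to the fundamental theorem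
    on the compact interval \<open>{y/2..b}\<close>.\<close>
  define b where "b = y + 1"
  have sub: "{y/2..b} \<subseteq> {0<..}" using assms by auto
  have eq: "tail x = tail b + integral {x..b} dens" if "x \<in> {y/2..b}" for x
  proof -
    have "tail x = (LBINT u:{x<..b} \<union> {b<..}. dens u)"
      unfolding tail_def using that by (intro arg_cong[where f="\<lambda>S. LBINT u:S. dens u"]) auto
    also have "\<dots> = (LBINT u:{x<..b}. dens u) + tail b"
      unfolding tail_def by (rule set_integral_Un) (use that assms b_def in \<open>auto intro!: dens_int_subset[of 0]\<close>)
    also have "(LBINT u:{x<..b}. dens u) = integral {x<..b} dens"
      by (rule set_borel_integral_eq_integral) (use that assms b_def in \<open>auto intro!: dens_int_subset[of 0]\<close>)
    also have "\<dots> = integral {x..b} dens"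
    proof (rule integral_spike_set)
      show "negligible {u \<in> {x<..b} - {x..b}. dens u \<noteq> 0}" by (rule negligible_subset[of "{x}"]) auto
      show "negligible {u \<in> {x..b} - {x<..b}. dens u \<noteq> 0}" by (rule negligible_subset[of "{x}"]) auto
    qed
    finally show ?thesis by simp
  qed
  have "((\<lambda>x. tail b + integral {x..b} dens) has_real_derivative - dens y) (at y within {y/2..b})"
    using integral_has_real_derivative'[OF continuous_on_subset[OF dens_cont sub], of y] assms
    by (auto intro!: derivative_eq_intros simp: b_def)
  moreover have "at y within {y/2..b} = at y"
    using assms by (intro at_within_interior) (auto simp: b_def)
  ultimately have "((\<lambda>x. tail b + integral {x..b} dens) has_real_derivative - dens y) (at y)" by simp
  then show ?thesis
  proof (rule has_field_derivative_transform_within_open[where S="{y/2<..<b}"])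
    show "y \<in> {y/2<..<b}" using assms by (simp add: b_def)
    show "tail b + integral {x..b} dens = tail x" if "x \<in> {y/2<..<b}" for x
      by (rule eq[symmetric]) (use that in auto)
  qed simp
qed

lemma tail_nonneg: "0 \<le> y \<Longrightarrow> 0 \<le> tail y"
  unfolding tail_def set_lebesgue_integral_def
  by (intro Bochner_Integration.integral_nonneg) (auto simp: indicator_def intro: dens_nonneg)

lemma tail_antimono: "0 \<le> x \<Longrightarrow> x \<le> y \<Longrightarrow> tail y \<le> tail x"
  unfolding tail_def
  by (rule set_integral_mono_subset[OF dens_int_subset[of 0]]) (auto intro!: dens_nonneg)

lemma tail_le: "1 \<le> y \<Longrightarrow> tail y \<le> p * h 1 / (p + y)"
proof -
  assume y: "1 \<le> y"
  have "tail y \<le> (LBINT x:{y..}. p * h 1 * (1 / (p + x)\<^sup>2))"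
  proof -
    have eq: "tail y = (LBINT x:{y..}. dens x)"
      unfolding tail_def set_lebesgue_integral_def
    proof (rule integral_cong_AE)
      show "(\<lambda>x. indicator {y<..} x *\<^sub>R dens x) \<in> borel_measurable lborel"
        using dens_meas[of "{y<..}"] y by (auto simp: set_borel_measurable_def)
      show "(\<lambda>x. indicator {y..} x *\<^sub>R dens x) \<in> borel_measurable lborel"
        using dens_meas[of "{y..}", unfolded set_borel_measurable_def] y by (auto simp: subset_iff)
      show "AE x in lborel. indicator {y<..} x *\<^sub>R dens x = indicator {y..} x *\<^sub>R dens x"
        using AE_lborel_singleton[of y] by eventually_elim (auto simp: indicator_def)
    qed
    show ?thesis unfolding eq
    proof (rule set_integral_mono)
      show "set_integrable lborel {y..} dens" using y by (intro dens_int_subset[of 0]) auto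
      show "set_integrable lborel {y..} (\<lambda>x. p * h 1 * (1 / (p + x)\<^sup>2))"
        using inverse_square_tail[of p y] p_pos y
        by (intro set_integrable_mult_right) (auto simp: set_integrable_def has_bochner_integral_iff)
    qed (use y dens_le in auto)
  qed
  also have "\<dots> = p * h 1 * (LBINT x:{y..}. 1 / (p + x)\<^sup>2)" by (rule set_integral_mult_right)
  also have "(LBINT x:{y..}. 1 / (p + x)\<^sup>2) = 1 / (p + y)"
    using inverse_square_tail[of p y] p_pos y by (simp add: set_lebesgue_integral_def has_bochner_integral_iff)
  finally show ?thesis by simp
qed

abbreviation xi :: "real \<Rightarrow> real" where "xi \<equiv> xi_stat p h"

text \<open>This is the stationary equation with \<open>\<rho>\<close> = 1/p, solved for the
  derivative.\<close>

lemma xi_deriv: "0 < y \<Longrightarrow> (xi has_real_derivative (xi y - p * h y) / (p + y)) (at y)"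
proof -
  assume y: "0 < y"
  have "((\<lambda>y. (p + y) * tail y) has_real_derivative tail y - (p + y) * dens y) (at y)"
    using tail_deriv[OF y] by (auto intro!: derivative_eq_intros)
  moreover have "tail y - (p + y) * dens y = (xi y - p * h y) / (p + y)"
  proof -
    have "(p + y) * dens y = p * h y / (p + y)" using p_pos y by (simp add: dens_def power2_eq_square)
    then show ?thesis using p_pos y by (simp add: xi_stat_eq diff_divide_distrib)
  qed
  moreover have "xi = (\<lambda>y. (p + y) * tail y)" by (simp add: fun_eq_iff xi_stat_eq)
  ultimately show ?thesis by simp
qed

lemma xi_nonneg: "0 < y \<Longrightarrow> 0 \<le> xi y"
  using tail_nonneg[of y] p_pos by (simp add: xi_stat_eq)

definition xi_max :: real where "xi_max = (p + 1) * tail 0 + p * h 1"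

lemma xi_le: "0 < y \<Longrightarrow> xi y \<le> xi_max"
proof -
  assume y: "0 < y"
  have nn: "0 \<le> (p + 1) * tail 0" "0 \<le> p * h 1" using p_pos h_pos[of 1] tail_nonneg[of 0] by auto
  show "xi y \<le> xi_max"
  proof (cases "1 \<le> y")
    case True
    then have "(p + y) * tail y \<le> p * h 1"
      using tail_le[OF True] p_pos by (simp add: field_simps)
    then show ?thesis using nn by (simp add: xi_stat_eq xi_max_def)
  next
    case False
    then have "(p + y) * tail y \<le> (p + 1) * tail 0"
      using y p_pos by (intro mult_mono tail_antimono tail_nonneg) auto
    then show ?thesis using nn by (simp add: xi_stat_eq xi_max_def)
  qed
qed

definition xi1 :: "real \<Rightarrow> real" where "xi1 y = (xi y - p * h y) / (p + y)"

text \<open>Differentiating \<open>(p + y) * xi1 y = xi y - p * h y\<close> produces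
  \<open>xi1 y\<close> on both sides, where it cancels.\<close>

lemma xi1_deriv: "0 < y \<Longrightarrow> (xi1 has_real_derivative - p * h1 y / (p + y)) (at y)"
proof -
  assume y: "0 < y"
  have "((X / c - p * b) * c - X * (0 + 1)) / (c * c) = - p * b / c" if "c \<noteq> 0" for X b c :: real
    using that by (simp add: field_simps)
  from this[of "p + y" "xi y - p * h y" "h1 y"] show ?thesis
    unfolding xi1_def
    by (intro DERIV_cong[OF DERIV_divide[OF DERIV_diff[OF xi_deriv DERIV_cmult[OF h_deriv]] DERIV_add[OF DERIV_const DERIV_ident]]])
      (use p_pos y in auto)
qed

text \<open>For small y, where \<open>h\<close> may be unbounded, monotonicity shows that
  \<open>y * h y\<close> is at most the integral of \<open>h\<close> over
  \<open>{0<..y}\<close>.\<close>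

lemma yh_le: "0 < y \<Longrightarrow> y * h y / (p + y) \<le> h 1 + (LBINT x:{0<..1}. h x) / p"
proof -
  assume y: "0 < y"
  have int_nonneg: "0 \<le> (LBINT x:{0<..1}. h x)"
    unfolding set_lebesgue_integral_def
    by (intro Bochner_Integration.integral_nonneg) (auto simp: indicator_def less_imp_le h_pos)
  show ?thesis
  proof (cases "1 \<le> y")
    case True
    then have "y * h y / (p + y) \<le> h 1"
    proof -
      have "y * h y \<le> y * h 1" using h_antimono[of 1 y] True by auto
      also have "\<dots> \<le> (p + y) * h 1" using p_pos h_pos[of 1] by auto
      finally show ?thesis using p_pos y by (simp add: field_simps)
    qed
    then show ?thesis using int_nonneg p_pos by (simp add: add_increasing2)
  next
    case False
    have "y * h y = (LBINT x:{0<..y}. h y)" using y by (simp add: set_lebesgue_integral_def)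
    also have "\<dots> \<le> (LBINT x:{0<..y}. h x)"
    proof (rule set_integral_mono)
      show "set_integrable lborel {0<..y} h"
        by (rule set_integrable_subset[OF h_int]) (use False in auto)
      show "set_integrable lborel {0<..y} (\<lambda>x. h y)"
        using y by (simp add: set_integrable_def)
    qed (use h_antimono in auto)
    also have "\<dots> \<le> (LBINT x:{0<..1}. h x)"
      by (rule set_integral_mono_subset[OF h_int]) (use False in \<open>auto intro!: less_imp_le[OF h_pos]\<close>)
    finally have "y * h y / (p + y) \<le> (LBINT x:{0<..1}. h x) / p"
      using p_pos y int_nonneg by (intro frac_le) auto
    then show ?thesis using h_pos[of 1] by (simp add: add_increasing)
  qed
qed

text \<open>Replacing 1/p by \<open>\<rho>\<close> in the stationary equation leaves the source
  \<open>- (\<rho> - 1/p) * \<psi>\<close> in the equation for the difference from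
  \<open>xi\<close>. The decay of this difference therefore rests on weighted bounds for
  \<open>\<psi>\<close> and its two derivatives.\<close>

definition \<psi> :: "real \<Rightarrow> real" where "\<psi> y = xi y - y * xi1 y"
definition \<psi>1 :: "real \<Rightarrow> real" where "\<psi>1 y = p * y * h1 y / (p + y)"
definition \<psi>2 :: "real \<Rightarrow> real" where "\<psi>2 y = p / (p + y) * (y * h2 y + p * h1 y / (p + y))"

lemma \<psi>_deriv: "0 < y \<Longrightarrow> (\<psi> has_real_derivative \<psi>1 y) (at y)"
  unfolding \<psi>_def
  by (rule DERIV_cong[OF DERIV_diff[OF xi_deriv DERIV_mult[OF DERIV_ident xi1_deriv]]])
    (simp_all add: \<psi>1_def xi1_def mult_ac)

lemma \<psi>1_deriv: "0 < y \<Longrightarrow> (\<psi>1 has_real_derivative \<psi>2 y) (at y)"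
proof -
  assume y: "0 < y"
  have "((p * 1 * a + b * (p * (c - p))) * c - p * (c - p) * a * (0 + 1)) / (c * c) = p / c * ((c - p) * b + p * a / c)"
    if "c \<noteq> 0" for a b c :: real
    using that by (simp add: field_simps)
  from this[of "p + y" "h1 y" "h2 y"] show ?thesis
    unfolding \<psi>1_def
    by (intro DERIV_cong[OF DERIV_divide[OF DERIV_mult[OF DERIV_cmult[OF DERIV_ident] h1_deriv] DERIV_add[OF DERIV_const DERIV_ident]]])
      (use p_pos y in \<open>auto simp: \<psi>2_def\<close>)
qed

lemma \<psi>_cont: "continuous_on {0<..} \<psi>" and \<psi>1_cont: "continuous_on {0<..} \<psi>1"
  by (rule DERIV_continuous_on has_field_derivative_at_within[OF \<psi>_deriv] has_field_derivative_at_within[OF \<psi>1_deriv]; simp)+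

lemma \<psi>2_cont: "continuous_on {0<..} \<psi>2"
  unfolding \<psi>2_def using p_pos by (auto intro!: continuous_intros h1_cont h2_cont)

text \<open>Eliminating \<open>xi1\<close> exhibits \<open>\<psi>\<close> as a sum of two
  non-negative bounded terms, which its definition as a difference hides.\<close>

lemma \<psi>_eq: "0 < y \<Longrightarrow> \<psi> y = p * xi y / (p + y) + p * (y * h y / (p + y))"
proof -
  assume y: "0 < y"
  have "X - (c - p) * ((X - p * b) / c) = p * X / c + p * ((c - p) * b / c)" if "c \<noteq> 0" for X b c :: real
    using that by (simp add: field_simps)
  from this[of "p + y" "xi y" "h y"] show ?thesis using p_pos y by (simp add: \<psi>_def xi1_def)
qed

lemma \<psi>_nonneg: "0 < y \<Longrightarrow> 0 \<le> \<psi> y"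
  using p_pos xi_nonneg[of y] h_pos[of y] by (simp add: \<psi>_eq)

definition \<psi>_max :: real where "\<psi>_max = xi_max + p * (h 1 + (LBINT x:{0<..1}. h x) / p)"

lemma \<psi>_le: "0 < y \<Longrightarrow> \<psi> y \<le> \<psi>_max"
proof -
  assume y: "0 < y"
  have "p * xi y \<le> (p + y) * xi y" using p_pos y xi_nonneg[OF y] by (simp add: distrib_right)
  then have "p * xi y / (p + y) \<le> xi y" using p_pos y by (simp add: pos_divide_le_eq mult.commute)
  then have "p * xi y / (p + y) \<le> xi_max" using xi_le[OF y] by simp
  then show ?thesis unfolding \<psi>_eq[OF y] \<psi>_max_def
    using mult_left_mono[OF yh_le[OF y], of p] p_pos by (intro add_mono) auto
qed

lemma \<psi>1_bound: "0 < y \<Longrightarrow> y * \<bar>\<psi>1 y\<bar> \<le> p * H"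
proof -
  assume y: "0 < y"
  have "y * \<bar>\<psi>1 y\<bar> = p * (y / (p + y)) * (y * \<bar>h1 y\<bar>)"
    using p_pos y by (simp add: \<psi>1_def abs_mult)
  also have "\<dots> \<le> p * 1 * H"
    using p_pos y h1_bound[OF y] by (intro mult_mono) auto
  finally show ?thesis by simp
qed

lemma \<psi>2_bound: "0 < y \<Longrightarrow> y\<^sup>2 * \<bar>\<psi>2 y\<bar> \<le> 2 * p * H"
proof -
  assume y: "0 < y"
  have "\<bar>\<psi>2 y\<bar> \<le> p / (p + y) * (y * \<bar>h2 y\<bar> + \<bar>h1 y\<bar>)"
  proof -
    have "\<bar>p * h1 y / (p + y)\<bar> \<le> \<bar>h1 y\<bar>" using p_pos y by (simp add: abs_mult field_simps)
    then have "\<bar>y * h2 y + p * h1 y / (p + y)\<bar> \<le> y * \<bar>h2 y\<bar> + \<bar>h1 y\<bar>"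
      using y abs_triangle_ineq[of "y * h2 y" "p * h1 y / (p + y)"] by (simp add: abs_mult)
    then show ?thesis using p_pos y by (simp add: \<psi>2_def abs_mult mult_left_mono divide_right_mono)
  qed
  then have "y\<^sup>2 * \<bar>\<psi>2 y\<bar> \<le> y\<^sup>2 * (p / (p + y) * (y * \<bar>h2 y\<bar> + \<bar>h1 y\<bar>))"
    by (intro mult_left_mono) auto
  also have "\<dots> = p * (y / (p + y)) * (y\<^sup>2 * \<bar>h2 y\<bar> + y * \<bar>h1 y\<bar>)"
    using y p_pos by (simp add: field_simps power2_eq_square)
  also have "\<dots> \<le> p * 1 * (H + H)"
    using p_pos y h1_bound[OF y] h2_bound[OF y] H_nonneg by (intro mult_mono add_mono) auto
  finally show ?thesis by simp
qed

text \<open>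
  Kernel of the equation for \<open>\<rho> - 1/p\<close> linearized at the stationary
  profile, up to the factor \<open>exp (- (t - s)/p)\<close>; see \<open>N\<close> below.
\<close>

definition S :: "real \<Rightarrow> real" where "S y = \<psi> y / p - (1 + y / p) * \<psi>1 y"

lemma S_eq: "0 < y \<Longrightarrow> S y = \<psi> y / p - y * h1 y"
proof -
  assume y: "0 < y"
  have "1 + y / p = (p + y) / p" using p_pos by (simp add: add_divide_distrib)
  then show ?thesis using p_pos y by (simp add: S_def \<psi>1_def)
qed

lemma S_deriv: "0 < y \<Longrightarrow> (S has_real_derivative - p * h1 y / (p + y) - y * h2 y) (at y)"
proof -
  assume y: "0 < y"
  have "((\<lambda>y. \<psi> y / p - y * h1 y) has_real_derivative - p * h1 y / (p + y) - y * h2 y) (at y)"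
  proof (rule DERIV_cong[OF DERIV_diff[OF DERIV_cdivide[OF \<psi>_deriv[OF y]] DERIV_mult[OF DERIV_ident h1_deriv[OF y]]]])
    have "(c - p) * a / c - a = - p * a / c" if "c \<noteq> 0" for a c :: real
      using that by (simp add: field_simps)
    from this[of "p + y" "h1 y"] show "\<psi>1 y / p - (1 * h1 y + h2 y * y) = - p * h1 y / (p + y) - y * h2 y"
      using p_pos y by (simp add: \<psi>1_def)
  qed
  then show ?thesis
    by (rule has_field_derivative_transform_within_open[where S="{0<..}"]) (use y in \<open>auto simp: S_eq\<close>)
qed

text \<open>Since \<open>- h1 y\<close> is non-negative, the factor p/(p + y) < 1 only diminishes
  it, and \<open>h2_ineq\<close> then decides the sign.\<close>

lemma S_deriv_nonpos: "0 < y \<Longrightarrow> - p * h1 y / (p + y) - y * h2 y \<le> 0"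
proof -
  assume y: "0 < y"
  have "- h1 y * (p / (p + y)) \<le> - h1 y * 1"
    using h1_nonpos[OF y] p_pos y by (intro mult_left_mono) auto
  then show ?thesis using h2_ineq[OF y] by (simp add: mult.commute)
qed

lemma S_nonneg: "0 < y \<Longrightarrow> 0 \<le> S y"
  using p_pos divide_nonneg_pos[OF \<psi>_nonneg[of y] p_pos] mult_nonneg_nonpos[OF _ h1_nonpos[of y], of y] by (simp add: S_eq)

definition S_max :: real where "S_max = \<psi>_max / p + H"

lemma S_le: "0 < y \<Longrightarrow> S y \<le> S_max"
proof -
  assume y: "0 < y"
  have "- (y * h1 y) \<le> H" using h1_bound[OF y] h1_nonpos[OF y] by simp
  moreover have "\<psi> y / p \<le> \<psi>_max / p" using \<psi>_le[OF y] p_pos by (simp add: divide_right_mono)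
  ultimately show ?thesis using y by (simp add: S_eq S_max_def)
qed

end

section \<open>Monotone dependence on the past\<close>

context source
begin

text \<open>
  What \<open>h\<close> contributes to \<open>\<xi>/p - (1 + y/p) D\<xi>\<close> at
  \<open>(y, t)\<close> when the growth factor is \<open>b(s) = exp (-
  \<integral>\<^sub>s\<^sup>t \<rho>)\<close>: the characteristic through \<open>(y,
  t)\<close> is then at \<open>(y + \<integral>\<^sub>s\<^sup>t b) / b(s)\<close> at time
  \<open>s\<close>.
\<close>

definition memory :: "real \<Rightarrow> real \<Rightarrow> (real \<Rightarrow> real) \<Rightarrow> real" where
  "memory y t b = integral {0..t} (\<lambda>s. b s * h ((y + integral {s..t} b) / b s) / p
     - (1 + y / p) * h1 ((y + integral {s..t} b) / b s))"

text \<open>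
  Mean value theorem along the segment from \<open>b0\<close> to \<open>b1\<close>: the
  weight \<open>c\<close> is the variational derivative at an intermediate \<open>b\<close>.
  It contains a negative integral of \<open>h''(Y)/b\<close>, which monotonicity of
  \<open>y\<^sup>2 h''\<close> bounds by the positive term \<open>Y h''(Y)/b\<close>,
  because \<open>b/X\<^sup>2\<close> is the derivative of \<open>1/X\<close>.
\<close>

lemma memory_comparison:
  fixes b0 b1 b0' b1' :: "real \<Rightarrow> real"
  assumes t: "0 \<le> t" and y: "0 < y"
    and cont0: "continuous_on {0..t} b0" and cont1: "continuous_on {0..t} b1"
    and pos0: "\<And>s. s \<in> {0..t} \<Longrightarrow> 0 < b0 s" and pos1: "\<And>s. s \<in> {0..t} \<Longrightarrow> 0 < b1 s"
    and end0: "b0 t = 1" and end1: "b1 t = 1"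
    and deriv0: "\<And>s. s \<in> {0<..<t} \<Longrightarrow> (b0 has_real_derivative b0' s) (at s)"
    and deriv1: "\<And>s. s \<in> {0<..<t} \<Longrightarrow> (b1 has_real_derivative b1' s) (at s)"
    and mono0: "\<And>s. s \<in> {0<..<t} \<Longrightarrow> 0 \<le> b0' s" and mono1: "\<And>s. s \<in> {0<..<t} \<Longrightarrow> 0 \<le> b1' s"
  obtains c where "continuous_on {0..t} c"
    "\<And>s. s \<in> {0..t} \<Longrightarrow> h_inf / p \<le> c s" "\<And>s. s \<in> {0..t} \<Longrightarrow> c s \<le> (h y + H) / p + (1 + y / p) * (H / y)"
    "memory y t b1 - memory y t b0 = integral {0..t} (\<lambda>s. c s * (b1 s - b0 s))"
proof -
  define \<beta> where "\<beta> = (\<lambda>s. b1 s - b0 s)"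
  define \<Xi> where "\<Xi> = (\<lambda>s. integral {s..t} \<beta>)"
  define X0 where "X0 = (\<lambda>s. y + integral {s..t} b0)"
  \<comment> \<open>The path from \<open>b0\<close> to \<open>b1\<close>. The rescaled position
    \<open>X\<close> is affine in \<theta> as well, while the position \<open>Y\<close> itself is a
    quotient.\<close>
  define b where "b = (\<lambda>\<theta> s. b0 s + \<theta> * \<beta> s)"
  define X where "X = (\<lambda>\<theta> s. X0 s + \<theta> * \<Xi> s)"
  define Y where "Y = (\<lambda>\<theta> s. X \<theta> s / b \<theta> s)"
  have \<beta>_cont: "continuous_on {0..t} \<beta>" unfolding \<beta>_def by (intro continuous_intros cont0 cont1)
  have b_cont: "continuous_on {0..t} (b \<theta>)" for \<theta>
    unfolding b_def by (intro continuous_intros cont0 \<beta>_cont)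
  have tail_deriv: "((\<lambda>s. integral {s..t} f) has_real_derivative - f s) (at s within {0..t})"
    if "continuous_on {0..t} f" "s \<in> {0..t}" for f s
    using integral_has_real_derivative'[OF that] .
  have tail_cont: "continuous_on {0..t} (\<lambda>s. integral {s..t} f)" if "continuous_on {0..t} f" for f :: "real \<Rightarrow> real"
    by (rule DERIV_continuous_on[OF tail_deriv[OF that]])
  have \<Xi>_cont: "continuous_on {0..t} \<Xi>" unfolding \<Xi>_def by (rule tail_cont[OF \<beta>_cont])
  have X0_cont: "continuous_on {0..t} X0" unfolding X0_def by (intro continuous_intros tail_cont cont0)
  have b_pos: "0 < b \<theta> s" if "\<theta> \<in> {0..1}" "s \<in> {0..t}" for \<theta> s
  proof -
    have "b \<theta> s = (1 - \<theta>) * b0 s + \<theta> * b1 s" by (simp add: b_def \<beta>_def algebra_simps)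
    also have "\<dots> > 0"
      using that pos0[OF that(2)] pos1[OF that(2)]
      by (cases "\<theta> = 0") (auto intro!: add_nonneg_pos)
    finally show ?thesis .
  qed
  have X_eq: "X \<theta> s = y + integral {s..t} (b \<theta>)" if "s \<in> {0..t}" for \<theta> s
  proof -
    have "b0 integrable_on {s..t}" "\<beta> integrable_on {s..t}"
      using that by (auto intro!: integrable_continuous_interval continuous_on_subset[OF cont0] continuous_on_subset[OF \<beta>_cont])
    then show ?thesis
      using integral_add[of b0 "{s..t}" "\<lambda>s. \<theta> * \<beta> s"] integrable_on_mult_right[of \<beta> "{s..t}" \<theta>]
      by (simp add: X_def X0_def \<Xi>_def b_def)
  qed
  have X_ge: "y \<le> X \<theta> s" if "\<theta> \<in> {0..1}" "s \<in> {0..t}" for \<theta> s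
  proof -
    have "0 \<le> integral {s..t} (b \<theta>)"
      using that by (intro integral_nonneg integrable_continuous_interval continuous_on_subset[OF b_cont])
        (auto intro!: less_imp_le[OF b_pos])
    then show ?thesis using X_eq[OF that(2)] by simp
  qed
  have X_pos: "0 < X \<theta> s" if "\<theta> \<in> {0..1}" "s \<in> {0..t}" for \<theta> s using X_ge[OF that] y by simp
  have Y_pos: "0 < Y \<theta> s" if "\<theta> \<in> {0..1}" "s \<in> {0..t}" for \<theta> s
    unfolding Y_def using X_pos[OF that] b_pos[OF that] by simp
  \<comment> \<open>\<open>A\<close> and \<open>B\<close> are the coefficients of
    \<open>\<beta>\<close> and of its tail integral \<open>\<Xi>\<close> in the \<theta>-derivative
    of the integrand \<open>F\<close>.\<close>
  define A where "A = (\<lambda>\<theta> s. (h (Y \<theta> s) - Y \<theta> s * h1 (Y \<theta> s)) / p + (1 + y/p) * (Y \<theta> s * h2 (Y \<theta> s) / b \<theta> s))"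
  define B where "B = (\<lambda>\<theta> s. h1 (Y \<theta> s) / p - (1 + y/p) * (h2 (Y \<theta> s) / b \<theta> s))"
  define F where "F = (\<lambda>\<theta> s. b \<theta> s * h (Y \<theta> s) / p - (1 + y/p) * h1 (Y \<theta> s))"
  have prod_cont: "continuous_on ({0..1} \<times> {0..t}) (\<lambda>z. f (snd z))" if "continuous_on {0..t} f" for f :: "real \<Rightarrow> real"
    by (rule continuous_on_compose2[OF that continuous_on_snd]) auto
  have bb: "continuous_on ({0..1} \<times> {0..t}) (\<lambda>z. b (fst z) (snd z))"
    unfolding b_def by (intro continuous_intros prod_cont cont0 \<beta>_cont)
  have nz: "b (fst z) (snd z) \<noteq> 0" if "z \<in> {0..1} \<times> {0..t}" for z
    using b_pos[of "fst z" "snd z"] that by auto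
  have YY: "continuous_on ({0..1} \<times> {0..t}) (\<lambda>z. Y (fst z) (snd z))"
    unfolding Y_def X_def
    by (intro continuous_intros prod_cont X0_cont \<Xi>_cont bb) (use nz in auto)
  have comp: "continuous_on ({0..1} \<times> {0..t}) (\<lambda>z. f (Y (fst z) (snd z)))" if "continuous_on {0<..} f" for f :: "real \<Rightarrow> real"
    by (rule continuous_on_compose2[OF that YY]) (use Y_pos in auto)
  have AA: "continuous_on ({0..1} \<times> {0..t}) (\<lambda>z. A (fst z) (snd z))"
    unfolding A_def using nz p_pos by (intro continuous_intros comp h_cont h1_cont h2_cont bb YY) auto
  have BB: "continuous_on ({0..1} \<times> {0..t}) (\<lambda>z. B (fst z) (snd z))"
    unfolding B_def using nz p_pos by (intro continuous_intros comp h_cont h1_cont h2_cont bb YY) auto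
  have FF: "continuous_on ({0..1} \<times> {0..t}) (\<lambda>z. F (fst z) (snd z))"
    unfolding F_def using nz p_pos by (intro continuous_intros comp h_cont h1_cont h2_cont bb YY) auto
  have slice: "continuous_on {0..t} (f \<theta>)" if "continuous_on ({0..1} \<times> {0..t}) (\<lambda>z. f (fst z) (snd z))" "\<theta> \<in> {0..1}"
    for f :: "real \<Rightarrow> real \<Rightarrow> real" and \<theta>
  proof -
    have "continuous_on {0..t} (\<lambda>s. (\<theta>, s))" by (intro continuous_intros)
    moreover have "(\<lambda>s. (\<theta>, s)) ` {0..t} \<subseteq> {0..1} \<times> {0..t}" using that(2) by auto
    ultimately have "continuous_on {0..t} (\<lambda>s. (\<lambda>z. f (fst z) (snd z)) (\<theta>, s))"
      by (rule continuous_on_compose2[OF that(1)])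
    then show ?thesis by simp
  qed
  have F_deriv: "((\<lambda>\<theta>. F \<theta> s) has_real_derivative A \<theta> s * \<beta> s + B \<theta> s * \<Xi> s) (at \<theta> within {0..1})"
    if "\<theta> \<in> {0..1}" "s \<in> {0..t}" for \<theta> s
  proof -
    note pos = b_pos[OF that] Y_pos[OF that]
    have dY: "((\<lambda>\<theta>. Y \<theta> s) has_real_derivative (\<Xi> s - Y \<theta> s * \<beta> s) / b \<theta> s) (at \<theta> within {0..1})"
      unfolding Y_def X_def b_def
      using pos(1) unfolding b_def by (auto intro!: derivative_eq_intros simp: field_simps power2_eq_square)
    have db: "((\<lambda>\<theta>. b \<theta> s) has_real_derivative \<beta> s) (at \<theta> within {0..1})"
      unfolding b_def by (auto intro!: derivative_eq_intros)
    have dh: "((\<lambda>\<theta>. h (Y \<theta> s)) has_real_derivative h1 (Y \<theta> s) * ((\<Xi> s - Y \<theta> s * \<beta> s) / b \<theta> s)) (at \<theta> within {0..1})"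
      using DERIV_chain2[OF h_deriv[OF pos(2)] dY] .
    have dh1: "((\<lambda>\<theta>. h1 (Y \<theta> s)) has_real_derivative h2 (Y \<theta> s) * ((\<Xi> s - Y \<theta> s * \<beta> s) / b \<theta> s)) (at \<theta> within {0..1})"
      using DERIV_chain2[OF h1_deriv[OF pos(2)] dY] .
    show ?thesis unfolding F_def
      by (rule DERIV_cong[OF DERIV_diff[OF DERIV_cdivide[OF DERIV_mult[OF db dh]] DERIV_cmult[OF dh1]]])
        (use pos(1) p_pos in \<open>simp add: A_def B_def field_simps\<close>)
  qed
  have memF: "memory y t (b \<theta>) = integral {0..t} (F \<theta>)" for \<theta>
    unfolding memory_def F_def Y_def by (rule integral_cong) (simp add: X_eq)
  have "((\<lambda>\<theta>. integral (cbox 0 t) (F \<theta>)) has_field_derivative integral (cbox 0 t) (\<lambda>s. A \<theta> s * \<beta> s + B \<theta> s * \<Xi> s)) (at \<theta> within {0..1})"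
    if "\<theta> \<in> {0..1}" for \<theta>
  proof (rule leibniz_rule_field_derivative)
    show "continuous_on ({0..1} \<times> cbox 0 t) (\<lambda>(\<theta>, s). A \<theta> s * \<beta> s + B \<theta> s * \<Xi> s)"
      unfolding split_beta box_real by (intro continuous_intros AA BB prod_cont \<beta>_cont \<Xi>_cont)
    show "F \<theta> integrable_on cbox 0 t" if "\<theta> \<in> {0..1}" for \<theta>
      unfolding box_real by (intro integrable_continuous_interval slice[OF FF that])
  qed (use F_deriv that in auto)
  then have "\<exists>\<theta>\<in>{0..1}. integral (cbox 0 t) (F 1) - integral (cbox 0 t) (F 0)
      = integral (cbox 0 t) (\<lambda>s. A \<theta> s * \<beta> s + B \<theta> s * \<Xi> s) * (1 - 0)"
    unfolding has_field_derivative_def by (intro mvt_very_simple) auto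
  then obtain \<theta> where \<theta>: "\<theta> \<in> {0..1}"
    and diff: "memory y t (b 1) - memory y t (b 0) = integral {0..t} (\<lambda>s. A \<theta> s * \<beta> s + B \<theta> s * \<Xi> s)"
    unfolding memF by auto
  have b01: "b 1 = b1" "b 0 = b0" by (auto simp: b_def \<beta>_def)
  define R where "R = (\<lambda>\<tau>. integral {0..\<tau>} (B \<theta>))"
  note B_cont = slice[OF BB \<theta>] and A_cont = slice[OF AA \<theta>] and Y_cont = slice[OF YY \<theta>]
  have R_deriv: "(R has_real_derivative B \<theta> s) (at s within {0..t})" if "s \<in> {0..t}" for s
    unfolding R_def by (rule integral_has_real_derivative[OF B_cont that])
  have R_cont: "continuous_on {0..t} R" by (rule DERIV_continuous_on[OF R_deriv])
  \<comment> \<open>Integration by parts trades the tail integral \<open>\<Xi>\<close> for the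
    primitive \<open>R\<close> of \<open>B \<theta>\<close>. The boundary terms vanish because
    \<open>R 0 = 0\<close> and \<open>\<Xi> t = 0\<close>, so that \<open>A \<theta> + R\<close>
    becomes a weight for \<open>\<beta>\<close> alone.\<close>
  have parts: "((\<lambda>s. B \<theta> s * \<Xi> s + - \<beta> s * R s) has_integral R t * \<Xi> t - R 0 * \<Xi> 0) {0..t}"
  proof (rule fundamental_theorem_of_calculus)
    fix s assume s: "s \<in> {0..t}"
    show "((\<lambda>s. R s * \<Xi> s) has_vector_derivative B \<theta> s * \<Xi> s + - \<beta> s * R s) (at s within {0..t})"
      unfolding has_real_derivative_iff_has_vector_derivative[symmetric] \<Xi>_def
      by (rule DERIV_mult[OF R_deriv[OF s] tail_deriv[OF \<beta>_cont s]])
  qed (use t in auto)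
  have R0: "R 0 = 0" "\<Xi> t = 0" by (auto simp: R_def \<Xi>_def)
  define c where "c = (\<lambda>s. A \<theta> s + R s)"
  have c_cont: "continuous_on {0..t} c" unfolding c_def by (intro continuous_intros A_cont R_cont)
  have "integral {0..t} (\<lambda>s. A \<theta> s * \<beta> s + B \<theta> s * \<Xi> s)
      = integral {0..t} (\<lambda>s. c s * \<beta> s + (B \<theta> s * \<Xi> s + - \<beta> s * R s))"
    by (rule integral_cong) (simp add: c_def algebra_simps)
  also have "\<dots> = integral {0..t} (\<lambda>s. c s * \<beta> s) + 0"
    using parts R0 by (subst integral_add)
      (auto intro!: integrable_continuous_interval continuous_intros c_cont \<beta>_cont simp: integral_unique has_integral_integrable)
  finally have c_eq: "memory y t b1 - memory y t b0 = integral {0..t} (\<lambda>s. c s * (b1 s - b0 s))"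
    using diff b01 by (simp add: \<beta>_def)
  \<comment> \<open>Monotonicity of the growth factors enters here: as s increases, positions move
    towards 0 with speed at least 1.\<close>
  define b' where "b' = (\<lambda>s. (1 - \<theta>) * b0' s + \<theta> * b1' s)"
  have b'_nonneg: "0 \<le> b' s" if "s \<in> {0<..<t}" for s
    using mono0[OF that] mono1[OF that] \<theta> by (auto simp: b'_def)
  have at_in: "at s within {0..t} = at s" if "s \<in> {0<..<t}" for s
    using that by (intro at_within_interior) auto
  have b_deriv: "(b \<theta> has_real_derivative b' s) (at s)" if "s \<in> {0<..<t}" for s
    unfolding b_def \<beta>_def b'_def using deriv0[OF that] deriv1[OF that]
    by (auto intro!: derivative_eq_intros simp: algebra_simps)
  have X_deriv: "(X \<theta> has_real_derivative - b \<theta> s) (at s within {0..t})" if "s \<in> {0..t}" for s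
    unfolding X_def X0_def \<Xi>_def b_def
    by (rule DERIV_cong[OF DERIV_add[OF DERIV_add[OF DERIV_const tail_deriv[OF cont0 that]] DERIV_cmult[OF tail_deriv[OF \<beta>_cont that]]]]) simp
  have Y_deriv: "(Y \<theta> has_real_derivative - 1 - X \<theta> s * b' s / (b \<theta> s * b \<theta> s)) (at s)" if s: "s \<in> {0<..<t}" for s
  proof -
    have s': "s \<in> {0..t}" using s by auto
    have "(X \<theta> has_real_derivative - b \<theta> s) (at s)" using X_deriv[OF s'] at_in[OF s] by simp
    from DERIV_divide[OF this b_deriv[OF s]] b_pos[OF \<theta> s'] show ?thesis
      unfolding Y_def by (auto simp: field_simps)
  qed
  have Y_anti: "Y \<theta> s' \<le> Y \<theta> s" if "0 \<le> s" "s \<le> s'" "s' \<le> t" for s s'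
  proof (rule DERIV_nonpos_imp_decreasing_open[OF that(2)])
    fix x assume x: "s < x" "x < s'"
    have "0 \<le> X \<theta> x * b' x / (b \<theta> x * b \<theta> x)"
      using X_pos[OF \<theta>, of x] b'_nonneg[of x] x that by auto
    then show "\<exists>y. (Y \<theta> has_real_derivative y) (at x) \<and> y \<le> 0"
      using Y_deriv[of x] x that by (intro exI[of _ "- 1 - X \<theta> x * b' x / (b \<theta> x * b \<theta> x)"]) auto
  qed (use that in \<open>auto intro: continuous_on_subset[OF Y_cont]\<close>)
  have Yt: "Y \<theta> t = y" using end0 end1 t by (simp add: Y_def X_def X0_def \<Xi>_def b_def \<beta>_def)
  define k where "k = (\<lambda>s. (Y \<theta> s)\<^sup>2 * h2 (Y \<theta> s))"
  have k_mono: "k s \<le> k s'" if "0 \<le> s" "s \<le> s'" "s' \<le> t" for s s'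
    unfolding k_def using monotone_onD[OF h2_decr, of "Y \<theta> s'" "Y \<theta> s"] Y_anti[OF that] Y_pos[OF \<theta>] that by auto
  have k_bounds: "0 \<le> k s" "k s \<le> H" if "s \<in> {0..t}" for s
    using h2_bound[OF Y_pos[OF \<theta> that]] h2_nonneg[OF Y_pos[OF \<theta> that]] by (auto simp: k_def)
  have kX: "Y \<theta> s * h2 (Y \<theta> s) / b \<theta> s = k s / X \<theta> s" "h2 (Y \<theta> s) / b \<theta> s = k s * (b \<theta> s / (X \<theta> s)\<^sup>2)" if "s \<in> {0..t}" for s
    using b_pos[OF \<theta> that] X_pos[OF \<theta> that] by (auto simp: k_def Y_def field_simps power2_eq_square)
  have hY_cont: "continuous_on {0..t} (\<lambda>s. f (Y \<theta> s))" if "continuous_on {0<..} f" for f :: "real \<Rightarrow> real"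
    by (rule continuous_on_compose2[OF that Y_cont]) (use Y_pos[OF \<theta>] in auto)
  have b_nz: "b \<theta> s \<noteq> 0" if "s \<in> {0..t}" for s using b_pos[OF \<theta> that] by simp
  \<comment> \<open>Because Y' \<le> -1 and \<open>h1 \<le> 0\<close>, the gain of \<open>h\<close>
    along the path makes up for the integral of \<open>h1\<close>. The sum is non-decreasing, and at
    time 0 it is at least \<open>h_inf\<close>.\<close>
  have first: "h_inf \<le> h (Y \<theta> \<tau>) + integral {0..\<tau>} (\<lambda>s. h1 (Y \<theta> s))" if \<tau>: "\<tau> \<in> {0..t}" for \<tau>
  proof -
    let ?R = "\<lambda>\<tau>. integral {0..\<tau>} (\<lambda>s. h1 (Y \<theta> s))"
    have dR: "(?R has_real_derivative h1 (Y \<theta> s)) (at s within {0..t})" if "s \<in> {0..t}" for s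
      by (rule integral_has_real_derivative[OF hY_cont[OF h1_cont] that])
    have "h (Y \<theta> 0) + ?R 0 \<le> h (Y \<theta> \<tau>) + ?R \<tau>"
    proof (rule DERIV_nonneg_imp_increasing_open[of 0 \<tau>])
      fix s assume s: "0 < s" "s < \<tau>"
      then have s': "s \<in> {0<..<t}" "s \<in> {0..t}" using \<tau> by auto
      have "((\<lambda>s. h (Y \<theta> s) + ?R s) has_real_derivative
          h1 (Y \<theta> s) * (- 1 - X \<theta> s * b' s / (b \<theta> s * b \<theta> s)) + h1 (Y \<theta> s)) (at s)"
        using dR[OF s'(2)] at_in[OF s'(1)]
        by (intro DERIV_add DERIV_chain2[OF h_deriv[OF Y_pos[OF \<theta> s'(2)]] Y_deriv[OF s'(1)]]) auto
      moreover have "h1 (Y \<theta> s) * (- 1 - X \<theta> s * b' s / (b \<theta> s * b \<theta> s)) + h1 (Y \<theta> s) = - h1 (Y \<theta> s) * (X \<theta> s * b' s / (b \<theta> s * b \<theta> s))"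
        by (simp add: algebra_simps)
      moreover have "0 \<le> - h1 (Y \<theta> s) * (X \<theta> s * b' s / (b \<theta> s * b \<theta> s))"
        using h1_nonpos[OF Y_pos[OF \<theta> s'(2)]] X_pos[OF \<theta> s'(2)] b'_nonneg[OF s'(1)] by (intro mult_nonneg_nonneg) auto
      ultimately show "\<exists>y. ((\<lambda>s. h (Y \<theta> s) + ?R s) has_real_derivative y) (at s) \<and> 0 \<le> y" by metis
    qed (use \<tau> in \<open>auto intro!: continuous_intros continuous_on_subset[OF hY_cont[OF h_cont]]
        continuous_on_subset[OF DERIV_continuous_on[OF dR]]\<close>)
    moreover have "h_inf \<le> h (Y \<theta> 0)" using h_ge[OF Y_pos[OF \<theta>, of 0]] t by auto
    ultimately show ?thesis by simp
  qed
  \<comment> \<open>\<open>k\<close> is non-decreasing in s, hence may be frozen at its final value;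
    what is left is the exact integral of b/X^2.\<close>
  have second: "integral {0..\<tau>} (\<lambda>s. h2 (Y \<theta> s) / b \<theta> s) \<le> k \<tau> / X \<theta> \<tau>" if \<tau>: "\<tau> \<in> {0..t}" for \<tau>
  proof -
    have "((\<lambda>s. b \<theta> s / (X \<theta> s)\<^sup>2) has_integral 1 / X \<theta> \<tau> - 1 / X \<theta> 0) {0..\<tau>}"
    proof (rule fundamental_theorem_of_calculus)
      fix s assume s: "s \<in> {0..\<tau>}"
      have "((\<lambda>s. 1 / X \<theta> s) has_real_derivative b \<theta> s / (X \<theta> s)\<^sup>2) (at s within {0..\<tau>})"
        using DERIV_divide[OF DERIV_const[of 1] DERIV_subset[OF X_deriv], of s "{0..\<tau>}"] s \<tau> X_pos[OF \<theta>, of s]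
        by (auto simp: power2_eq_square)
      then show "((\<lambda>s. 1 / X \<theta> s) has_vector_derivative b \<theta> s / (X \<theta> s)\<^sup>2) (at s within {0..\<tau>})"
        by (simp add: has_real_derivative_iff_has_vector_derivative)
    qed (use \<tau> in auto)
    then have major: "((\<lambda>s. k \<tau> * (b \<theta> s / (X \<theta> s)\<^sup>2)) has_integral k \<tau> * (1 / X \<theta> \<tau> - 1 / X \<theta> 0)) {0..\<tau>}"
      by (rule has_integral_mult_right)
    have minor: "continuous_on {0..\<tau>} (\<lambda>s. h2 (Y \<theta> s) / b \<theta> s)"
      using \<tau> b_nz by (intro continuous_intros continuous_on_subset[OF hY_cont[OF h2_cont]] continuous_on_subset[OF b_cont]) auto
    have "integral {0..\<tau>} (\<lambda>s. h2 (Y \<theta> s) / b \<theta> s) \<le> k \<tau> * (1 / X \<theta> \<tau> - 1 / X \<theta> 0)"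
    proof (rule has_integral_le[OF integrable_integral[OF integrable_continuous_interval[OF minor]] major])
      fix s assume s: "s \<in> {0..\<tau>}"
      then show "h2 (Y \<theta> s) / b \<theta> s \<le> k \<tau> * (b \<theta> s / (X \<theta> s)\<^sup>2)"
        using \<tau> b_pos[OF \<theta>, of s] mult_right_mono[OF k_mono[of s \<tau>], of "b \<theta> s / (X \<theta> s)\<^sup>2"] by (subst kX) auto
    qed
    also have "\<dots> \<le> k \<tau> * (1 / X \<theta> \<tau>)"
      using k_bounds[OF \<tau>] X_pos[OF \<theta>, of 0] t by (intro mult_left_mono) auto
    finally show ?thesis by simp
  qed
  have R_split: "R \<tau> = integral {0..\<tau>} (\<lambda>s. h1 (Y \<theta> s)) / p - (1 + y/p) * integral {0..\<tau>} (\<lambda>s. h2 (Y \<theta> s) / b \<theta> s)"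
    if \<tau>: "\<tau> \<in> {0..t}" for \<tau>
  proof -
    have "(\<lambda>s. h1 (Y \<theta> s)) integrable_on {0..\<tau>}" "(\<lambda>s. h2 (Y \<theta> s) / b \<theta> s) integrable_on {0..\<tau>}"
      using \<tau> b_nz by (auto intro!: integrable_continuous_interval continuous_intros
        continuous_on_subset[OF hY_cont[OF h2_cont]] continuous_on_subset[OF hY_cont[OF h1_cont]] continuous_on_subset[OF b_cont])
    from integral_diff[OF integrable_on_mult_right[OF this(1), of "1/p"] integrable_on_mult_right[OF this(2), of "1 + y/p"]]
    show ?thesis unfolding R_def B_def by (simp add: integral_mult_right[symmetric] del: integral_mult_right)
  qed
  have c_split: "c s = (h (Y \<theta> s) - Y \<theta> s * h1 (Y \<theta> s)) / p + (1 + y/p) * (k s / X \<theta> s) + R s" if "s \<in> {0..t}" for s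
    unfolding c_def A_def kX(1)[OF that] by simp
  have yp: "0 < 1 + y/p" using y p_pos by (simp add: add_pos_pos)
  have lower: "h_inf / p \<le> c s" if s: "s \<in> {0..t}" for s
  proof -
    have "Y \<theta> s * h1 (Y \<theta> s) \<le> 0" using Y_pos[OF \<theta> s] h1_nonpos[OF Y_pos[OF \<theta> s]] by (intro mult_nonneg_nonpos) auto
    then have "h_inf / p \<le> (h (Y \<theta> s) - Y \<theta> s * h1 (Y \<theta> s) + integral {0..s} (\<lambda>s. h1 (Y \<theta> s))) / p"
      using first[OF s] p_pos by (intro divide_right_mono) auto
    moreover have "(1 + y/p) * integral {0..s} (\<lambda>s. h2 (Y \<theta> s) / b \<theta> s) \<le> (1 + y/p) * (k s / X \<theta> s)"
      using second[OF s] yp by (intro mult_left_mono) auto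
    ultimately show ?thesis unfolding c_split[OF s] R_split[OF s] by (simp add: add_divide_distrib)
  qed
  \<comment> \<open>For the upper bound \<open>R\<close> is dropped altogether, both of its parts
    being non-positive.\<close>
  have upper: "c s \<le> (h y + H) / p + (1 + y/p) * (H / y)" if s: "s \<in> {0..t}" for s
  proof -
    note pos = Y_pos[OF \<theta> s]
    have "R s \<le> integral {0..s} (\<lambda>_. 0)"
      unfolding R_def
    proof (rule integral_le)
      fix u assume u: "u \<in> {0..s}"
      then have u': "u \<in> {0..t}" using s by auto
      have "0 \<le> (1 + y/p) * (h2 (Y \<theta> u) / b \<theta> u)"
        using yp h2_nonneg[OF Y_pos[OF \<theta> u']] b_pos[OF \<theta> u'] by auto
      moreover have "h1 (Y \<theta> u) / p \<le> 0" using h1_nonpos[OF Y_pos[OF \<theta> u']] p_pos by (simp add: divide_nonpos_pos)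
      ultimately show "B \<theta> u \<le> 0" by (simp add: B_def)
    qed (use s in \<open>auto intro!: integrable_continuous_interval continuous_on_subset[OF B_cont]\<close>)
    moreover have "h (Y \<theta> s) \<le> h y" using h_antimono[OF y, of "Y \<theta> s"] Y_anti[of s t] Yt s by auto
    moreover have "- (Y \<theta> s * h1 (Y \<theta> s)) \<le> H" using h1_bound[OF pos] h1_nonpos[OF pos] by simp
    ultimately have 1: "R s \<le> 0" "(h (Y \<theta> s) - Y \<theta> s * h1 (Y \<theta> s)) / p \<le> (h y + H) / p"
      using p_pos by (auto intro!: divide_right_mono)
    have "k s / X \<theta> s \<le> H / y"
      using k_bounds[OF s] X_ge[OF \<theta> s] y H_nonneg by (intro frac_le) auto
    then have "(1 + y/p) * (k s / X \<theta> s) \<le> (1 + y/p) * (H / y)" using yp by (intro mult_left_mono) auto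
    with 1 show ?thesis unfolding c_split[OF s] by simp
  qed
  show thesis by (rule that[OF c_cont lower upper c_eq])
qed

text \<open>For the stationary growth factor the integrand is the s-derivative of
  \<open>exp (-(t-s)/p) * h (Y s)\<close>, so only two endpoint values remain.\<close>

lemma memory_exp:
  assumes t: "0 \<le> t" and y: "0 < y"
  shows "memory y t (\<lambda>s. exp (-(t-s)/p)) = h y - exp (-t/p) * h ((y + p) * exp (t/p) - p)"
proof -
  define Y where "Y = (\<lambda>s. (y + p) * exp ((t-s)/p) - p)"
  have Y_pos: "0 < Y s" if "s \<le> t" for s
  proof -
    have "(y + p) * 1 \<le> (y + p) * exp ((t-s)/p)" using that y p_pos by (intro mult_left_mono) auto
    then show ?thesis using y by (simp add: Y_def)
  qed
  have inv: "exp (-(t-s)/p) * exp ((t-s)/p) = 1" for s by (simp add: exp_add[symmetric] diff_divide_distrib)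
  have Y_eq: "(y + integral {s..t} (\<lambda>s. exp (-(t-s)/p))) / exp (-(t-s)/p) = Y s" if "s \<in> {0..t}" for s
  proof -
    have "integral {s..t} (\<lambda>s. exp (-(t-s)/p)) = p * (1 - exp (-(t-s)/p))"
      using exp_weight_integral[OF p_pos, of s t t] that by (auto simp: integral_unique)
    then show ?thesis using inv[of s] by (simp add: Y_def exp_minus field_simps)
  qed
  have "((\<lambda>s. exp (-(t-s)/p) * h (Y s) / p - (1 + y / p) * h1 (Y s)) has_integral
      exp (-(t-t)/p) * h (Y t) - exp (-(t-0)/p) * h (Y 0)) {0..t}"
  proof (rule fundamental_theorem_of_calculus)
    fix s assume s: "s \<in> {0..t}"
    have dY: "(Y has_real_derivative - (y + p) * exp ((t-s)/p) / p) (at s within {0..t})"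
      unfolding Y_def using p_pos by (auto intro!: derivative_eq_intros simp: field_simps)
    have dE: "((\<lambda>s. exp (-(t-s)/p)) has_real_derivative exp (-(t-s)/p) / p) (at s within {0..t})"
      using p_pos by (auto intro!: derivative_eq_intros)
    have "exp (-(t-s)/p) / p * h (Y s) + h1 (Y s) * (- (y + p) * exp ((t-s)/p) / p) * exp (-(t-s)/p)
        = exp (-(t-s)/p) * h (Y s) / p - (1 + y/p) * h1 (Y s) * (exp (-(t-s)/p) * exp ((t-s)/p))"
      using p_pos by (simp add: field_simps)
    then have "((\<lambda>s. exp (-(t-s)/p) * h (Y s)) has_real_derivative exp (-(t-s)/p) * h (Y s) / p - (1 + y / p) * h1 (Y s)) (at s within {0..t})"
      using DERIV_mult[OF dE DERIV_chain2[OF h_deriv[OF Y_pos] dY]] s inv[of s] by simp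
    then show "((\<lambda>s. exp (-(t-s)/p) * h (Y s)) has_vector_derivative exp (-(t-s)/p) * h (Y s) / p - (1 + y / p) * h1 (Y s)) (at s within {0..t})"
      by (simp add: has_real_derivative_iff_has_vector_derivative)
  qed (use t in auto)
  then have "integral {0..t} (\<lambda>s. exp (-(t-s)/p) * h (Y s) / p - (1 + y / p) * h1 (Y s))
      = h y - exp (-t/p) * h ((y + p) * exp (t/p) - p)"
    by (simp add: integral_unique Y_def)
  then show ?thesis unfolding memory_def using Y_eq
    by (subst integral_cong[where g = "\<lambda>s. exp (-(t-s)/p) * h (Y s) / p - (1 + y / p) * h1 (Y s)"]) auto
qed

end

section \<open>Characteristics\<close>

text \<open>The weight \<open>c\<close> is known only through its two bounds, so \<open>f\<close> is
  split by sign and each bound is used against the part for which it points the right way.\<close>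

lemma integrals_nonneg_mult_split:
  fixes f g c :: "real \<Rightarrow> real"
  assumes f: "continuous_on {a..b} f" and g: "continuous_on {a..b} g" and c: "continuous_on {a..b} c"
    and g0: "\<And>s. s \<in> {a..b} \<Longrightarrow> 0 \<le> g s"
    and lo: "\<And>s. s \<in> {a..b} \<Longrightarrow> l \<le> c s" and hi: "\<And>s. s \<in> {a..b} \<Longrightarrow> c s \<le> u"
  shows "integral {a..b} (\<lambda>s. c s * (g s * f s))
      \<le> u * integral {a..b} (\<lambda>s. g s * max 0 (f s)) - l * integral {a..b} (\<lambda>s. g s * max 0 (- f s))"
    "l * integral {a..b} (\<lambda>s. g s * max 0 (f s)) - u * integral {a..b} (\<lambda>s. g s * max 0 (- f s))
      \<le> integral {a..b} (\<lambda>s. c s * (g s * f s))"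
proof -
  have int: "(\<lambda>s. k * (g s * max 0 (f s)) - m * (g s * max 0 (- f s))) integrable_on {a..b}"
    "(\<lambda>s. g s * max 0 (f s)) integrable_on {a..b}" "(\<lambda>s. g s * max 0 (- f s)) integrable_on {a..b}"
    "(\<lambda>s. c s * (g s * f s)) integrable_on {a..b}" for k m
    by (intro integrable_continuous_interval continuous_intros f g c)+
  have eq: "k * integral {a..b} (\<lambda>s. g s * max 0 (f s)) - m * integral {a..b} (\<lambda>s. g s * max 0 (- f s))
    = integral {a..b} (\<lambda>s. k * (g s * max 0 (f s)) - m * (g s * max 0 (- f s)))" for k m
    using int(2,3) by (subst integral_diff) (auto intro: integrable_on_mult_right)
  have key: "c s * (g s * f s) = c s * (g s * max 0 (f s)) - c s * (g s * max 0 (- f s))" for s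
    by (auto simp: max_def)
  show "integral {a..b} (\<lambda>s. c s * (g s * f s))
      \<le> u * integral {a..b} (\<lambda>s. g s * max 0 (f s)) - l * integral {a..b} (\<lambda>s. g s * max 0 (- f s))"
    unfolding eq
  proof (rule integral_le[OF int(4) int(1)])
    fix s assume s: "s \<in> {a..b}"
    show "c s * (g s * f s) \<le> u * (g s * max 0 (f s)) - l * (g s * max 0 (- f s))"
      unfolding key using g0[OF s] lo[OF s] hi[OF s] by (intro diff_mono mult_right_mono) auto
  qed
  show "l * integral {a..b} (\<lambda>s. g s * max 0 (f s)) - u * integral {a..b} (\<lambda>s. g s * max 0 (- f s))
      \<le> integral {a..b} (\<lambda>s. c s * (g s * f s))"
    unfolding eq
  proof (rule integral_le[OF int(1) int(4)])
    fix s assume s: "s \<in> {a..b}"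
    show "l * (g s * max 0 (f s)) - u * (g s * max 0 (- f s)) \<le> c s * (g s * f s)"
      unfolding key using g0[OF s] lo[OF s] hi[OF s] by (intro diff_mono mult_right_mono) auto
  qed
qed

lemma antiderivative_from_zero:
  fixes f :: "real \<Rightarrow> real"
  assumes f: "continuous_on {0..} f"
  shows "continuous_on {0..} (\<lambda>t. integral {0..t} f)"
    "0 < t \<Longrightarrow> ((\<lambda>t. integral {0..t} f) has_real_derivative f t) (at t)"
    "0 \<le> s \<Longrightarrow> s \<le> t \<Longrightarrow> integral {0..t} f - integral {0..s} f = integral {s..t} f"
proof -
  have d: "((\<lambda>t. integral {0..t} f) has_real_derivative f t) (at t within {0..b})" if "0 \<le> t" "t \<le> b" for t b
    using f that by (intro integral_has_real_derivative) (auto intro: continuous_on_subset)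
  have at: "at t within {0..t+1} = at t" if "0 < t" for t :: real
    using that by (intro at_within_interior) auto
  show D: "((\<lambda>t. integral {0..t} f) has_real_derivative f t) (at t)" if "0 < t" for t
    using d[of t "t+1"] at[OF that] that by auto
  show "continuous_on {0..} (\<lambda>t. integral {0..t} f)"
    unfolding continuous_on_eq_continuous_within
  proof
    fix t :: real assume "t \<in> {0..}"
    then consider "0 < t" | "t = 0" by fastforce
    then show "continuous (at t within {0..}) (\<lambda>t. integral {0..t} f)"
    proof cases
      case 1
      then show ?thesis using DERIV_isCont[OF D[OF 1]] continuous_at_imp_continuous_at_within by blast
    next
      case 2
      have "continuous (at 0 within {0..1}) (\<lambda>t. integral {0..t} f)"
        using has_field_derivative_imp_has_derivative[OF d[of 0 1]] has_derivative_continuous by auto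
      moreover have "at 0 within {0..1} = at (0::real) within {0..}"
        by (rule at_within_nhd[of _ "{..<1}"]) auto
      ultimately show ?thesis using 2 by simp
    qed
  qed
  show "0 \<le> s \<Longrightarrow> s \<le> t \<Longrightarrow> integral {0..t} f - integral {0..s} f = integral {s..t} f"
    using Henstock_Kurzweil_Integration.integral_combine[of 0 s t f]
      integrable_continuous_interval[OF continuous_on_subset[OF f], of 0 t] by auto
qed

locale flow = source +
  fixes \<rho> :: "real \<Rightarrow> real"
  assumes \<rho>_cont: "continuous_on {0..} \<rho>"
begin

text \<open>
  \<open>Y t y s\<close> is the position at time \<open>s\<close> of the characteristic that
  reaches \<open>y\<close> at time \<open>t\<close>; \<open>P t * y + Q t\<close> is its
  starting point.
\<close>

definition P :: "real \<Rightarrow> real" where "P t = exp (integral {0..t} \<rho>)"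
definition Q :: "real \<Rightarrow> real" where "Q t = integral {0..t} P"
definition Y :: "real \<Rightarrow> real \<Rightarrow> real \<Rightarrow> real" where "Y t y s = (P t * y + Q t - Q s) / P s"
definition v :: "real \<Rightarrow> real" where "v t = P t * exp (- t / p)"
definition \<omega> :: "real \<Rightarrow> real" where "\<omega> t = \<rho> t - 1 / p"

lemma P_0 [simp]: "P 0 = 1" and P_pos [simp]: "0 < P t" and P_nz [simp]: "P t \<noteq> 0"
  by (auto simp: P_def)

lemma P_cont: "continuous_on {0..} P"
  unfolding P_def by (intro continuous_intros antiderivative_from_zero \<rho>_cont)

lemma P_deriv: "0 < t \<Longrightarrow> (P has_real_derivative \<rho> t * P t) (at t)"
  unfolding P_def by (auto intro!: derivative_eq_intros antiderivative_from_zero(2)[OF \<rho>_cont])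

lemma Q_0 [simp]: "Q 0 = 0"
  by (simp add: Q_def)

lemma Q_cont: "continuous_on {0..} Q" and Q_deriv: "0 < t \<Longrightarrow> (Q has_real_derivative P t) (at t)"
  and Q_diff: "0 \<le> s \<Longrightarrow> s \<le> t \<Longrightarrow> Q t - Q s = integral {s..t} P"
  unfolding Q_def using antiderivative_from_zero[OF P_cont] by auto

lemma Q_mono: "0 \<le> s \<Longrightarrow> s \<le> t \<Longrightarrow> Q s \<le> Q t"
  using Q_diff[of s t] integral_nonneg[OF integrable_continuous_interval[OF continuous_on_subset[OF P_cont]], of s t]
  by (auto simp: less_imp_le)

lemma Y_end [simp]: "Y t y t = y" and Y_start: "Y t y 0 = P t * y + Q t"
  by (auto simp: Y_def)

lemma PY_ge: "0 \<le> s \<Longrightarrow> s \<le> t \<Longrightarrow> P t * y \<le> P s * Y t y s"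
  using Q_mono[of s t] by (simp add: Y_def)

lemma Y_pos: "0 < y \<Longrightarrow> 0 \<le> s \<Longrightarrow> s \<le> t \<Longrightarrow> 0 < Y t y s"
  using PY_ge[of s t y] by (metis P_pos less_le_trans mult_pos_pos zero_less_mult_pos)

lemma Y_cont: "continuous_on {0..t} (Y t y)"
  unfolding Y_def
  by (intro continuous_intros continuous_on_subset[OF P_cont] continuous_on_subset[OF Q_cont]) auto

lemma Y_deriv: "0 < s \<Longrightarrow> (Y t y has_real_derivative - 1 - \<rho> s * Y t y s) (at s)"
  unfolding Y_def
  by (rule DERIV_cong[OF DERIV_divide[OF DERIV_diff[OF DERIV_const Q_deriv] P_deriv]]) (auto simp: field_simps)

lemma v_pos [simp]: "0 < v t"
  by (simp add: v_def)

lemma v_nonneg [simp]: "0 \<le> v t" and v_nz [simp]: "v t \<noteq> 0" and P_nonneg [simp]: "0 \<le> P t"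
  using v_pos[of t] P_pos[of t] by (auto simp del: v_pos P_pos)

lemma v_cont: "continuous_on {0..} v"
  unfolding v_def using p_pos by (intro continuous_intros P_cont) auto

lemma v_deriv: "0 < t \<Longrightarrow> (v has_real_derivative \<omega> t * v t) (at t)"
  unfolding v_def using p_pos
  by (auto intro!: derivative_eq_intros P_deriv simp: \<omega>_def algebra_simps)

text \<open>The growth ratio splits into its stationary value and a correction by \<open>v\<close>;
  every comparison with the stationary flow starts here.\<close>

lemma P_ratio: "P s / P t = exp (-(t-s)/p) * (v s / v t)"
  by (simp add: v_def exp_minus diff_divide_distrib exp_diff field_simps)

lemma \<omega>_cont: "continuous_on {0..} \<omega>"
  unfolding \<omega>_def by (intro continuous_intros \<rho>_cont)

end

section \<open>Two-sided bounds on the memory term\<close>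

locale bounded_flow = flow +
  fixes vl vu :: real
  assumes \<rho>_nonneg: "\<And>t. 0 \<le> t \<Longrightarrow> 0 \<le> \<rho> t"
    and vl_pos: "0 < vl" and v_ge: "\<And>t. 0 \<le> t \<Longrightarrow> vl \<le> v t" and v_le: "\<And>t. 0 \<le> t \<Longrightarrow> v t \<le> vu"
begin

text \<open>Upper bound for the weight of \<open>memory_comparison\<close> that is uniform in y
  \<ge> \<epsilon>.\<close>

definition Cm :: "real \<Rightarrow> real" where "Cm \<epsilon> = (h \<epsilon> + H) / p + H / \<epsilon> + H / p"

definition Jp :: "real \<Rightarrow> real" where "Jp t = integral {0..t} (\<lambda>s. exp (-(t-s)/p) * max 0 (v s - v t))"
definition Jm :: "real \<Rightarrow> real" where "Jm t = integral {0..t} (\<lambda>s. exp (-(t-s)/p) * max 0 (v t - v s))"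

abbreviation mem :: "real \<Rightarrow> real \<Rightarrow> real" where "mem y t \<equiv> memory y t (\<lambda>s. P s / P t)"

text \<open>By \<open>P_ratio\<close> the growth factor differs from the stationary one by the
  exponential weight times \<open>(v s - v t) / v t\<close>, and the weight of
  \<open>memory_comparison\<close> lies between \<open>h_inf / p\<close> and
  \<open>Cm \<epsilon>\<close>. The remainder in \<open>memory_exp\<close> is non-negative and
  enters with a minus sign, hence only the lower bound carries it.\<close>

lemma memory_bounds:
  assumes \<epsilon>: "0 < \<epsilon>" "\<epsilon> \<le> y" and t: "0 \<le> t"
  shows "mem y t - h y \<le> (Cm \<epsilon> * Jp t - h_inf / p * Jm t) / v t"
    "(h_inf / p * Jp t - Cm \<epsilon> * Jm t) / v t - exp (-t/p) * h \<epsilon> \<le> mem y t - h y"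
proof -
  have y: "0 < y" using \<epsilon> by simp
  have Pc: "continuous_on {0..t} P" by (rule continuous_on_subset[OF P_cont]) auto
  obtain c where c: "continuous_on {0..t} c"
    "\<And>s. s \<in> {0..t} \<Longrightarrow> h_inf / p \<le> c s" "\<And>s. s \<in> {0..t} \<Longrightarrow> c s \<le> (h y + H) / p + (1 + y / p) * (H / y)"
    and diff: "mem y t - memory y t (\<lambda>s. exp (-(t-s)/p))
        = integral {0..t} (\<lambda>s. c s * (P s / P t - exp (-(t-s)/p)))"
  proof (rule memory_comparison[OF t y, where ?b0.0 = "\<lambda>s. exp (-(t-s)/p)" and ?b1.0 = "\<lambda>s. P s / P t"])
    show "((\<lambda>s. P s / P t) has_real_derivative \<rho> s * P s / P t) (at s)" if "s \<in> {0<..<t}" for s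
      using that by (intro DERIV_cdivide P_deriv) auto
    show "((\<lambda>s. exp (-(t-s)/p)) has_real_derivative exp (-(t-s)/p) / p) (at s)" for s
      using p_pos by (auto intro!: derivative_eq_intros)
    show "0 \<le> \<rho> s * P s / P t" if "s \<in> {0<..<t}" for s
      using that \<rho>_nonneg[of s] by (auto intro!: divide_nonneg_pos mult_nonneg_nonneg less_imp_le[OF P_pos])
  qed (use p_pos Pc in \<open>auto intro!: continuous_intros\<close>)
  have c_le: "c s \<le> Cm \<epsilon>" if "s \<in> {0..t}" for s
  proof -
    have "(h y + H) / p + (1 + y / p) * (H / y) = (h y + H) / p + H / y + H / p"
      using y p_pos by (simp add: field_simps)
    also have "\<dots> \<le> Cm \<epsilon>" unfolding Cm_def
      using h_antimono[OF \<epsilon>] \<epsilon> p_pos H_nonneg y by (intro add_mono divide_right_mono divide_left_mono) auto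
    finally show ?thesis using c(3)[OF that] by simp
  qed
  have "integral {0..t} (\<lambda>s. c s * (P s / P t - exp (-(t-s)/p)))
      = integral {0..t} (\<lambda>s. c s * (exp (-(t-s)/p) * (v s - v t)) / v t)"
    by (rule integral_cong) (simp add: P_ratio field_simps less_imp_neq[OF v_pos, symmetric])
  also have "\<dots> = integral {0..t} (\<lambda>s. c s * (exp (-(t-s)/p) * (v s - v t))) / v t" by simp
  finally have eq: "mem y t - h y = integral {0..t} (\<lambda>s. c s * (exp (-(t-s)/p) * (v s - v t))) / v t
      - exp (-t/p) * h ((y + p) * exp (t/p) - p)"
    using diff memory_exp[OF t y] by simp
  have vc: "continuous_on {0..t} (\<lambda>s. v s - v t)"
    by (intro continuous_intros continuous_on_subset[OF v_cont]) auto
  have ec: "continuous_on {0..t} (\<lambda>s. exp (-(t-s)/p))" using p_pos by (intro continuous_intros) auto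
  note bounds = integrals_nonneg_mult_split[OF vc ec c(1), of "h_inf/p" "Cm \<epsilon>"]
  have J: "Jp t = integral {0..t} (\<lambda>s. exp (-(t-s)/p) * max 0 (v s - v t))"
    "Jm t = integral {0..t} (\<lambda>s. exp (-(t-s)/p) * max 0 (- (v s - v t)))"
    by (auto simp: Jp_def Jm_def)
  have ge: "y \<le> (y + p) * exp (t/p) - p"
  proof -
    have "0 \<le> t / p" using t p_pos by simp
    then have "1 \<le> exp (t/p)" by simp
    then have "(y + p) * 1 \<le> (y + p) * exp (t/p)" using y p_pos by (intro mult_left_mono) auto
    then show ?thesis by simp
  qed
  have "0 \<le> exp (-t/p) * h ((y + p) * exp (t/p) - p)" using h_pos ge y by (auto simp: less_imp_le)
  moreover have "exp (-t/p) * h ((y + p) * exp (t/p) - p) \<le> exp (-t/p) * h \<epsilon>"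
    using ge \<epsilon> h_antimono[of \<epsilon> "(y + p) * exp (t/p) - p"] by (intro mult_left_mono) auto
  moreover have "integral {0..t} (\<lambda>s. c s * (exp (-(t-s)/p) * (v s - v t))) / v t \<le> (Cm \<epsilon> * Jp t - h_inf / p * Jm t) / v t"
    unfolding J by (intro divide_right_mono bounds) (use c c_le in \<open>auto simp: less_imp_le\<close>)
  moreover have "(h_inf / p * Jp t - Cm \<epsilon> * Jm t) / v t \<le> integral {0..t} (\<lambda>s. c s * (exp (-(t-s)/p) * (v s - v t))) / v t"
    unfolding J by (intro divide_right_mono bounds) (use c c_le in \<open>auto simp: less_imp_le\<close>)
  ultimately show "mem y t - h y \<le> (Cm \<epsilon> * Jp t - h_inf / p * Jm t) / v t"
    "(h_inf / p * Jp t - Cm \<epsilon> * Jm t) / v t - exp (-t/p) * h \<epsilon> \<le> mem y t - h y"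
    unfolding eq by linarith+
qed

end

section \<open>Differentiation in space and along characteristics\<close>

context flow
begin

lemma flow_leibniz:
  fixes f f' c :: "real \<Rightarrow> real"
  assumes f: "\<And>z. 0 < z \<Longrightarrow> (f has_real_derivative f' z) (at z)" and f': "continuous_on {0<..} f'"
    and c: "continuous_on {0..t} c" and y: "0 < y"
  shows "((\<lambda>y. integral {0..t} (\<lambda>s. c s * f (Y t y s))) has_real_derivative
      integral {0..t} (\<lambda>s. c s * (P t / P s) * f' (Y t y s))) (at y)"
proof -
  have f_cont: "continuous_on {0<..} f"
    by (rule DERIV_continuous_on[OF has_field_derivative_at_within[OF f]]) auto
  have Yp: "0 < Y t y s" if "0 < y" "s \<in> {0..t}" for y s using Y_pos[OF that(1)] that(2) by auto
  have prod_cont: "continuous_on ({0<..} \<times> {0..t}) (\<lambda>z. g (snd z))" if "continuous_on {0..t} g" for g :: "real \<Rightarrow> real"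
    by (rule continuous_on_compose2[OF that continuous_on_snd]) auto
  have Pc: "continuous_on {0..t} P" and Qc: "continuous_on {0..t} Q"
    by (rule continuous_on_subset[OF P_cont] continuous_on_subset[OF Q_cont]; auto)+
  have YY: "continuous_on ({0<..} \<times> {0..t}) (\<lambda>z. Y t (fst z) (snd z))"
    unfolding Y_def by (intro continuous_intros prod_cont Pc Qc) auto
  have "((\<lambda>y. integral (cbox 0 t) (\<lambda>s. c s * f (Y t y s))) has_field_derivative
      integral (cbox 0 t) (\<lambda>s. c s * (P t / P s) * f' (Y t y s))) (at y within {0<..})"
  proof (rule leibniz_rule_field_derivative)
    show "((\<lambda>y. c s * f (Y t y s)) has_real_derivative c s * (P t / P s) * f' (Y t y s)) (at y within {0<..})"
      if "y \<in> {0<..}" "s \<in> cbox 0 t" for y s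
    proof -
      have "((\<lambda>y. Y t y s) has_real_derivative P t / P s) (at y)"
        unfolding Y_def by (auto intro!: derivative_eq_intros)
      from DERIV_cmult[OF DERIV_chain2[OF f[OF Yp] this], where c = "c s"] that
      show ?thesis by (auto intro!: has_field_derivative_at_within simp: mult_ac)
    qed
    show "(\<lambda>s. c s * f (Y t y s)) integrable_on cbox 0 t" if "y \<in> {0<..}" for y
      using that Yp unfolding box_real
      by (intro integrable_continuous_interval continuous_intros c continuous_on_compose2[OF f_cont Y_cont]) auto
    show "continuous_on ({0<..} \<times> cbox 0 t) (\<lambda>(y, s). c s * (P t / P s) * f' (Y t y s))"
      unfolding split_beta box_real
      by (intro continuous_intros prod_cont c Pc continuous_on_compose2[OF f' YY]) (use Yp in auto)
  qed (use y in auto)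
  then show ?thesis using y at_within_open[of y "{0<..}"] by auto
qed

end

text \<open>Joint differentiability of \<open>F\<close> is not assumed. The increment in space is
  taken at the moving time \<tau> by the mean value theorem, and joint continuity of
  \<open>Fy\<close> makes its intermediate slope converge; the increment in time is then needed only
  at the fixed point \<open>g s\<close>.\<close>

lemma DERIV_chain_partials:
  fixes F Fy :: "real \<Rightarrow> real \<Rightarrow> real"
  assumes g: "(g has_real_derivative g') (at s)"
    and Ft: "((\<lambda>\<tau>. F \<tau> (g s)) has_real_derivative a) (at s)"
    and U: "open U" "(s, g s) \<in> U"
    and Fy: "\<And>\<tau> y. (\<tau>, y) \<in> U \<Longrightarrow> (F \<tau> has_real_derivative Fy \<tau> y) (at y)"
    and Fy_cont: "continuous_on U (\<lambda>(\<tau>, y). Fy \<tau> y)"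
  shows "((\<lambda>\<tau>. F \<tau> (g \<tau>)) has_real_derivative a + Fy s (g s) * g') (at s)"
proof -
  obtain A B where "open A" "open B" "(s, g s) \<in> A \<times> B" "A \<times> B \<subseteq> U"
    by (rule open_prod_elim[OF U])
  then have AB: "open A" "open B" "s \<in> A" "g s \<in> B" "A \<times> B \<subseteq> U" by auto
  obtain e where e: "0 < e" "cball (g s) e \<subseteq> B" using open_contains_cball AB(2,4) by blast
  have g_isCont: "isCont g s" using g by (rule DERIV_isCont)
  have near: "eventually (\<lambda>\<tau>. \<tau> \<in> A \<and> \<bar>g \<tau> - g s\<bar> < d) (at s)" if "0 < d" for d
  proof -
    have "eventually (\<lambda>\<tau>. \<tau> \<in> A) (at s)" using AB by (intro eventually_at_in_open') auto
    moreover have "eventually (\<lambda>\<tau>. dist (g \<tau>) (g s) < d) (at s)"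
      using g_isCont that by (auto simp: isCont_def tendsto_iff)
    ultimately show ?thesis by eventually_elim (auto simp: dist_real_def)
  qed
  define z where "z \<tau> = (SOME z. \<bar>z - g s\<bar> \<le> \<bar>g \<tau> - g s\<bar> \<and> F \<tau> (g \<tau>) - F \<tau> (g s) = Fy \<tau> z * (g \<tau> - g s))" for \<tau>
  have z: "\<bar>z \<tau> - g s\<bar> \<le> \<bar>g \<tau> - g s\<bar> \<and> F \<tau> (g \<tau>) - F \<tau> (g s) = Fy \<tau> (z \<tau>) * (g \<tau> - g s)"
    if tA: "\<tau> \<in> A" and tg: "\<bar>g \<tau> - g s\<bar> < e" for \<tau>
    unfolding z_def
  proof (rule someI_ex)
    have d: "(F \<tau> has_real_derivative Fy \<tau> x) (at x)" if "\<bar>x - g s\<bar> < e" for x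
      using Fy AB e that tA by (auto simp: subset_iff dist_real_def abs_minus_commute)
    consider "g \<tau> = g s" | "g \<tau> < g s" | "g s < g \<tau>" by linarith
    then show "\<exists>z. \<bar>z - g s\<bar> \<le> \<bar>g \<tau> - g s\<bar> \<and> F \<tau> (g \<tau>) - F \<tau> (g s) = Fy \<tau> z * (g \<tau> - g s)"
    proof cases
      case 1
      then show ?thesis by auto
    next
      case 2
      then obtain z where "g \<tau> < z" "z < g s" "F \<tau> (g s) - F \<tau> (g \<tau>) = (g s - g \<tau>) * Fy \<tau> z"
        using MVT2[OF 2, of "F \<tau>" "Fy \<tau>"] d tg by force
      then show ?thesis by (intro exI[of _ z]) (auto simp: algebra_simps)
    next
      case 3
      then obtain z where "g s < z" "z < g \<tau>" "F \<tau> (g \<tau>) - F \<tau> (g s) = (g \<tau> - g s) * Fy \<tau> z"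
        using MVT2[OF 3, of "F \<tau>" "Fy \<tau>"] d tg by force
      then show ?thesis by (intro exI[of _ z]) (auto simp: algebra_simps)
    qed
  qed
  have ev: "eventually (\<lambda>\<tau>. \<bar>z \<tau> - g s\<bar> \<le> \<bar>g \<tau> - g s\<bar> \<and> F \<tau> (g \<tau>) - F \<tau> (g s) = Fy \<tau> (z \<tau>) * (g \<tau> - g s)) (at s)"
    using near[OF e(1)] by eventually_elim (use z in auto)
  have "(g \<longlongrightarrow> g s) (at s)" using g_isCont by (simp add: isCont_def)
  then have "((\<lambda>\<tau>. \<bar>g \<tau> - g s\<bar>) \<longlongrightarrow> 0) (at s)"
    by (intro tendsto_rabs_zero) (simp add: LIM_zero_iff)
  then have "((\<lambda>\<tau>. z \<tau> - g s) \<longlongrightarrow> 0) (at s)"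
    by (rule Lim_null_comparison[rotated]) (use ev in \<open>auto elim: eventually_mono\<close>)
  then have "(z \<longlongrightarrow> g s) (at s)" by (simp add: LIM_zero_iff)
  then have "((\<lambda>\<tau>. (\<tau>, z \<tau>)) \<longlongrightarrow> (s, g s)) (at s)" by (intro tendsto_Pair tendsto_ident_at)
  moreover have "isCont (\<lambda>(\<tau>, y). Fy \<tau> y) (s, g s)"
    using Fy_cont U by (simp add: continuous_on_eq_continuous_at)
  ultimately have Fy_lim: "((\<lambda>\<tau>. Fy \<tau> (z \<tau>)) \<longlongrightarrow> Fy s (g s)) (at s)"
    using isCont_tendsto_compose[of "(s, g s)" "\<lambda>(\<tau>, y). Fy \<tau> y" "\<lambda>\<tau>. (\<tau>, z \<tau>)" "at s"] by simp
  have "((\<lambda>\<tau>. (F \<tau> (g s) - F s (g s)) / (\<tau> - s) + Fy \<tau> (z \<tau>) * ((g \<tau> - g s) / (\<tau> - s))) \<longlongrightarrow> a + Fy s (g s) * g') (at s)"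
    using Ft g by (intro tendsto_intros Fy_lim) (auto simp: has_field_derivative_iff)
  moreover have "eventually (\<lambda>\<tau>. (F \<tau> (g s) - F s (g s)) / (\<tau> - s) + Fy \<tau> (z \<tau>) * ((g \<tau> - g s) / (\<tau> - s))
      = (F \<tau> (g \<tau>) - F s (g s)) / (\<tau> - s)) (at s)"
    using ev by eventually_elim (simp add: diff_divide_distrib[symmetric] add_divide_distrib[symmetric])
  ultimately show ?thesis
    unfolding has_field_derivative_iff by (rule Lim_transform_eventually)
qed

context flow
begin

text \<open>\<open>P\<close> is the integrating factor of the zeroth-order term, and the transport
  terms cancel along \<open>Y\<close>. In the second formula the stationary equation eliminates
  \<open>h\<close> and leaves \<open>\<omega>\<close> times \<open>\<psi>\<close>.\<close>

lemma characteristics: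
  fixes \<xi> \<xi>y :: "real \<Rightarrow> real \<Rightarrow> real"
  assumes pde: "\<And>t y. 0 < t \<Longrightarrow> 0 < y \<Longrightarrow>
      ((\<lambda>s. \<xi> s y) has_real_derivative h y + \<xi>y t y - \<rho> t * (\<xi> t y - y * \<xi>y t y)) (at t)"
    and \<xi>_deriv: "\<And>t y. 0 \<le> t \<Longrightarrow> 0 < y \<Longrightarrow> (\<xi> t has_real_derivative \<xi>y t y) (at y)"
    and \<xi>_cont: "continuous_on ({0..} \<times> {0<..}) (\<lambda>(t, y). \<xi> t y)"
    and \<xi>y_cont: "continuous_on ({0..} \<times> {0<..}) (\<lambda>(t, y). \<xi>y t y)"
    and t: "0 \<le> t" and y: "0 < y"
  shows "P t * \<xi> t y = \<xi> 0 (P t * y + Q t) + integral {0..t} (\<lambda>s. P s * h (Y t y s))"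
    "P t * (\<xi> t y - xi y) = (\<xi> 0 (P t * y + Q t) - xi (P t * y + Q t)) - integral {0..t} (\<lambda>s. P s * \<omega> s * \<psi> (Y t y s))"
proof -
  have Yp: "0 < Y t y s" if "s \<in> {0..t}" for s using Y_pos[OF y] that by auto
  have Pc: "continuous_on {0..t} P" by (rule continuous_on_subset[OF P_cont]) auto
  have \<xi>Y: "continuous_on {0..t} (\<lambda>s. \<xi> s (Y t y s))"
  proof -
    have "continuous_on {0..t} (\<lambda>s. (s, Y t y s))" by (intro continuous_intros Y_cont)
    moreover have "(\<lambda>s. (s, Y t y s)) ` {0..t} \<subseteq> {0..} \<times> {0<..}" using Yp by auto
    ultimately have "continuous_on {0..t} (\<lambda>s. (\<lambda>(t, y). \<xi> t y) (s, Y t y s))"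
      by (rule continuous_on_compose2[OF \<xi>_cont])
    then show ?thesis by simp
  qed
  have "continuous_on {0<..} xi"
    by (rule DERIV_continuous_on[OF has_field_derivative_at_within[OF xi_deriv]]) auto
  then have xiY: "continuous_on {0..t} (\<lambda>s. xi (Y t y s))"
    by (rule continuous_on_compose2[OF _ Y_cont]) (use Yp in auto)
  have d1: "((\<lambda>s. P s * \<xi> s (Y t y s)) has_real_derivative P s * h (Y t y s)) (at s)" if s: "s \<in> {0<..<t}" for s
  proof -
    let ?Y = "Y t y s"
    have Y0: "0 < ?Y" using Yp s by auto
    have chain: "((\<lambda>\<tau>. \<xi> \<tau> (Y t y \<tau>)) has_real_derivative
        (h ?Y + \<xi>y s ?Y - \<rho> s * (\<xi> s ?Y - ?Y * \<xi>y s ?Y)) + \<xi>y s ?Y * (- 1 - \<rho> s * ?Y)) (at s)"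
    proof (rule DERIV_chain_partials[where U = "{0<..} \<times> {0<..}" and F = \<xi> and Fy = \<xi>y and g = "Y t y"])
      show "continuous_on ({0<..} \<times> {0<..}) (\<lambda>(\<tau>, y). \<xi>y \<tau> y)"
        by (rule continuous_on_subset[OF \<xi>y_cont]) auto
    qed (use s Y0 in \<open>auto intro!: Y_deriv pde \<xi>_deriv open_Times\<close>)
    show ?thesis
      by (rule DERIV_cong[OF DERIV_mult[OF P_deriv chain]]) (use s in \<open>auto simp: algebra_simps\<close>)
  qed
  have d2: "((\<lambda>s. P s * (\<xi> s (Y t y s) - xi (Y t y s))) has_real_derivative - (P s * \<omega> s * \<psi> (Y t y s))) (at s)"
    if s: "s \<in> {0<..<t}" for s
  proof -
    let ?Y = "Y t y s"
    have Y0: "0 < ?Y" "0 < s" using Yp s by auto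
    have dx: "((\<lambda>s. xi (Y t y s)) has_real_derivative xi1 ?Y * (- 1 - \<rho> s * ?Y)) (at s)"
      using DERIV_chain2[OF xi_deriv[OF Y0(1)] Y_deriv[OF Y0(2)]] by (simp add: xi1_def)
    have hY: "h ?Y = xi ?Y / p - (1 + ?Y / p) * xi1 ?Y"
    proof -
      have "(p + ?Y) * xi1 ?Y = xi ?Y - p * h ?Y" using p_pos Y0 by (simp add: xi1_def)
      then show ?thesis using p_pos by (simp add: field_simps)
    qed
    have "P s * h ?Y - (\<rho> s * P s * xi ?Y + xi1 ?Y * (- 1 - \<rho> s * ?Y) * P s) = - (P s * \<omega> s * \<psi> ?Y)"
      unfolding hY by (simp add: \<omega>_def \<psi>_def algebra_simps)
    from DERIV_cong[OF DERIV_diff[OF d1[OF s] DERIV_mult[OF P_deriv[OF Y0(2)] dx]] this]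
    show ?thesis by (simp add: right_diff_distrib)
  qed
  have "((\<lambda>s. P s * h (Y t y s)) has_integral P t * \<xi> t (Y t y t) - P 0 * \<xi> 0 (Y t y 0)) {0..t}"
    using d1 t by (intro fundamental_theorem_of_calculus_interior continuous_intros Pc \<xi>Y)
      (auto simp: has_real_derivative_iff_has_vector_derivative)
  then show "P t * \<xi> t y = \<xi> 0 (P t * y + Q t) + integral {0..t} (\<lambda>s. P s * h (Y t y s))"
    by (simp add: integral_unique Y_start)
  have "((\<lambda>s. - (P s * \<omega> s * \<psi> (Y t y s))) has_integral P t * (\<xi> t (Y t y t) - xi (Y t y t)) - P 0 * (\<xi> 0 (Y t y 0) - xi (Y t y 0))) {0..t}"
    using d2 t by (intro fundamental_theorem_of_calculus_interior continuous_intros Pc \<xi>Y xiY)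
      (auto simp: has_real_derivative_iff_has_vector_derivative)
  then show "P t * (\<xi> t y - xi y) = (\<xi> 0 (P t * y + Q t) - xi (P t * y + Q t)) - integral {0..t} (\<lambda>s. P s * \<omega> s * \<psi> (Y t y s))"
    by (auto simp: Y_start dest!: integral_unique)
qed

end

section \<open>The linearized kernel\<close>

lemma lipschitz_above:
  fixes f f' :: "real \<Rightarrow> real"
  assumes "\<And>z. m \<le> z \<Longrightarrow> (f has_real_derivative f' z) (at z)" "\<And>z. m \<le> z \<Longrightarrow> \<bar>f' z\<bar> \<le> B"
    and "m \<le> a" "m \<le> b"
  shows "\<bar>f a - f b\<bar> \<le> B * \<bar>a - b\<bar>"
  using field_differentiable_bound[of "{m..}" f f' B a b] assms
  by (auto intro: has_field_derivative_at_within)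

context bounded_flow
begin

text \<open>
  \<open>Y1\<close> is \<open>Y\<close> for the constant \<open>\<rho> = 1/p\<close>; there
  \<open>N t y s\<close> equals \<open>S (Y1 t y s)\<close>.
\<close>

definition Y1 :: "real \<Rightarrow> real \<Rightarrow> real \<Rightarrow> real" where "Y1 t y s = (y + p) * exp ((t-s)/p) - p"

definition N :: "real \<Rightarrow> real \<Rightarrow> real \<Rightarrow> real" where
  "N t y s = v s / v t * \<psi> (Y t y s) / p - (1 + y/p) * exp ((t-s)/p) * \<psi>1 (Y t y s)"

lemma Y1_ge: "0 < y \<Longrightarrow> s \<le> t \<Longrightarrow> y \<le> Y1 t y s"
proof -
  assume "0 < y" "s \<le> t"
  then have "(y + p) * 1 \<le> (y + p) * exp ((t-s)/p)" using p_pos by (intro mult_left_mono) auto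
  then show ?thesis by (simp add: Y1_def)
qed

lemma Y1_factor: "(1 + y/p) * exp ((t-s)/p) = 1 + Y1 t y s / p"
  using p_pos by (simp add: Y1_def field_simps)

text \<open>The rescaled position is y plus the integral of \<open>P \<tau> / P t\<close>, which is
  linear in the ratios \<open>v \<tau> / v t\<close> with non-negative coefficients; bounds on the
  ratios therefore pass to the position. The summand y carries no ratio, whence a \<le> 1 \<le>
  b.\<close>

lemma Y_ratio:
  assumes s: "0 \<le> s" "s \<le> t" and y: "0 < y" and ab: "a \<le> 1" "1 \<le> b"
    and r: "\<And>\<tau>. \<tau> \<in> {s..t} \<Longrightarrow> a \<le> v \<tau> / v t" "\<And>\<tau>. \<tau> \<in> {s..t} \<Longrightarrow> v \<tau> / v t \<le> b"
  shows "a * Y1 t y s \<le> v s / v t * Y t y s" "v s / v t * Y t y s \<le> b * Y1 t y s"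
proof -
  let ?E = "exp (-(t-s)/p)"
  have int: "((\<lambda>\<tau>. exp (-(t-\<tau>)/p)) has_integral p * (1 - ?E)) {s..t}"
    using exp_weight_integral[OF p_pos s(1) s(2), of t] by simp
  have c: "continuous_on {s..t} (\<lambda>\<tau>. P \<tau> / P t)"
    using s by (intro continuous_intros continuous_on_subset[OF P_cont]) auto
  have X: "P s / P t * Y t y s = y + integral {s..t} (\<lambda>\<tau>. P \<tau> / P t)"
    using Q_diff[OF s] by (simp add: Y_def field_simps)
  have PP: "P \<tau> / P t = v \<tau> / v t * exp (-(t-\<tau>)/p)" for \<tau>
    by (simp add: P_ratio mult.commute)
  have lo: "a * (p * (1 - ?E)) \<le> integral {s..t} (\<lambda>\<tau>. P \<tau> / P t)"
    by (rule has_integral_le[OF has_integral_mult_right[OF int, of a] integrable_integral[OF integrable_continuous_interval[OF c]]])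
      (use r in \<open>auto simp only: PP intro!: mult_right_mono, auto\<close>)
  have hi: "integral {s..t} (\<lambda>\<tau>. P \<tau> / P t) \<le> b * (p * (1 - ?E))"
    by (rule has_integral_le[OF integrable_integral[OF integrable_continuous_interval[OF c]] has_integral_mult_right[OF int, of b]])
      (use r in \<open>auto simp only: PP intro!: mult_right_mono, auto\<close>)
  have EE: "exp ((t-s)/p) * ?E = 1" by (simp add: exp_add[symmetric] diff_divide_distrib)
  have Y1E: "?E * Y1 t y s = y + p * (1 - ?E)"
  proof -
    have "?E * Y1 t y s = (y + p) * (exp ((t-s)/p) * ?E) - ?E * p" by (simp add: Y1_def algebra_simps)
    then show ?thesis unfolding EE by (simp add: algebra_simps)
  qed
  have "a * y \<le> y" "y \<le> b * y" using ab y mult_right_mono[of a 1 y] mult_right_mono[of 1 b y] by auto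
  then have "a * (?E * Y1 t y s) \<le> P s / P t * Y t y s" "P s / P t * Y t y s \<le> b * (?E * Y1 t y s)"
    unfolding X Y1E using lo hi by (simp_all add: distrib_left)
  then have "?E * (a * Y1 t y s) \<le> ?E * (v s / v t * Y t y s)" "?E * (v s / v t * Y t y s) \<le> ?E * (b * Y1 t y s)"
    unfolding PP by (simp_all add: mult_ac)
  then show "a * Y1 t y s \<le> v s / v t * Y t y s" "v s / v t * Y t y s \<le> b * Y1 t y s"
    by (simp_all only: mult_le_cancel_left_pos[OF exp_gt_zero])
qed

text \<open>One summand for each error in \<open>kernel_close\<close>: the ratio
  \<open>v s / v t\<close>, the shift of \<open>\<psi>\<close> with 12 = 3 * 4, and the shift of
  \<open>\<psi>1\<close> with 72 = 2 * 9 * 4. Here 4 is the relative error of the position, and 3 is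
  the loss from bounding derivatives on all of [B/3, \<infinity>).\<close>

definition KN :: "real \<Rightarrow> real" where "KN \<epsilon> = \<psi>_max / p + 12 * H + 72 * p * H * (1/\<epsilon> + 1/p)"
definition KB :: "real \<Rightarrow> real" where "KB \<epsilon> = vu / vl * \<psi>_max / p + (vu/vl)\<^sup>2 * (p * H) * (1/\<epsilon> + 1/p)"

lemma \<psi>_max_nonneg: "0 \<le> \<psi>_max"
  using \<psi>_nonneg[of 1] \<psi>_le[of 1] by auto

text \<open>Ratios near 1 give a small relative error of the position \<open>Y\<close> against
  \<open>Y1\<close>. As \<open>\<psi>1\<close> and \<open>\<psi>2\<close> decay like 1/z and 1/z^2,
  a relative error of the position is an absolute error of \<open>\<psi>\<close>, and an error of
  order 1/B in \<open>\<psi>1\<close>.\<close>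

lemma kernel_close:
  assumes \<epsilon>: "0 < \<epsilon>" "\<epsilon> \<le> y" and s: "0 \<le> s" "s \<le> t" and \<delta>: "0 \<le> \<delta>" "\<delta> \<le> 1/2"
    and r: "\<And>\<tau>. \<tau> \<in> {s..t} \<Longrightarrow> \<bar>v \<tau> / v t - 1\<bar> \<le> \<delta>"
  shows "\<bar>N t y s - S (Y1 t y s)\<bar> \<le> KN \<epsilon> * \<delta>"
proof -
  have y: "0 < y" using \<epsilon> by simp
  define r' where "r' = v s / v t"
  define A where "A = Y t y s"
  define B where "B = Y1 t y s"
  have rs: "\<bar>r' - 1\<bar> \<le> \<delta>" using r[of s] s by (simp add: r'_def)
  have B: "\<epsilon> \<le> B" "0 < B" using Y1_ge[OF y s(2)] \<epsilon> by (auto simp: B_def)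
  have A: "0 < A" using Y_pos[OF y s] by (simp add: A_def)
  have rA: "(1 - \<delta>) * B \<le> r' * A" "r' * A \<le> (1 + \<delta>) * B"
    using Y_ratio[OF s y, of "1 - \<delta>" "1 + \<delta>"] r \<delta> unfolding A_def B_def r'_def by (force simp: abs_le_iff)+
  have r'1: "1 - \<delta> \<le> r'" "r' \<le> 1 + \<delta>" using rs by auto
  \<comment> \<open>Dividing the bounds on \<open>r' * A\<close> by those on \<open>r'\<close>
    compares \<open>A\<close> with \<open>B\<close>. The assumption \<delta> \<le> 1/2 is what makes
    the factor \<open>1 + 4 * \<delta>\<close> and, further below, the lower bound B/3 work.\<close>
  have "(1 - \<delta>) * A \<le> r' * A" using r'1 A by (intro mult_right_mono) auto
  also have "\<dots> \<le> (1 + \<delta>) * B" by (rule rA)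
  also have "\<dots> \<le> ((1 - \<delta>) * (1 + 4 * \<delta>)) * B"
  proof (intro mult_right_mono)
    have "\<delta> * \<delta> \<le> \<delta> * (1/2)" using \<delta> by (intro mult_left_mono) auto
    then show "1 + \<delta> \<le> (1 - \<delta>) * (1 + 4 * \<delta>)" by (simp add: algebra_simps)
  qed (use B in auto)
  finally have AB: "A \<le> (1 + 4 * \<delta>) * B" using \<delta> by (simp add: mult.assoc)
  have "(1 + \<delta>) * ((1 - 4 * \<delta>) * B) \<le> (1 - \<delta>) * B"
  proof -
    have "(1 + \<delta>) * (1 - 4 * \<delta>) \<le> 1 - \<delta>" using \<delta> by (simp add: algebra_simps)
    from mult_right_mono[OF this, of B] B show ?thesis by (simp add: mult.assoc)
  qed
  also have "\<dots> \<le> r' * A" by (rule rA)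
  also have "\<dots> \<le> (1 + \<delta>) * A" using r'1 A by (intro mult_right_mono) auto
  finally have BA: "(1 - 4 * \<delta>) * B \<le> A" using \<delta> by simp
  have "(1 + \<delta>) * (B / 3) \<le> (1 - \<delta>) * B"
  proof -
    have "(1 + \<delta>) / 3 \<le> 1 - \<delta>" using \<delta> by simp
    from mult_right_mono[OF this, of B] B show ?thesis by simp
  qed
  also have "\<dots> \<le> r' * A" by (rule rA)
  also have "\<dots> \<le> (1 + \<delta>) * A" using r'1 A by (intro mult_right_mono) auto
  finally have A3: "B / 3 \<le> A" using \<delta> by simp
  have dist: "\<bar>A - B\<bar> \<le> 4 * \<delta> * B" using AB BA by (simp add: abs_le_iff algebra_simps)
  have z: "1 / z \<le> 3 / B" "0 < z" if "B / 3 \<le> z" for z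
    using that B by (auto simp: field_simps intro: less_le_trans[of 0 "B/3"])
  have b1: "\<bar>\<psi>1 z\<bar> \<le> p * H * (3 / B)" if "B / 3 \<le> z" for z
  proof -
    have "\<bar>\<psi>1 z\<bar> \<le> p * H * (1 / z)" using \<psi>1_bound[OF z(2)[OF that]] z(2)[OF that] by (simp add: field_simps)
    also have "\<dots> \<le> p * H * (3 / B)" using z(1)[OF that] p_pos H_nonneg by (intro mult_left_mono) auto
    finally show ?thesis .
  qed
  have b2: "\<bar>\<psi>2 z\<bar> \<le> 2 * p * H * ((3 / B) * (3 / B))" if "B / 3 \<le> z" for z
  proof -
    have "\<bar>\<psi>2 z\<bar> \<le> 2 * p * H * ((1 / z) * (1 / z))"
      using \<psi>2_bound[OF z(2)[OF that]] z(2)[OF that] by (simp add: field_simps power2_eq_square)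
    also have "\<dots> \<le> 2 * p * H * ((3 / B) * (3 / B))"
      using z[OF that] p_pos H_nonneg B by (intro mult_left_mono mult_mono) auto
    finally show ?thesis .
  qed
  have "\<bar>\<psi> A - \<psi> B\<bar> \<le> p * H * (3 / B) * \<bar>A - B\<bar>"
    by (rule lipschitz_above[where m = "B/3"]) (use \<psi>_deriv z(2) b1 A3 B in auto)
  also have "\<dots> \<le> p * H * (3 / B) * (4 * \<delta> * B)"
    using dist p_pos H_nonneg B by (intro mult_left_mono) auto
  also have "\<dots> = 12 * p * H * \<delta>" using B by simp
  finally have d1: "\<bar>\<psi> A - \<psi> B\<bar> \<le> 12 * p * H * \<delta>" .
  have "\<bar>\<psi>1 A - \<psi>1 B\<bar> \<le> 2 * p * H * ((3 / B) * (3 / B)) * \<bar>A - B\<bar>"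
    by (rule lipschitz_above[where m = "B/3"]) (use \<psi>1_deriv z(2) b2 A3 B in auto)
  also have "\<dots> \<le> 2 * p * H * ((3 / B) * (3 / B)) * (4 * \<delta> * B)"
    using dist p_pos H_nonneg B by (intro mult_left_mono) auto
  also have "\<dots> = 72 * p * H * \<delta> * (1 / B)" using B by (simp add: field_simps)
  finally have d2: "\<bar>\<psi>1 A - \<psi>1 B\<bar> \<le> 72 * p * H * \<delta> * (1 / B)" .
  \<comment> \<open>The growth of 1 + B/p is paid for by the factor 1/B in the increment of
    \<open>\<psi>1\<close>.\<close>
  have "\<bar>(1 + B/p) * (\<psi>1 A - \<psi>1 B)\<bar> \<le> (1 + B/p) * (72 * p * H * \<delta> * (1 / B))"
    unfolding abs_mult using d2 B p_pos by (intro mult_mono) auto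
  also have "\<dots> = 72 * p * H * \<delta> * (1 / B + 1 / p)" using B p_pos by (simp add: field_simps)
  also have "\<dots> \<le> 72 * p * H * \<delta> * (1 / \<epsilon> + 1 / p)"
    using B \<epsilon> p_pos H_nonneg \<delta> by (intro mult_left_mono add_mono) (auto simp: field_simps)
  finally have t3: "\<bar>(1 + B/p) * (\<psi>1 A - \<psi>1 B)\<bar> \<le> 72 * p * H * (1 / \<epsilon> + 1 / p) * \<delta>" by (simp add: mult_ac)
  have "\<bar>(\<psi> A - \<psi> B) / p\<bar> \<le> 12 * p * H * \<delta> / p"
    unfolding abs_divide abs_of_pos[OF p_pos] by (rule divide_right_mono[OF d1]) (use p_pos in auto)
  also have "\<dots> = 12 * H * \<delta>" using p_pos by simp
  finally have t2: "\<bar>(\<psi> A - \<psi> B) / p\<bar> \<le> 12 * H * \<delta>" .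
  have "\<bar>(r' - 1) * (\<psi> A / p)\<bar> \<le> \<delta> * (\<psi>_max / p)"
    unfolding abs_mult using rs \<psi>_nonneg[OF A] \<psi>_le[OF A] p_pos by (intro mult_mono) (auto intro: divide_right_mono)
  then have t1: "\<bar>(r' - 1) * (\<psi> A / p)\<bar> \<le> \<psi>_max / p * \<delta>" by (simp add: mult.commute)
  have "N t y s - S (Y1 t y s) = (r' - 1) * (\<psi> A / p) + (\<psi> A - \<psi> B) / p - (1 + B/p) * (\<psi>1 A - \<psi>1 B)"
    unfolding N_def S_def Y1_factor A_def[symmetric] B_def[symmetric] r'_def[symmetric]
    using p_pos by (simp add: field_simps)
  moreover have "KN \<epsilon> * \<delta> = \<psi>_max / p * \<delta> + 12 * H * \<delta> + 72 * p * H * (1/\<epsilon> + 1/p) * \<delta>"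
    by (simp only: KN_def distrib_right[where c = \<delta>])
  moreover have "\<bar>T1 + T2 - T3\<bar> \<le> k1 + k2 + k3" if "\<bar>T1\<bar> \<le> k1" "\<bar>T2\<bar> \<le> k2" "\<bar>T3\<bar> \<le> k3" for T1 T2 T3 k1 k2 k3 :: real
    using that by linarith
  ultimately show ?thesis using t1 t2 t3 by metis
qed

text \<open>A crude bound for the initial period, in which the ratios of \<open>v\<close> are
  confined only to [vl/vu, vu/vl].\<close>

lemma kernel_bound:
  assumes \<epsilon>: "0 < \<epsilon>" "\<epsilon> \<le> y" and s: "0 \<le> s" "s \<le> t"
  shows "\<bar>N t y s\<bar> \<le> KB \<epsilon>"
proof -
  have y: "0 < y" using \<epsilon> by simp
  define A where "A = Y t y s"
  define B where "B = Y1 t y s"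
  have B: "\<epsilon> \<le> B" "0 < B" using Y1_ge[OF y s(2)] \<epsilon> by (auto simp: B_def)
  have A: "0 < A" using Y_pos[OF y s] by (simp add: A_def)
  have vuvl: "vl \<le> vu" "0 < vu" using v_ge[of 0] v_le[of 0] vl_pos by auto
  have ratio: "vl / vu \<le> v \<tau> / v t" "v \<tau> / v t \<le> vu / vl" if "0 \<le> \<tau>" for \<tau>
    using that s v_ge[of \<tau>] v_le[of \<tau>] v_ge[of t] v_le[of t] vl_pos vuvl by (auto intro!: frac_le)
  have "vl / vu * B \<le> v s / v t * A"
    unfolding A_def B_def using s y ratio vuvl vl_pos by (intro Y_ratio(1)[where b = "vu/vl"]) auto
  also have "\<dots> \<le> vu / vl * A" using ratio(2)[OF s(1)] A by (intro mult_right_mono) auto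
  finally have AB: "1 / A \<le> (vu/vl)\<^sup>2 * (1 / B)"
    using A B vl_pos vuvl by (simp add: field_simps power2_eq_square)
  have "\<bar>\<psi>1 A\<bar> \<le> p * H * (1 / A)" using \<psi>1_bound[OF A] A by (simp add: field_simps)
  also have "\<dots> \<le> p * H * ((vu/vl)\<^sup>2 * (1 / B))" using AB p_pos H_nonneg by (intro mult_left_mono) auto
  finally have "(1 + B/p) * \<bar>\<psi>1 A\<bar> \<le> (1 + B/p) * (p * H * ((vu/vl)\<^sup>2 * (1 / B)))"
    using B p_pos by (intro mult_left_mono) auto
  also have "\<dots> = (vu/vl)\<^sup>2 * (p * H) * (1 / B + 1 / p)" using B p_pos by (simp add: field_simps)
  also have "\<dots> \<le> (vu/vl)\<^sup>2 * (p * H) * (1 / \<epsilon> + 1 / p)"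
    using B \<epsilon> p_pos H_nonneg by (intro mult_left_mono add_mono) (auto simp: field_simps)
  finally have 1: "\<bar>(1 + B/p) * \<psi>1 A\<bar> \<le> (vu/vl)\<^sup>2 * (p * H) * (1 / \<epsilon> + 1 / p)"
    using B p_pos by (simp add: abs_mult)
  have "v s / v t * \<psi> A \<le> vu / vl * \<psi>_max"
    using ratio[OF s(1)] \<psi>_le[OF A] \<psi>_nonneg[OF A] vl_pos vuvl by (intro mult_mono) auto
  then have "v s / v t * \<psi> A / p \<le> vu / vl * \<psi>_max / p" using p_pos by (intro divide_right_mono) auto
  moreover have "0 \<le> v s / v t * \<psi> A / p"
    using p_pos \<psi>_nonneg[OF A] less_imp_le[OF v_pos[of s]] less_imp_le[OF v_pos[of t]] by simp
  ultimately have 2: "\<bar>v s / v t * \<psi> A / p\<bar> \<le> vu / vl * \<psi>_max / p" by linarith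
  show ?thesis unfolding N_def Y1_factor A_def[symmetric] B_def[symmetric] KB_def using 1 2 by linarith
qed

text \<open>Integration by parts against \<open>S (Y1 t y s)\<close>, which increases in s because
  \<open>S\<close> decreases and \<open>Y1\<close> descends to y. Its total increase
  \<open>S y - S (Y1 t y 0)\<close> is at most \<open>S y\<close>, so at a running maximum of
  \<open>\<bar>W\<bar>\<close> the boundary term dominates the integral.\<close>

lemma kernel_parts:
  fixes W w :: "real \<Rightarrow> real"
  assumes t: "0 \<le> t" and y: "0 < y"
    and W0: "W 0 = 0" and W_cont: "continuous_on {0..t} W" and w_cont: "continuous_on {0..t} w"
    and W_deriv: "\<And>s. s \<in> {0<..<t} \<Longrightarrow> (W has_real_derivative w s) (at s)"
    and Wm: "\<And>s. s \<in> {0..t} \<Longrightarrow> \<bar>W s\<bar> \<le> m"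
  shows "\<bar>integral {0..t} (\<lambda>s. w s * S (Y1 t y s))\<bar> \<le> 2 * S_max * m"
    "\<bar>W t\<bar> = m \<Longrightarrow> 0 \<le> sgn (W t) * integral {0..t} (\<lambda>s. w s * S (Y1 t y s))"
proof -
  define B where "B = Y1 t y"
  have B_pos: "0 < B s" if "s \<in> {0..t}" for s using Y1_ge[OF y, of s t] y that by (auto simp: B_def)
  have B_deriv: "(B has_real_derivative - (1 + B s / p)) (at s)" for s
    unfolding B_def Y1_def using p_pos by (auto intro!: derivative_eq_intros simp: field_simps)
  have B_cont: "continuous_on {0..t} B" unfolding B_def Y1_def using p_pos by (intro continuous_intros) auto
  define dS where "dS s = - (- p * h1 (B s) / (p + B s) - B s * h2 (B s)) * (1 + B s / p)" for s
  have SB_deriv: "((\<lambda>s. S (B s)) has_real_derivative dS s) (at s)" if "s \<in> {0..t}" for s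
    by (rule DERIV_cong[OF DERIV_chain2[OF S_deriv[OF B_pos[OF that]] B_deriv]]) (simp only: dS_def mult_minus_right mult_minus_left)
  have dS_nonneg: "0 \<le> dS s" if "s \<in> {0..t}" for s
    unfolding dS_def using S_deriv_nonpos[OF B_pos[OF that]] B_pos[OF that] p_pos by (intro mult_nonneg_nonneg) auto
  have dS_cont: "continuous_on {0..t} dS"
    unfolding dS_def using p_pos B_pos
    by (intro continuous_intros B_cont continuous_on_compose2[OF h1_cont B_cont] continuous_on_compose2[OF h2_cont B_cont])
      (auto simp: add_pos_pos[THEN less_imp_neq, symmetric])
  have SB_cont: "continuous_on {0..t} (\<lambda>s. S (B s))"
    by (rule DERIV_continuous_on[OF has_field_derivative_at_within[OF SB_deriv]])
  have dS_int: "(dS has_integral S y - S (B 0)) {0..t}"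
    using fundamental_theorem_of_calculus[of 0 t "\<lambda>s. S (B s)" dS] SB_deriv t
    by (auto simp: has_real_derivative_iff_has_vector_derivative[symmetric] B_def Y1_def intro: has_field_derivative_at_within)
  have parts: "((\<lambda>s. w s * S (B s) + dS s * W s) has_integral W t * S (B t) - W 0 * S (B 0)) {0..t}"
    using t W_deriv SB_deriv
    by (intro fundamental_theorem_of_calculus_interior continuous_intros W_cont SB_cont)
      (auto simp: has_real_derivative_iff_has_vector_derivative[symmetric] intro!: DERIV_mult)
  have Bt: "B t = y" by (simp add: B_def Y1_def)
  have int_dSW: "(\<lambda>s. dS s * W s) integrable_on {0..t}"
    by (intro integrable_continuous_interval continuous_intros dS_cont W_cont)
  have "integral {0..t} (\<lambda>s. (w s * S (B s) + dS s * W s) - dS s * W s) = W t * S y - integral {0..t} (\<lambda>s. dS s * W s)"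
    using parts W0 Bt int_dSW by (subst integral_diff) (auto simp: integral_unique has_integral_integrable)
  then have eq: "integral {0..t} (\<lambda>s. w s * S (B s)) = W t * S y - integral {0..t} (\<lambda>s. dS s * W s)" by simp
  have SB0: "0 \<le> S (B 0)" using S_nonneg B_pos[of 0] t by auto
  have "\<bar>integral {0..t} (\<lambda>s. dS s * W s)\<bar> \<le> (S y - S (B 0)) * m"
  proof -
    have "norm (integral {0..t} (\<lambda>s. dS s * W s)) \<le> integral {0..t} (\<lambda>s. dS s * m)"
      by (rule integral_norm_bound_integral[OF int_dSW])
        (use dS_nonneg Wm in \<open>auto intro!: mult_left_mono has_integral_integrable[OF has_integral_mult_left[OF dS_int]] simp: abs_mult\<close>)
    also have "\<dots> = (S y - S (B 0)) * m" by (rule integral_unique[OF has_integral_mult_left[OF dS_int]])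
    finally show ?thesis by simp
  qed
  note dSW = this
  have m: "0 \<le> m" using Wm[of 0] t by auto
  have Sy: "0 \<le> S y" "S y \<le> S_max" using S_nonneg[OF y] S_le[OF y] by auto
  have "\<bar>W t * S y\<bar> \<le> m * S_max" unfolding abs_mult using Wm[of t] t Sy by (intro mult_mono) auto
  moreover have "(S y - S (B 0)) * m \<le> S_max * m" using SB0 Sy m by (intro mult_right_mono) auto
  ultimately show "\<bar>integral {0..t} (\<lambda>s. w s * S (Y1 t y s))\<bar> \<le> 2 * S_max * m"
    unfolding B_def[symmetric] eq using dSW by (simp add: mult.commute)
  assume Wt: "\<bar>W t\<bar> = m"
  have "sgn (W t) * integral {0..t} (\<lambda>s. w s * S (B s)) = m * S y - sgn (W t) * integral {0..t} (\<lambda>s. dS s * W s)"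
    unfolding eq Wt[symmetric] by (auto simp: algebra_simps sgn_if)
  moreover have "sgn (W t) * integral {0..t} (\<lambda>s. dS s * W s) \<le> (S y - S (B 0)) * m"
    using dSW by (auto simp: sgn_if)
  moreover have "(S y - S (B 0)) * m \<le> m * S y" using SB0 m by (simp add: algebra_simps)
  ultimately show "0 \<le> sgn (W t) * integral {0..t} (\<lambda>s. w s * S (Y1 t y s))" unfolding B_def[symmetric] by linarith
qed

end

section \<open>The functional\<close>

lemma sup_norm_leI: "(\<And>y. 0 < y \<Longrightarrow> \<bar>f y\<bar> \<le> B) \<Longrightarrow> sup_norm f \<le> ereal B"
  by (auto simp: wnorm_def intro!: SUP_least)

lemma sup_norm_finiteI: "(\<And>y. 0 < y \<Longrightarrow> \<bar>f y\<bar> \<le> B) \<Longrightarrow> sup_norm f < \<infinity>"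
  using sup_norm_leI[of f B] by (auto intro: le_less_trans)

lemma nonneg_contD: "\<zeta> \<in> nonneg_cont \<Longrightarrow> continuous_on {0<..} \<zeta>" "\<zeta> \<in> nonneg_cont \<Longrightarrow> 0 < y \<Longrightarrow> 0 \<le> \<zeta> y"
  by (auto simp: nonneg_cont_def)

lemma zero_nonneg_cont: "(\<lambda>_. 0) \<in> nonneg_cont"
  by (auto simp: nonneg_cont_def)

lemma nonneg_cont_add:
  "\<zeta> \<in> nonneg_cont \<Longrightarrow> \<phi> \<in> nonneg_cont \<Longrightarrow> 0 \<le> c \<Longrightarrow> (\<lambda>y. \<zeta> y + c * \<phi> y) \<in> nonneg_cont"
  by (auto simp: nonneg_cont_def intro!: continuous_intros)

lemma nonneg_cont_convex:
  assumes "\<zeta>1 \<in> nonneg_cont" "\<zeta>2 \<in> nonneg_cont" "0 \<le> \<theta>" "\<theta> \<le> 1"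
  shows "(\<lambda>y. \<zeta>1 y + \<theta> * (\<zeta>2 y - \<zeta>1 y)) \<in> nonneg_cont"
proof -
  have "\<zeta>1 y + \<theta> * (\<zeta>2 y - \<zeta>1 y) = (1 - \<theta>) * \<zeta>1 y + \<theta> * \<zeta>2 y" for y by (simp add: algebra_simps)
  then show ?thesis using assms by (auto simp: nonneg_cont_def intro!: continuous_intros)
qed

lemma continuous_on_measurable:
  "continuous_on {0<..} \<phi> \<Longrightarrow> set_borel_measurable lborel {0<..} (\<phi> :: real \<Rightarrow> real)"
  using borel_measurable_continuous_on_indicator[of "{0<..}" \<phi>] by (simp add: set_borel_measurable_def)

lemma set_integrable_mult_bounded:
  fixes g \<phi> :: "real \<Rightarrow> real"
  assumes g: "set_integrable lborel {0<..} g" and \<phi>: "set_borel_measurable lborel {0<..} \<phi>"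
    and bound: "AE y in lborel. 0 < y \<longrightarrow> \<bar>g y * \<phi> y\<bar> \<le> K * \<bar>g y\<bar>"
  shows "set_integrable lborel {0<..} (\<lambda>y. g y * \<phi> y)"
proof -
  have "(\<lambda>y. (indicator {0<..} y *\<^sub>R g y) * (indicator {0<..} y *\<^sub>R \<phi> y)) \<in> borel_measurable lborel"
    using g \<phi> by (intro borel_measurable_times) (auto simp: set_integrable_def set_borel_measurable_def)
  also have "(\<lambda>y. (indicator {0<..} y *\<^sub>R g y) * (indicator {0<..} y *\<^sub>R \<phi> y)) = (\<lambda>y. indicator {0<..} y *\<^sub>R (g y * \<phi> y))"
    by (auto simp: indicator_def)
  finally show ?thesis
    using bound by (intro set_integrable_bound[OF set_integrable_mult_right[OF set_integrable_abs[OF g], of K]])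
      (auto simp: set_borel_measurable_def elim!: eventually_mono)
qed

lemma pairing_bound:
  assumes g: "set_integrable lborel {0<..} g" and \<phi>: "continuous_on {0<..} \<phi>"
    and K: "\<And>y. 0 < y \<Longrightarrow> \<bar>\<phi> y\<bar> \<le> K"
  shows "set_integrable lborel {0<..} (\<lambda>y. g y * \<phi> y)" "\<bar>pairing g \<phi>\<bar> \<le> K * (LBINT y:{0<..}. \<bar>g y\<bar>)"
proof -
  have le: "\<bar>g y * \<phi> y\<bar> \<le> K * \<bar>g y\<bar>" if "0 < y" for y
    using mult_left_mono[OF K[OF that], of "\<bar>g y\<bar>"] by (simp add: abs_mult mult.commute)
  show int: "set_integrable lborel {0<..} (\<lambda>y. g y * \<phi> y)"
    by (rule set_integrable_mult_bounded[OF g continuous_on_measurable[OF \<phi>]]) (use le in auto)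
  have "\<bar>pairing g \<phi>\<bar> \<le> (LBINT y:{0<..}. \<bar>g y * \<phi> y\<bar>)"
    using set_integral_norm_bound[OF int] by (simp add: pairing_def)
  also have "\<dots> \<le> (LBINT y:{0<..}. K * \<bar>g y\<bar>)"
    by (rule set_integral_mono) (use int g le in \<open>auto intro!: set_integrable_abs\<close>)
  finally show "\<bar>pairing g \<phi>\<bar> \<le> K * (LBINT y:{0<..}. \<bar>g y\<bar>)" by simp
qed

text \<open>The directions converge only pointwise, so against the fixed \<open>g0\<close> dominated
  convergence is used; the change of the gradient is absorbed by the common bound
  \<open>K\<close>.\<close>

lemma pairing_tendsto:
  fixes g :: "nat \<Rightarrow> real \<Rightarrow> real"
  assumes g: "\<And>n. set_integrable lborel {0<..} (g n)" "set_integrable lborel {0<..} g0"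
    and g_lim: "(\<lambda>n. LBINT y:{0<..}. \<bar>g n y - g0 y\<bar>) \<longlonglongrightarrow> 0"
    and \<phi>: "\<And>n. continuous_on {0<..} (\<phi> n)" "continuous_on {0<..} \<phi>0"
    and K: "\<And>n y. 0 < y \<Longrightarrow> \<bar>\<phi> n y\<bar> \<le> K"
    and \<phi>_lim: "\<And>y. 0 < y \<Longrightarrow> (\<lambda>n. \<phi> n y) \<longlonglongrightarrow> \<phi>0 y"
  shows "(\<lambda>n. pairing (g n) (\<phi> n)) \<longlonglongrightarrow> pairing g0 \<phi>0"
proof -
  have lim1: "(\<lambda>n. pairing g0 (\<phi> n)) \<longlonglongrightarrow> pairing g0 \<phi>0"
    unfolding pairing_def set_lebesgue_integral_def
  proof (rule integral_dominated_convergence)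
    have K0: "0 \<le> K" using K[of 1] by (auto intro: order_trans[OF abs_ge_zero])
    have K_lim: "\<bar>\<phi>0 y\<bar> \<le> K" if "0 < y" for y
      by (rule LIMSEQ_le_const2[OF tendsto_rabs[OF \<phi>_lim[OF that]]]) (use K that in auto)
    show "(\<lambda>y. indicator {0<..} y *\<^sub>R (g0 y * \<phi>0 y)) \<in> borel_measurable lborel"
      using pairing_bound(1)[OF g(2) \<phi>(2) K_lim] by (auto simp: set_integrable_def)
    show "(\<lambda>y. indicator {0<..} y *\<^sub>R (g0 y * \<phi> n y)) \<in> borel_measurable lborel" for n
      using pairing_bound(1)[OF g(2) \<phi>(1) K] by (auto simp: set_integrable_def)
    show "integrable lborel (\<lambda>y. K * (indicator {0<..} y *\<^sub>R \<bar>g0 y\<bar>))"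
      using set_integrable_abs[OF g(2)] by (intro integrable_mult_right) (auto simp: set_integrable_def)
    show "AE y in lborel. (\<lambda>n. indicator {0<..} y *\<^sub>R (g0 y * \<phi> n y)) \<longlonglongrightarrow> indicator {0<..} y *\<^sub>R (g0 y * \<phi>0 y)"
    proof (rule AE_I2)
      fix y :: real
      show "(\<lambda>n. indicator {0<..} y *\<^sub>R (g0 y * \<phi> n y)) \<longlonglongrightarrow> indicator {0<..} y *\<^sub>R (g0 y * \<phi>0 y)"
        by (cases "0 < y") (auto intro!: tendsto_mult_left \<phi>_lim)
    qed
    show "AE y in lborel. norm (indicator {0<..} y *\<^sub>R (g0 y * \<phi> n y)) \<le> K * (indicator {0<..} y *\<^sub>R \<bar>g0 y\<bar>)" for n
    proof (rule AE_I2)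
      fix y :: real
      show "norm (indicator {0<..} y *\<^sub>R (g0 y * \<phi> n y)) \<le> K * (indicator {0<..} y *\<^sub>R \<bar>g0 y\<bar>)"
        using mult_left_mono[OF K[of y n], of "\<bar>g0 y\<bar>"] by (cases "0 < y") (simp_all add: abs_mult mult.commute)
    qed
  qed
  have lim2: "(\<lambda>n. pairing (g n) (\<phi> n) - pairing g0 (\<phi> n)) \<longlonglongrightarrow> 0"
  proof (rule Lim_null_comparison)
    show "eventually (\<lambda>n. norm (pairing (g n) (\<phi> n) - pairing g0 (\<phi> n)) \<le> K * (LBINT y:{0<..}. \<bar>g n y - g0 y\<bar>)) sequentially"
    proof (rule always_eventually, rule allI)
      fix n
      have "pairing (g n) (\<phi> n) - pairing g0 (\<phi> n) = pairing (\<lambda>y. g n y - g0 y) (\<phi> n)"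
        unfolding pairing_def
        using set_integral_diff(2)[OF pairing_bound(1)[OF g(1) \<phi>(1) K] pairing_bound(1)[OF g(2) \<phi>(1) K], of n n]
        by (simp add: left_diff_distrib)
      then show "norm (pairing (g n) (\<phi> n) - pairing g0 (\<phi> n)) \<le> K * (LBINT y:{0<..}. \<bar>g n y - g0 y\<bar>)"
        using pairing_bound(2)[OF set_integral_diff(1)[OF g(1) g(2)] \<phi>(1) K, of n n] by simp
    qed
    show "(\<lambda>n. K * (LBINT y:{0<..}. \<bar>g n y - g0 y\<bar>)) \<longlonglongrightarrow> 0"
      using tendsto_mult_right_zero[OF g_lim] .
  qed
  from tendsto_add[OF lim2 lim1] show ?thesis by simp
qed

text \<open>Properties (a), (b) and the sign condition of (d), with the witnesses \<open>e0\<close>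
  and \<open>C\<close> fixed as parameters.\<close>

locale functional =
  fixes I :: "(real \<Rightarrow> real) \<Rightarrow> real" and dI :: "(real \<Rightarrow> real) \<Rightarrow> real \<Rightarrow> real" and e0 C :: real
  assumes I_grad: "is_gradient I dI"
    and e0_pos: "0 < e0"
    and I_local: "\<And>\<zeta>1 \<zeta>2. \<zeta>1 \<in> nonneg_cont \<Longrightarrow> \<zeta>2 \<in> nonneg_cont \<Longrightarrow> (\<And>y. e0 \<le> y \<Longrightarrow> \<zeta>1 y = \<zeta>2 y) \<Longrightarrow> I \<zeta>1 = I \<zeta>2"
    and dI_int: "\<And>\<zeta>. \<zeta> \<in> nonneg_cont \<Longrightarrow> set_integrable lborel {0<..} (dI \<zeta>)"
    and C_pos: "0 < C"
    and dI_lip: "\<And>\<zeta>1 \<zeta>2. \<zeta>1 \<in> nonneg_cont \<Longrightarrow> \<zeta>2 \<in> nonneg_cont \<Longrightarrow>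
        ereal (LBINT y:{0<..}. \<bar>dI \<zeta>1 y - dI \<zeta>2 y\<bar>) \<le> ereal C * sup_norm (\<lambda>y. \<zeta>1 y - \<zeta>2 y)"
    and dI_nonpos: "\<And>\<zeta>. \<zeta> \<in> nonneg_cont \<Longrightarrow> AE y in lborel. 0 < y \<longrightarrow> dI \<zeta> y \<le> 0"
begin

text \<open>
  By locality, \<open>I\<close> and its gradient do not see the replacement of
  \<open>\<zeta>\<close> by \<open>hat \<zeta>\<close>. This matters because the time
  derivative of a solution is bounded only away from \<open>y = 0\<close>.
\<close>

definition hat :: "(real \<Rightarrow> real) \<Rightarrow> real \<Rightarrow> real" where "hat f y = f (max y e0)"

lemma hat_eq: "e0 \<le> y \<Longrightarrow> hat f y = f y"
  by (simp add: hat_def max_def)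

lemma hat_cont: "continuous_on {0<..} f \<Longrightarrow> continuous_on {0<..} (hat f)"
  unfolding hat_def
  by (rule continuous_on_compose2[of "{0<..}"]) (use e0_pos in \<open>auto intro!: continuous_intros\<close>)

lemma hat_nonneg_cont: "\<zeta> \<in> nonneg_cont \<Longrightarrow> hat \<zeta> \<in> nonneg_cont"
  using hat_cont[of \<zeta>] e0_pos by (auto simp: nonneg_cont_def hat_def)

lemma I_hat: "\<zeta> \<in> nonneg_cont \<Longrightarrow> I (hat \<zeta>) = I \<zeta>"
  by (intro I_local hat_nonneg_cont) (auto simp: hat_eq)

section \<open>Locality of the gradient\<close>

lemma right_derivative:
  assumes "\<zeta> \<in> nonneg_cont" "\<phi> \<in> nonneg_cont" "\<And>y. 0 < y \<Longrightarrow> \<phi> y \<le> B"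
  shows "((\<lambda>\<epsilon>. I (\<lambda>y. \<zeta> y + \<epsilon> * \<phi> y)) has_real_derivative pairing (dI \<zeta>) \<phi>) (at 0 within {0..})"
proof -
  have "sup_norm \<phi> < \<infinity>" by (rule sup_norm_finiteI[of _ B]) (use assms nonneg_contD in auto)
  then have "((\<lambda>\<epsilon>. I (\<lambda>y. \<zeta> y + \<epsilon> * \<phi> y)) has_real_derivative pairing (dI \<zeta>) \<phi>)
      (at 0 within {\<epsilon>. (\<lambda>y. \<zeta> y + \<epsilon> * \<phi> y) \<in> nonneg_cont})"
    using I_grad assms(1) nonneg_contD(1)[OF assms(2)] unfolding is_gradient_def by blast
  then show ?thesis
    by (rule DERIV_subset) (use assms nonneg_cont_add in auto)
qed

text \<open>Both pairings are the right derivative at 0 of one and the same function of \<epsilon>.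
  Directions are non-negative so that every \<epsilon> \<ge> 0 is admissible; a signed direction may
  admit only \<epsilon> = 0, where \<open>is_gradient\<close> says nothing.\<close>

lemma pairing_local:
  assumes "\<zeta>1 \<in> nonneg_cont" "\<zeta>2 \<in> nonneg_cont" "\<phi>1 \<in> nonneg_cont" "\<phi>2 \<in> nonneg_cont"
    and "\<And>y. 0 < y \<Longrightarrow> \<phi>1 y \<le> B" "\<And>y. 0 < y \<Longrightarrow> \<phi>2 y \<le> B"
    and eq: "\<And>y. e0 \<le> y \<Longrightarrow> \<zeta>1 y = \<zeta>2 y" "\<And>y. e0 \<le> y \<Longrightarrow> \<phi>1 y = \<phi>2 y"
  shows "pairing (dI \<zeta>1) \<phi>1 = pairing (dI \<zeta>2) \<phi>2"
proof -
  let ?f = "\<lambda>\<zeta> \<phi> \<epsilon>. I (\<lambda>y. \<zeta> y + \<epsilon> * \<phi> y)"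
  have f_eq: "?f \<zeta>1 \<phi>1 \<epsilon> = ?f \<zeta>2 \<phi>2 \<epsilon>" if "\<epsilon> \<in> {0..}" for \<epsilon>
    by (rule I_local) (use assms that in \<open>auto intro!: nonneg_cont_add\<close>)
  have "(?f \<zeta>1 \<phi>1 has_real_derivative pairing (dI \<zeta>2) \<phi>2) (at 0 within {0..})"
    by (rule has_field_derivative_transform_within[OF right_derivative[OF assms(2,4,6)] zero_less_one]) (use f_eq in auto)
  moreover have "(?f \<zeta>1 \<phi>1 has_real_derivative pairing (dI \<zeta>1) \<phi>1) (at 0 within {0..})"
    by (rule right_derivative[OF assms(1,3,5)])
  moreover have "at (0::real) within {0..} \<noteq> bot"
  proof -
    have "{0::real..} - {0} = {0<..} - {0}" by auto
    then have "at (0::real) within {0..} = at_right 0" by (simp add: at_within_def)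
    then show ?thesis by simp
  qed
  ultimately show ?thesis
    unfolding has_field_derivative_iff using tendsto_unique by blast
qed

text \<open>A test direction supported below \<open>e0\<close> pairs to zero by locality. The
  integrand has one sign and the direction is positive there, so the gradient itself must
  vanish.\<close>

lemma dI_vanishes:
  assumes \<zeta>: "\<zeta> \<in> nonneg_cont"
  shows "AE y in lborel. 0 < y \<and> y < e0 \<longrightarrow> dI \<zeta> y = 0"
proof -
  define \<phi> where "\<phi> y = max 0 (e0 - y)" for y
  have \<phi>: "\<phi> \<in> nonneg_cont" "\<And>y. 0 < y \<Longrightarrow> \<bar>\<phi> y\<bar> \<le> e0"
    using e0_pos by (auto simp: nonneg_cont_def \<phi>_def intro!: continuous_intros)
  have "pairing (dI \<zeta>) \<phi> = pairing (dI \<zeta>) (\<lambda>_. 0)"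
    by (rule pairing_local[where B = e0]) (use \<zeta> \<phi> e0_pos zero_nonneg_cont in \<open>auto simp: \<phi>_def\<close>)
  then have zero: "pairing (dI \<zeta>) \<phi> = 0" by (simp add: pairing_def set_lebesgue_integral_def)
  have int: "integrable lborel (\<lambda>y. - (indicator {0<..} y *\<^sub>R (dI \<zeta> y * \<phi> y)))"
    using pairing_bound(1)[OF dI_int[OF \<zeta>] nonneg_contD(1)[OF \<phi>(1)] \<phi>(2)] by (auto simp: set_integrable_def)
  have nonneg: "AE y in lborel. 0 \<le> - (indicator {0<..} y *\<^sub>R (dI \<zeta> y * \<phi> y))"
    using dI_nonpos[OF \<zeta>] by eventually_elim (auto simp: indicator_def \<phi>_def mult_nonpos_nonneg)
  have "(\<integral>y. - (indicator {0<..} y *\<^sub>R (dI \<zeta> y * \<phi> y)) \<partial>lborel) = 0"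
    using zero by (simp add: pairing_def set_lebesgue_integral_def)
  then have "AE y in lborel. - (indicator {0<..} y *\<^sub>R (dI \<zeta> y * \<phi> y)) = 0"
    using integral_nonneg_eq_0_iff_AE[OF int nonneg] by simp
  then show ?thesis by eventually_elim (auto simp: \<phi>_def)
qed

lemma pairing_cong_above:
  assumes \<zeta>: "\<zeta> \<in> nonneg_cont" and \<phi>: "continuous_on {0<..} \<phi>1" "continuous_on {0<..} \<phi>2"
    and eq: "\<And>y. e0 \<le> y \<Longrightarrow> \<phi>1 y = \<phi>2 y"
  shows "pairing (dI \<zeta>) \<phi>1 = pairing (dI \<zeta>) \<phi>2"
proof -
  have m: "(\<lambda>y. indicator {0<..} y *\<^sub>R (dI \<zeta> y * \<phi> y)) \<in> borel_measurable lborel" if "continuous_on {0<..} \<phi>" for \<phi>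
  proof -
    have "(\<lambda>y. (indicator {0<..} y *\<^sub>R dI \<zeta> y) * (indicator {0<..} y *\<^sub>R \<phi> y)) \<in> borel_measurable lborel"
      using dI_int[OF \<zeta>] continuous_on_measurable[OF that]
      by (intro borel_measurable_times) (auto simp: set_integrable_def set_borel_measurable_def)
    also have "(\<lambda>y. (indicator {0<..} y *\<^sub>R dI \<zeta> y) * (indicator {0<..} y *\<^sub>R \<phi> y)) = (\<lambda>y. indicator {0<..} y *\<^sub>R (dI \<zeta> y * \<phi> y))"
      by (auto simp: indicator_def)
    finally show ?thesis .
  qed
  show ?thesis unfolding pairing_def set_lebesgue_integral_def
  proof (rule integral_cong_AE[OF m[OF \<phi>(1)] m[OF \<phi>(2)]])
    show "AE y in lborel. indicator {0<..} y *\<^sub>R (dI \<zeta> y * \<phi>1 y) = indicator {0<..} y *\<^sub>R (dI \<zeta> y * \<phi>2 y)"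
      using dI_vanishes[OF \<zeta>] by eventually_elim (use eq in \<open>auto simp: indicator_def not_less[symmetric]\<close>)
  qed
qed

text \<open>Admits directions such as \<open>h\<close> that are unbounded near 0.\<close>

lemma pairing_integrable_above:
  assumes \<zeta>: "\<zeta> \<in> nonneg_cont" and \<phi>: "continuous_on {0<..} \<phi>" and K: "\<And>y. e0 \<le> y \<Longrightarrow> \<bar>\<phi> y\<bar> \<le> K"
  shows "set_integrable lborel {0<..} (\<lambda>y. dI \<zeta> y * \<phi> y)"
proof (rule set_integrable_mult_bounded[OF dI_int[OF \<zeta>] continuous_on_measurable[OF \<phi>], where K = K])
  show "AE y in lborel. 0 < y \<longrightarrow> \<bar>dI \<zeta> y * \<phi> y\<bar> \<le> K * \<bar>dI \<zeta> y\<bar>"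
    using dI_vanishes[OF \<zeta>]
  proof eventually_elim
    case (elim y)
    show ?case
    proof (cases "e0 \<le> y")
      case True
      then show ?thesis using mult_left_mono[OF K[OF True], of "\<bar>dI \<zeta> y\<bar>"] by (simp add: abs_mult mult.commute)
    qed (use elim in auto)
  qed
qed

lemma pairing_hat:
  assumes \<zeta>: "\<zeta> \<in> nonneg_cont" and \<phi>: "continuous_on {0<..} \<phi>" and K: "\<And>y. e0 \<le> y \<Longrightarrow> \<bar>\<phi> y\<bar> \<le> K"
  shows "pairing (dI \<zeta>) \<phi> = pairing (dI (hat \<zeta>)) (hat \<phi>)"
proof -
  \<comment> \<open>\<open>pairing_local\<close> is confined to non-negative directions, hence the
    split into positive and negative parts.\<close>
  define \<phi>p where "\<phi>p y = max 0 (hat \<phi> y)" for y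
  define \<phi>m where "\<phi>m y = max 0 (- hat \<phi> y)" for y
  have hK: "\<bar>hat \<phi> y\<bar> \<le> K" for y using K[of "max y e0"] by (simp add: hat_def)
  have c: "\<phi>p \<in> nonneg_cont" "\<phi>m \<in> nonneg_cont"
    using hat_cont[OF \<phi>] by (auto simp: nonneg_cont_def \<phi>p_def \<phi>m_def intro!: continuous_intros)
  have b: "\<bar>\<phi>p y\<bar> \<le> K" "\<bar>\<phi>m y\<bar> \<le> K" for y
    using hK[of y] by (auto simp: \<phi>p_def \<phi>m_def)
  have b': "\<phi>p y \<le> K" "\<phi>m y \<le> K" for y
    using abs_le_D1[OF b(1)] abs_le_D1[OF b(2)] by auto
  have diff: "pairing (dI z) (hat \<phi>) = pairing (dI z) \<phi>p - pairing (dI z) \<phi>m" if z: "z \<in> nonneg_cont" for z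
  proof -
    have "dI z y * hat \<phi> y = dI z y * \<phi>p y - dI z y * \<phi>m y" for y
      by (auto simp: \<phi>p_def \<phi>m_def max_def)
    then show ?thesis unfolding pairing_def
      using pairing_bound(1)[OF dI_int[OF z] nonneg_contD(1)[OF c(1)] b(1)] pairing_bound(1)[OF dI_int[OF z] nonneg_contD(1)[OF c(2)] b(2)]
      by simp
  qed
  have "pairing (dI \<zeta>) \<phi> = pairing (dI \<zeta>) (hat \<phi>)"
    by (rule pairing_cong_above[OF \<zeta> \<phi> hat_cont[OF \<phi>]]) (simp add: hat_eq)
  also have "\<dots> = pairing (dI \<zeta>) \<phi>p - pairing (dI \<zeta>) \<phi>m" by (rule diff[OF \<zeta>])
  also have "pairing (dI \<zeta>) \<phi>p = pairing (dI (hat \<zeta>)) \<phi>p"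
    by (rule pairing_local[where B = K]) (use \<zeta> c b' hat_nonneg_cont hat_eq in auto)
  also have "pairing (dI \<zeta>) \<phi>m = pairing (dI (hat \<zeta>)) \<phi>m"
    by (rule pairing_local[where B = K]) (use \<zeta> c b' hat_nonneg_cont hat_eq in auto)
  also have "pairing (dI (hat \<zeta>)) \<phi>p - pairing (dI (hat \<zeta>)) \<phi>m = pairing (dI (hat \<zeta>)) (hat \<phi>)"
    by (rule diff[OF hat_nonneg_cont[OF \<zeta>], symmetric])
  finally show ?thesis .
qed

section \<open>Size of the gradient and the mean value theorem for the functional\<close>

definition mass :: "(real \<Rightarrow> real) \<Rightarrow> real" where "mass \<zeta> = (LBINT y:{0<..}. \<bar>dI \<zeta> y\<bar>)"

lemma mass_nonneg: "0 \<le> mass \<zeta>"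
  unfolding mass_def set_lebesgue_integral_def by (intro Bochner_Integration.integral_nonneg) auto

lemma dI_lipschitz:
  assumes "\<zeta>1 \<in> nonneg_cont" "\<zeta>2 \<in> nonneg_cont" "\<And>y. 0 < y \<Longrightarrow> \<bar>\<zeta>1 y - \<zeta>2 y\<bar> \<le> B"
  shows "(LBINT y:{0<..}. \<bar>dI \<zeta>1 y - dI \<zeta>2 y\<bar>) \<le> C * B"
proof -
  have "ereal (LBINT y:{0<..}. \<bar>dI \<zeta>1 y - dI \<zeta>2 y\<bar>) \<le> ereal C * sup_norm (\<lambda>y. \<zeta>1 y - \<zeta>2 y)"
    by (rule dI_lip[OF assms(1,2)])
  also have "\<dots> \<le> ereal C * ereal B"
    using C_pos by (intro ereal_mult_left_mono sup_norm_leI assms(3)) auto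
  finally show ?thesis by simp
qed

lemma mass_bound:
  assumes "\<zeta> \<in> nonneg_cont" "\<And>y. 0 < y \<Longrightarrow> \<zeta> y \<le> B"
  shows "mass \<zeta> \<le> mass (\<lambda>_. 0) + C * B"
proof -
  note int = dI_int[OF assms(1)] dI_int[OF zero_nonneg_cont]
  have "mass \<zeta> \<le> (LBINT y:{0<..}. \<bar>dI (\<lambda>_. 0) y\<bar> + \<bar>dI \<zeta> y - dI (\<lambda>_. 0) y\<bar>)"
    unfolding mass_def
    by (rule set_integral_mono) (use int in \<open>auto intro!: set_integrable_abs set_integral_add set_integral_diff\<close>)
  also have "\<dots> = mass (\<lambda>_. 0) + (LBINT y:{0<..}. \<bar>dI \<zeta> y - dI (\<lambda>_. 0) y\<bar>)"
    unfolding mass_def using int by (intro set_integral_add set_integrable_abs set_integral_diff)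
  also have "\<dots> \<le> mass (\<lambda>_. 0) + C * B"
    using dI_lipschitz[OF assms(1) zero_nonneg_cont, of B] assms nonneg_contD(2)[OF assms(1)] by auto
  finally show ?thesis .
qed

lemma I_mean_value:
  assumes \<zeta>: "\<zeta>1 \<in> nonneg_cont" "\<zeta>2 \<in> nonneg_cont" and B: "\<And>y. 0 < y \<Longrightarrow> \<bar>\<zeta>2 y - \<zeta>1 y\<bar> \<le> B"
  obtains \<theta> where "0 \<le> \<theta>" "\<theta> \<le> 1"
    "I \<zeta>2 - I \<zeta>1 = pairing (dI (\<lambda>y. \<zeta>1 y + \<theta> * (\<zeta>2 y - \<zeta>1 y))) (\<lambda>y. \<zeta>2 y - \<zeta>1 y)"
proof -
  let ?\<phi> = "\<lambda>y. \<zeta>2 y - \<zeta>1 y"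
  let ?z = "\<lambda>\<theta> y. \<zeta>1 y + \<theta> * ?\<phi> y"
  have \<phi>: "continuous_on {0<..} ?\<phi>" by (intro continuous_on_diff nonneg_contD(1) \<zeta>)
  have d: "((\<lambda>\<theta>. I (?z \<theta>)) has_real_derivative pairing (dI (?z \<theta>)) ?\<phi>) (at \<theta> within {0..1})" if "\<theta> \<in> {0..1}" for \<theta>
  proof -
    have z: "?z \<theta> \<in> nonneg_cont" using that by (intro nonneg_cont_convex \<zeta>) auto
    have "((\<lambda>\<epsilon>. I (\<lambda>y. ?z \<theta> y + \<epsilon> * ?\<phi> y)) has_real_derivative pairing (dI (?z \<theta>)) ?\<phi>)
      (at 0 within {\<epsilon>. (\<lambda>y. ?z \<theta> y + \<epsilon> * ?\<phi> y) \<in> nonneg_cont})"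
      by (rule I_grad[unfolded is_gradient_def, rule_format, OF z \<phi> sup_norm_finiteI[OF B]])
    \<comment> \<open>\<open>is_gradient\<close> differentiates at step 0 from the point
      \<open>?z \<theta>\<close>. The segment shifted by \<theta> consists of admissible steps,
      which gives the derivative within \<open>{0..1}\<close>, one-sided at the endpoints.\<close>
    moreover have "(\<lambda>x. x - \<theta>) ` {0..1} \<subseteq> {\<epsilon>. (\<lambda>y. ?z \<theta> y + \<epsilon> * ?\<phi> y) \<in> nonneg_cont}"
    proof safe
      fix x :: real assume "x \<in> {0..1}"
      then have "?z x \<in> nonneg_cont" by (intro nonneg_cont_convex \<zeta>) auto
      moreover have "(\<lambda>y. ?z \<theta> y + (x - \<theta>) * ?\<phi> y) = ?z x" by (auto simp: algebra_simps)
      ultimately show "(\<lambda>y. ?z \<theta> y + (x - \<theta>) * ?\<phi> y) \<in> nonneg_cont" by simp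
    qed
    ultimately have "((\<lambda>\<epsilon>. I (\<lambda>y. ?z \<theta> y + \<epsilon> * ?\<phi> y)) has_real_derivative pairing (dI (?z \<theta>)) ?\<phi>)
      (at (\<theta> - \<theta>) within (\<lambda>x. x - \<theta>) ` {0..1})"
      unfolding diff_self by (rule DERIV_subset)
    moreover have "((\<lambda>x. x - \<theta>) has_real_derivative 1) (at \<theta> within {0..1})"
      by (auto intro!: derivative_eq_intros)
    ultimately have "(((\<lambda>\<epsilon>. I (\<lambda>y. ?z \<theta> y + \<epsilon> * ?\<phi> y)) \<circ> (\<lambda>x. x - \<theta>)) has_real_derivative pairing (dI (?z \<theta>)) ?\<phi> * 1) (at \<theta> within {0..1})"
      by (rule DERIV_image_chain)
    moreover have "(\<lambda>\<epsilon>. I (\<lambda>y. ?z \<theta> y + \<epsilon> * ?\<phi> y)) \<circ> (\<lambda>x. x - \<theta>) = (\<lambda>x. I (?z x))"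
    proof
      fix x
      have "(\<lambda>y. ?z \<theta> y + (x - \<theta>) * ?\<phi> y) = ?z x" by (auto simp: algebra_simps)
      then show "((\<lambda>\<epsilon>. I (\<lambda>y. ?z \<theta> y + \<epsilon> * ?\<phi> y)) \<circ> (\<lambda>x. x - \<theta>)) x = I (?z x)" by simp
    qed
    ultimately show ?thesis by simp
  qed
  have "\<exists>\<theta>\<in>{0..1}. I (?z 1) - I (?z 0) = pairing (dI (?z \<theta>)) ?\<phi> * (1 - 0)"
    by (rule mvt_very_simple) (use d in \<open>auto simp: has_field_derivative_def\<close>)
  then show thesis using that by auto
qed

lemma pairing_nonpos:
  assumes \<zeta>: "\<zeta> \<in> nonneg_cont" and \<phi>: "\<And>y. e0 \<le> y \<Longrightarrow> 0 \<le> \<phi> y"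
  shows "pairing (dI \<zeta>) \<phi> \<le> 0"
proof -
  have "0 \<le> (\<integral>y. - (indicator {0<..} y *\<^sub>R (dI \<zeta> y * \<phi> y)) \<partial>lborel)"
  proof (rule integral_nonneg_AE)
    show "AE y in lborel. 0 \<le> - (indicator {0<..} y *\<^sub>R (dI \<zeta> y * \<phi> y))"
      using dI_nonpos[OF \<zeta>] dI_vanishes[OF \<zeta>]
    proof eventually_elim
      case (elim y)
      then show ?case using \<phi>[of y] by (cases "e0 \<le> y") (auto simp: indicator_def mult_nonpos_nonneg)
    qed
  qed
  then show ?thesis by (simp add: pairing_def set_lebesgue_integral_def)
qed

text \<open>As \<open>- dI \<zeta>\<close> is non-negative, a one-sided bound on \<phi> determines
  the estimate; the two-sided bound \<open>B\<close> serves integrability and does not enter the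
  constant.\<close>

lemma pairing_mono_above:
  assumes \<zeta>: "\<zeta> \<in> nonneg_cont" and \<phi>: "continuous_on {0<..} \<phi>" and B: "\<And>y. e0 \<le> y \<Longrightarrow> \<bar>\<phi> y\<bar> \<le> B"
    and K: "\<And>y. e0 \<le> y \<Longrightarrow> \<phi> y \<le> K"
  shows "- pairing (dI \<zeta>) \<phi> \<le> mass \<zeta> * K"
proof -
  have int: "set_integrable lborel {0<..} (\<lambda>y. dI \<zeta> y * \<phi> y)"
    by (rule pairing_integrable_above[OF \<zeta> \<phi> B])
  have "- pairing (dI \<zeta>) \<phi> = (LBINT y:{0<..}. - (dI \<zeta> y * \<phi> y))"
    by (simp add: pairing_def set_lebesgue_integral_def)
  also have "\<dots> \<le> (LBINT y:{0<..}. \<bar>dI \<zeta> y\<bar> * K)"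
  proof (rule set_integral_mono_AE)
    show "set_integrable lborel {0<..} (\<lambda>y. - (dI \<zeta> y * \<phi> y))"
      using set_integrable_mult_right[OF int, of "-1"] by simp
    show "set_integrable lborel {0<..} (\<lambda>y. \<bar>dI \<zeta> y\<bar> * K)"
      by (intro set_integrable_mult_left set_integrable_abs dI_int \<zeta>)
    show "AE y \<in> {0<..} in lborel. - (dI \<zeta> y * \<phi> y) \<le> \<bar>dI \<zeta> y\<bar> * K"
      using dI_nonpos[OF \<zeta>] dI_vanishes[OF \<zeta>]
    proof eventually_elim
      case (elim y)
      then show ?case using mult_left_mono_neg[OF K[of y], of "dI \<zeta> y"] by (cases "e0 \<le> y") auto
    qed
  qed
  also have "\<dots> = mass \<zeta> * K" unfolding mass_def by simp
  finally show ?thesis .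
qed

end

section \<open>Solutions\<close>

text \<open>The spatial derivatives and the value of \<open>rho\<close> along the solution become
  parameters, and in \<open>R_eq\<close> the quotient is multiplied out.\<close>

locale solution = source + functional +
  fixes \<xi> \<xi>1 \<xi>2 :: "real \<Rightarrow> real \<Rightarrow> real" and R :: "real \<Rightarrow> real" and M \<delta> cI :: real
  assumes I_pos: "\<And>\<zeta>. \<zeta> \<in> nonneg_cont \<Longrightarrow> 0 < I \<zeta>"
    and I_h: "\<And>\<zeta>. \<zeta> \<in> nonneg_cont \<Longrightarrow> 0 \<le> I \<zeta> + pairing (dI \<zeta>) h"
    and \<xi>_deriv: "\<And>t y. 0 \<le> t \<Longrightarrow> 0 < y \<Longrightarrow> (\<xi> t has_real_derivative \<xi>1 t y) (at y)"
    and \<xi>1_deriv: "\<And>t y. 0 \<le> t \<Longrightarrow> 0 < y \<Longrightarrow> (\<xi>1 t has_real_derivative \<xi>2 t y) (at y)"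
    and \<xi>_nonneg: "\<And>t y. 0 \<le> t \<Longrightarrow> 0 < y \<Longrightarrow> 0 \<le> \<xi> t y"
    and \<xi>_le: "\<And>t y. 0 \<le> t \<Longrightarrow> 0 < y \<Longrightarrow> \<xi> t y \<le> M"
    and \<xi>1_le: "\<And>t y. 0 \<le> t \<Longrightarrow> 0 < y \<Longrightarrow> y * \<bar>\<xi>1 t y\<bar> \<le> M"
    and \<xi>2_le: "\<And>t y. 0 \<le> t \<Longrightarrow> 0 < y \<Longrightarrow> y\<^sup>2 * \<bar>\<xi>2 t y\<bar> \<le> M"
    and \<xi>_cont: "continuous_on ({0..} \<times> {0<..}) (\<lambda>(t, y). \<xi> t y)"
    and pde: "\<And>t y. 0 < t \<Longrightarrow> 0 < y \<Longrightarrow>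
      ((\<lambda>s. \<xi> s y) has_real_derivative h y + \<xi>1 t y - R t * (\<xi> t y - y * \<xi>1 t y)) (at t)"
    and R_eq: "\<And>t. 0 \<le> t \<Longrightarrow> R t * (p * I (\<xi> t) + pairing (dI (\<xi> t)) (\<lambda>y. \<xi> t y - y * \<xi>1 t y))
        = I (\<xi> t) + pairing (dI (\<xi> t)) (\<lambda>y. h y + \<xi>1 t y)"
    and \<delta>_pos: "0 < \<delta>"
    and den_ge: "\<And>t. 0 \<le> t \<Longrightarrow> \<delta> \<le> p * I (\<xi> t) + pairing (dI (\<xi> t)) (\<lambda>y. \<xi> t y - y * \<xi>1 t y)"
    and cI_pos: "0 < cI" and I_ge: "\<And>t. 0 \<le> t \<Longrightarrow> cI \<le> I (\<xi> t)"
    and \<xi>0_antimono: "antimono_on {0<..} (\<xi> 0)"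
begin

section \<open>Bounds on the solution and continuity in time\<close>

lemma \<xi>_nc: "0 \<le> t \<Longrightarrow> \<xi> t \<in> nonneg_cont"
  unfolding nonneg_cont_def using \<xi>_nonneg
  by (auto intro: DERIV_continuous_on[OF has_field_derivative_at_within[OF \<xi>_deriv]])

lemma \<xi>1_contin: "0 \<le> t \<Longrightarrow> continuous_on {0<..} (\<xi>1 t)"
  by (rule DERIV_continuous_on[OF has_field_derivative_at_within[OF \<xi>1_deriv]]) auto

lemma M_nonneg: "0 \<le> M"
  using \<xi>_nonneg[of 0 1] \<xi>_le[of 0 1] by auto

lemma \<xi>1_above: "0 \<le> t \<Longrightarrow> 0 < a \<Longrightarrow> a \<le> y \<Longrightarrow> \<bar>\<xi>1 t y\<bar> \<le> M / a"
proof -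
  assume "0 \<le> t" "0 < a" "a \<le> y"
  then have "a * \<bar>\<xi>1 t y\<bar> \<le> y * \<bar>\<xi>1 t y\<bar>" by (intro mult_right_mono) auto
  also have "\<dots> \<le> M" using \<xi>1_le \<open>0 \<le> t\<close> \<open>0 < a\<close> \<open>a \<le> y\<close> by auto
  finally show ?thesis using \<open>0 < a\<close> by (simp add: field_simps)
qed

lemma \<xi>2_above: "0 \<le> t \<Longrightarrow> 0 < a \<Longrightarrow> a \<le> y \<Longrightarrow> \<bar>\<xi>2 t y\<bar> \<le> M / a\<^sup>2"
proof -
  assume *: "0 \<le> t" "0 < a" "a \<le> y"
  then have "a\<^sup>2 * \<bar>\<xi>2 t y\<bar> \<le> y\<^sup>2 * \<bar>\<xi>2 t y\<bar>" by (intro mult_right_mono power_mono) auto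
  also have "\<dots> \<le> M" using \<xi>2_le * by auto
  finally show ?thesis using * by (simp add: field_simps)
qed

text \<open>Difference quotients in \<open>y\<close> converge locally uniformly because the second derivative is locally bounded.\<close>

lemma \<xi>1_joint_cont: "continuous_on ({0..} \<times> {0<..}) (\<lambda>(t, y). \<xi>1 t y)"
proof -
  have loc: "continuous_on ({0..} \<times> {a<..}) (\<lambda>(t, y). \<xi>1 t y)" if a: "0 < a" for a
  proof (rule uniform_limit_theorem[where F = sequentially])
    let ?q = "\<lambda>(n::nat) (t::real, y::real). (\<xi> t (y + 1 / Suc n) - \<xi> t y) * real (Suc n)"
    have c1: "continuous_on ({0..} \<times> {a<..}) (\<lambda>z. \<xi> (fst z) (snd z + k))" if "0 \<le> k" for k
    proof -
      have "continuous_on ({0..} \<times> {a<..}) (\<lambda>z. (\<lambda>(t::real, y::real). \<xi> t y) (fst z, snd z + k))"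
        by (rule continuous_on_compose2[OF \<xi>_cont]) (use a that in \<open>auto intro!: continuous_intros\<close>)
      then show ?thesis by simp
    qed
    show "eventually (\<lambda>n. continuous_on ({0..} \<times> {a<..}) (?q n)) sequentially"
      unfolding split_beta using c1[of 0] c1 by (intro always_eventually allI continuous_intros) auto
    show "uniform_limit ({0..} \<times> {a<..}) ?q (\<lambda>(t, y). \<xi>1 t y) sequentially"
    proof (rule uniform_limitI)
      fix e :: real assume "0 < e"
      obtain N where N: "M / a\<^sup>2 < e * real (Suc N)"
        using reals_Archimedean3[OF \<open>0 < e\<close>] by (metis mult.commute less_trans mult_less_cancel_left_pos \<open>0 < e\<close> of_nat_less_iff lessI)
      show "eventually (\<lambda>n. \<forall>z\<in>{0..} \<times> {a<..}. dist (?q n z) ((\<lambda>(t::real, y::real). \<xi>1 t y) z) < e) sequentially"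
        unfolding eventually_sequentially
      proof (intro exI[of _ N] allI impI ballI)
        fix n :: nat and z :: "real \<times> real" assume "N \<le> n" and z: "z \<in> {0..} \<times> {a<..}"
        obtain t y where ty: "z = (t, y)" "0 \<le> t" "a < y" using z by auto
        let ?k = "1 / real (Suc n)"
        have "\<exists>x. x > y \<and> x < y + ?k \<and> \<xi> t (y + ?k) - \<xi> t y = (y + ?k - y) * \<xi>1 t x"
          using ty a by (intro MVT2 \<xi>_deriv) auto
        then obtain x where x: "y < x" "x < y + ?k" "\<xi> t (y + ?k) - \<xi> t y = ?k * \<xi>1 t x" by auto
        then have "(\<xi> t (y + ?k) - \<xi> t y) * real (Suc n) = \<xi>1 t x" by simp
        moreover have "\<bar>\<xi>1 t x - \<xi>1 t y\<bar> \<le> M / a\<^sup>2 * \<bar>x - y\<bar>"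
          by (rule lipschitz_above[where m = a and f' = "\<xi>2 t"])
            (use a ty x in \<open>auto intro!: \<xi>1_deriv \<xi>2_above\<close>)
        moreover have "M / a\<^sup>2 * \<bar>x - y\<bar> \<le> M / a\<^sup>2 * ?k"
          using x M_nonneg by (intro mult_left_mono) auto
        moreover have "M / a\<^sup>2 * ?k < e"
        proof -
          have "e * real (Suc N) \<le> e * real (Suc n)" using \<open>N \<le> n\<close> \<open>0 < e\<close> by (intro mult_left_mono) auto
          then have "M / a\<^sup>2 < e * real (Suc n)" using N by simp
          moreover have "c * (1 / k) < e" if "c < e * k" "0 < k" for c k :: real
            using that by (simp add: field_simps)
          ultimately show ?thesis using of_nat_0_less_iff[of "Suc n"] by blast
        qed
        ultimately show "dist (?q n z) ((\<lambda>(t::real, y::real). \<xi>1 t y) z) < e" using ty by (simp add: dist_real_def)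
      qed
    qed
  qed auto
  show ?thesis unfolding continuous_on_eq_continuous_within
  proof
    fix z :: "real \<times> real" assume z: "z \<in> {0..} \<times> {0<..}"
    define a where "a = snd z / 2"
    have a: "0 < a" "z \<in> {0..} \<times> {a<..}" using z by (auto simp: a_def)
    then have "continuous (at z within {0..} \<times> {a<..}) (\<lambda>(t, y). \<xi>1 t y)"
      using loc[OF a(1), unfolded continuous_on_eq_continuous_within] a(2) by blast
    moreover have "at z within {0..} \<times> {a<..} = at z within {0..} \<times> {0<..}"
      by (rule at_within_nhd[of _ "UNIV \<times> {a<..}"]) (use a in \<open>auto intro!: open_Times\<close>)
    ultimately show "continuous (at z within {0..} \<times> {0<..}) (\<lambda>(t, y). \<xi>1 t y)" by simp
  qed
qed

lemma \<xi>_cont_time: "0 < y \<Longrightarrow> continuous_on {0..} (\<lambda>t. \<xi> t y)"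
  and \<xi>1_cont_time: "0 < y \<Longrightarrow> continuous_on {0..} (\<lambda>t. \<xi>1 t y)"
proof -
  assume y: "0 < y"
  have c: "continuous_on {0..} (\<lambda>t. (t, y))" by (intro continuous_intros)
  have "(\<lambda>t. (t, y)) ` {0..} \<subseteq> {0..} \<times> {0<..}" using y by auto
  from continuous_on_compose2[OF \<xi>_cont c this] continuous_on_compose2[OF \<xi>1_joint_cont c this]
  show "continuous_on {0..} (\<lambda>t. \<xi> t y)" "continuous_on {0..} (\<lambda>t. \<xi>1 t y)" by auto
qed

definition A0 :: real where "A0 = mass (\<lambda>_. 0) + C * M"

lemma mass_le: "\<zeta> \<in> nonneg_cont \<Longrightarrow> (\<And>y. 0 < y \<Longrightarrow> \<zeta> y \<le> M) \<Longrightarrow> mass \<zeta> \<le> A0"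
  unfolding A0_def by (rule mass_bound)

lemma A0_nonneg: "0 \<le> A0"
  using mass_le[OF \<xi>_nc[of 0] \<xi>_le[of 0]] mass_nonneg[of "\<xi> 0"] by linarith

lemma hat_\<xi>_le: "0 \<le> t \<Longrightarrow> hat (\<xi> t) y \<le> M"
  using \<xi>_le[of t "max y e0"] e0_pos by (auto simp: hat_def)

text \<open>The direction is controlled only above \<open>e0\<close>; \<open>hat\<close> extends
  this control to the half-line, where \<open>pairing_bound\<close> applies.\<close>

lemma pairing_le:
  assumes t: "0 \<le> t" and \<phi>: "continuous_on {0<..} \<phi>" and K: "\<And>y. e0 \<le> y \<Longrightarrow> \<bar>\<phi> y\<bar> \<le> K"
  shows "\<bar>pairing (dI (\<xi> t)) \<phi>\<bar> \<le> K * A0"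
proof -
  have K0: "0 \<le> K" using K[of e0] by (auto intro: order_trans[OF abs_ge_zero])
  have "\<bar>pairing (dI (\<xi> t)) \<phi>\<bar> = \<bar>pairing (dI (hat (\<xi> t))) (hat \<phi>)\<bar>"
    using pairing_hat[OF \<xi>_nc[OF t] \<phi> K] by simp
  also have "\<dots> \<le> K * mass (hat (\<xi> t))"
    unfolding mass_def
    by (rule pairing_bound(2)[OF dI_int[OF hat_nonneg_cont[OF \<xi>_nc[OF t]]] hat_cont[OF \<phi>]]) (use K in \<open>auto simp: hat_def\<close>)
  also have "\<dots> \<le> K * A0"
    using K0 t by (intro mult_left_mono mass_le hat_nonneg_cont \<xi>_nc hat_\<xi>_le)
  finally show ?thesis .
qed

lemma h\<xi>1_cont: "0 \<le> t \<Longrightarrow> continuous_on {0<..} (\<lambda>y. h y + \<xi>1 t y)"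
  and h\<xi>1_le: "0 \<le> t \<Longrightarrow> e0 \<le> y \<Longrightarrow> \<bar>h y + \<xi>1 t y\<bar> \<le> h e0 + M / e0"
proof -
  assume t: "0 \<le> t"
  show "continuous_on {0<..} (\<lambda>y. h y + \<xi>1 t y)" by (intro continuous_intros h_cont \<xi>1_contin t)
  assume y: "e0 \<le> y"
  have "0 < h y" "h y \<le> h e0" using h_pos h_antimono[OF e0_pos y] e0_pos y by auto
  then show "\<bar>h y + \<xi>1 t y\<bar> \<le> h e0 + M / e0" using \<xi>1_above[OF t e0_pos y] by linarith
qed

lemma psi_cont: "0 \<le> t \<Longrightarrow> continuous_on {0<..} (\<lambda>y. \<xi> t y - y * \<xi>1 t y)"
  and psi_le: "0 \<le> t \<Longrightarrow> 0 < y \<Longrightarrow> \<bar>\<xi> t y - y * \<xi>1 t y\<bar> \<le> 2 * M"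
proof -
  assume t: "0 \<le> t"
  show "continuous_on {0<..} (\<lambda>y. \<xi> t y - y * \<xi>1 t y)"
    by (intro continuous_intros \<xi>1_contin nonneg_contD(1) \<xi>_nc t)
  assume y: "0 < y"
  have "\<bar>y * \<xi>1 t y\<bar> \<le> M" using \<xi>1_le[OF t y] y by (simp add: abs_mult)
  then show "\<bar>\<xi> t y - y * \<xi>1 t y\<bar> \<le> 2 * M" using \<xi>_le[OF t y] \<xi>_nonneg[OF t y] by linarith
qed

definition I_max :: real where "I_max = I (\<lambda>_. 0)"

text \<open>Since the gradient is non-positive, \<open>I\<close> does not increase along the segment
  from 0 to \<open>\<xi> t\<close>.\<close>

lemma I_le: "0 \<le> t \<Longrightarrow> I (\<xi> t) \<le> I_max"
proof -
  assume t: "0 \<le> t"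
  obtain \<theta> where \<theta>: "0 \<le> \<theta>" "\<theta> \<le> 1"
    "I (\<xi> t) - I (\<lambda>_. 0) = pairing (dI (\<lambda>y. 0 + \<theta> * (\<xi> t y - 0))) (\<lambda>y. \<xi> t y - 0)"
    by (rule I_mean_value[OF zero_nonneg_cont \<xi>_nc[OF t], of M]) (use \<xi>_le \<xi>_nonneg t in auto)
  have "pairing (dI (\<lambda>y. 0 + \<theta> * (\<xi> t y - 0))) (\<lambda>y. \<xi> t y - 0) \<le> 0"
    by (rule pairing_nonpos[OF nonneg_cont_convex[OF zero_nonneg_cont \<xi>_nc[OF t] \<theta>(1,2)]])
      (use \<xi>_nonneg[OF t] e0_pos in auto)
  then show ?thesis using \<theta>(3) by (simp add: I_max_def)
qed

definition R_max :: real where "R_max = (I_max + (h e0 + M / e0) * A0) / \<delta>"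

lemma R_le: "0 \<le> t \<Longrightarrow> \<bar>R t\<bar> \<le> R_max"
proof -
  assume t: "0 \<le> t"
  have "\<bar>R t\<bar> * \<delta> \<le> \<bar>R t\<bar> * (p * I (\<xi> t) + pairing (dI (\<xi> t)) (\<lambda>y. \<xi> t y - y * \<xi>1 t y))"
    using den_ge[OF t] by (intro mult_left_mono) auto
  also have "\<dots> = \<bar>I (\<xi> t) + pairing (dI (\<xi> t)) (\<lambda>y. h y + \<xi>1 t y)\<bar>"
    unfolding R_eq[OF t, symmetric] abs_mult using den_ge[OF t] \<delta>_pos by simp
  also have "\<dots> \<le> I_max + (h e0 + M / e0) * A0"
    using pairing_le[OF t h\<xi>1_cont[OF t] h\<xi>1_le[OF t]] I_le[OF t] I_pos[OF \<xi>_nc[OF t]] by (simp add: abs_le_iff)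
  finally show ?thesis using \<delta>_pos by (simp add: R_max_def field_simps)
qed

abbreviation rhs :: "real \<Rightarrow> real \<Rightarrow> real" where "rhs t y \<equiv> h y + \<xi>1 t y - R t * (\<xi> t y - y * \<xi>1 t y)"

text \<open>Bound on the time derivative at points y \<ge> \<open>e0\<close>, hence a Lipschitz
  constant in time for \<open>hat (\<xi> t)\<close> that is uniform in space.\<close>

definition L :: real where "L = h e0 + M / e0 + R_max * (2 * M)"

lemma rhs_le: "0 \<le> t \<Longrightarrow> e0 \<le> y \<Longrightarrow> \<bar>rhs t y\<bar> \<le> L"
proof -
  assume t: "0 \<le> t" and y: "e0 \<le> y"
  then have y0: "0 < y" using e0_pos by simp
  have "\<bar>R t * (\<xi> t y - y * \<xi>1 t y)\<bar> \<le> R_max * (2 * M)"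
    unfolding abs_mult using R_le[OF t] psi_le[OF t y0] by (intro mult_mono) auto
  then show ?thesis using h\<xi>1_le[OF t y] unfolding L_def by linarith
qed

lemma L_nonneg: "0 \<le> L"
  using rhs_le[of 0 e0] by (auto intro: order_trans[OF abs_ge_zero])

lemma \<xi>_time_lipschitz:
  assumes "0 \<le> s" "0 \<le> t" "e0 \<le> y"
  shows "\<bar>\<xi> t y - \<xi> s y\<bar> \<le> L * \<bar>t - s\<bar>"
proof -
  have y: "0 < y" using assms e0_pos by simp
  have *: "\<bar>\<xi> b y - \<xi> a y\<bar> \<le> L * (b - a)" if "0 \<le> a" "a < b" for a b
  proof -
    have "continuous_on {a..b} (\<lambda>t. \<xi> t y)"
      by (rule continuous_on_subset[OF \<xi>_cont_time[OF y]]) (use that in auto)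
    moreover have "(\<lambda>t. \<xi> t y) differentiable (at x)" if "a < x" "x < b" for x
      unfolding real_differentiable_def by (rule exI, rule pde) (use that y \<open>0 \<le> a\<close> in auto)
    ultimately have "\<exists>l z. a < z \<and> z < b \<and> DERIV (\<lambda>t. \<xi> t y) z :> l \<and> \<xi> b y - \<xi> a y = (b - a) * l"
      by (rule MVT[OF that(2)])
    then obtain l z where z: "a < z" "DERIV (\<lambda>t. \<xi> t y) z :> l" "\<xi> b y - \<xi> a y = (b - a) * l" by auto
    have "l = rhs z y" using z that y by (intro DERIV_unique[OF z(2) pde]) auto
    then have "\<bar>l\<bar> \<le> L" using rhs_le[of z y] z that assms(3) by auto
    then have "(b - a) * \<bar>l\<bar> \<le> (b - a) * L" using that by (intro mult_left_mono) auto
    then show ?thesis using z(3) that by (simp add: abs_mult mult.commute)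
  qed
  consider "s < t" | "s = t" | "t < s" by linarith
  then show ?thesis using *[of s t] *[of t s] assms by cases (auto simp: abs_minus_commute)
qed

lemma hat_time_lipschitz: "0 \<le> s \<Longrightarrow> 0 \<le> t \<Longrightarrow> \<bar>hat (\<xi> t) y - hat (\<xi> s) y\<bar> \<le> L * \<bar>t - s\<bar>"
  unfolding hat_def by (rule \<xi>_time_lipschitz) auto

lemma tendsto_lipschitz_zero: "X \<longlonglongrightarrow> t \<Longrightarrow> (\<lambda>n. C * (L * \<bar>X n - t\<bar>)) \<longlonglongrightarrow> 0"
  by (intro tendsto_mult_right_zero tendsto_rabs_zero) (simp add: LIM_zero_iff)

text \<open>\<open>hat (\<xi> t)\<close> is Lipschitz in time in the supremum norm, so by property
  (b) its gradient is Lipschitz in time in L^1. For the directions, pointwise continuity with a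
  common bound is then enough.\<close>

lemma pairing_time_cont:
  assumes \<phi>: "\<And>t. 0 \<le> t \<Longrightarrow> continuous_on {0<..} (\<phi> t)"
    and K: "\<And>t y. 0 \<le> t \<Longrightarrow> e0 \<le> y \<Longrightarrow> \<bar>\<phi> t y\<bar> \<le> K"
    and \<phi>_time: "\<And>y. 0 < y \<Longrightarrow> continuous_on {0..} (\<lambda>t. \<phi> t y)"
  shows "continuous_on {0..} (\<lambda>t. pairing (dI (\<xi> t)) (\<phi> t))"
  unfolding continuous_on_sequentially
proof (intro ballI allI impI)
  fix X :: "nat \<Rightarrow> real" and t
  assume t: "t \<in> {0..}" and X: "(\<forall>n. X n \<in> {0..}) \<and> X \<longlonglongrightarrow> t"
  have X0: "0 \<le> X n" for n using X by auto
  have t0: "0 \<le> t" using t by auto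
  have "(\<lambda>n. pairing (dI (hat (\<xi> (X n)))) (hat (\<phi> (X n)))) \<longlonglongrightarrow> pairing (dI (hat (\<xi> t))) (hat (\<phi> t))"
  proof (rule pairing_tendsto)
    show "(\<lambda>n. LBINT y:{0<..}. \<bar>dI (hat (\<xi> (X n))) y - dI (hat (\<xi> t)) y\<bar>) \<longlonglongrightarrow> 0"
    proof (rule Lim_null_comparison[OF always_eventually tendsto_lipschitz_zero], rule allI)
      show "norm (LBINT y:{0<..}. \<bar>dI (hat (\<xi> (X n))) y - dI (hat (\<xi> t)) y\<bar>) \<le> C * (L * \<bar>X n - t\<bar>)" for n
        using dI_lipschitz[OF hat_nonneg_cont[OF \<xi>_nc[OF X0[of n]]] hat_nonneg_cont[OF \<xi>_nc[OF t0]] hat_time_lipschitz[OF t0 X0[of n]]]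
          Bochner_Integration.integral_nonneg[of lborel "\<lambda>y. indicator {0<..} y *\<^sub>R \<bar>dI (hat (\<xi> (X n))) y - dI (hat (\<xi> t)) y\<bar>"]
        by (simp add: set_lebesgue_integral_def)
    qed (use X in auto)
    show "(\<lambda>n. hat (\<phi> (X n)) y) \<longlonglongrightarrow> hat (\<phi> t) y" for y
      unfolding hat_def using \<phi>_time[of "max y e0"] e0_pos X t
      by (auto simp: continuous_on_sequentially o_def)
    show "\<bar>hat (\<phi> (X n)) y\<bar> \<le> K" for n y unfolding hat_def using K[OF X0] by auto
  qed (auto intro!: dI_int hat_nonneg_cont \<xi>_nc X0 t0 hat_cont \<phi>)
  then show "((\<lambda>t. pairing (dI (\<xi> t)) (\<phi> t)) \<circ> X) \<longlonglongrightarrow> pairing (dI (\<xi> t)) (\<phi> t)"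
    unfolding o_def using pairing_hat[OF \<xi>_nc \<phi> K] X0 t0 by simp
qed

section \<open>Differentiation of the functional along the solution\<close>

lemma I_quotient:
  assumes "0 \<le> s" "0 \<le> t"
  obtains \<theta> where "0 \<le> \<theta>" "\<theta> \<le> 1"
    "I (\<xi> s) - I (\<xi> t) = pairing (dI (\<lambda>y. hat (\<xi> t) y + \<theta> * (hat (\<xi> s) y - hat (\<xi> t) y))) (\<lambda>y. hat (\<xi> s) y - hat (\<xi> t) y)"
  using I_mean_value[OF hat_nonneg_cont[OF \<xi>_nc[OF assms(2)]] hat_nonneg_cont[OF \<xi>_nc[OF assms(1)]] hat_time_lipschitz[OF assms(2,1)]]
    I_hat[OF \<xi>_nc[OF assms(1)]] I_hat[OF \<xi>_nc[OF assms(2)]] by metis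

lemma I_time_cont: "continuous_on {0..} (\<lambda>t. I (\<xi> t))"
proof -
  have "\<bar>I (\<xi> s) - I (\<xi> t)\<bar> \<le> (L * A0) * \<bar>s - t\<bar>" if st: "0 \<le> s" "0 \<le> t" for s t
  proof -
    obtain \<theta> where \<theta>: "0 \<le> \<theta>" "\<theta> \<le> 1"
      "I (\<xi> s) - I (\<xi> t) = pairing (dI (\<lambda>y. hat (\<xi> t) y + \<theta> * (hat (\<xi> s) y - hat (\<xi> t) y))) (\<lambda>y. hat (\<xi> s) y - hat (\<xi> t) y)"
      by (rule I_quotient[OF st])
    let ?z = "\<lambda>y. hat (\<xi> t) y + \<theta> * (hat (\<xi> s) y - hat (\<xi> t) y)"
    have z: "?z \<in> nonneg_cont" using st \<theta> by (intro nonneg_cont_convex hat_nonneg_cont \<xi>_nc)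
    have zM: "?z y \<le> M" for y
    proof -
      have "?z y = (1 - \<theta>) * hat (\<xi> t) y + \<theta> * hat (\<xi> s) y" by (simp add: algebra_simps)
      also have "\<dots> \<le> (1 - \<theta>) * M + \<theta> * M" using \<theta> hat_\<xi>_le st by (intro add_mono mult_left_mono) auto
      finally show ?thesis by (simp add: algebra_simps)
    qed
    have "\<bar>I (\<xi> s) - I (\<xi> t)\<bar> \<le> (L * \<bar>s - t\<bar>) * mass ?z"
      unfolding \<theta>(3) mass_def
      by (rule pairing_bound(2)[OF dI_int[OF z] continuous_on_diff[OF nonneg_contD(1) nonneg_contD(1)]])
        (use st hat_time_lipschitz in \<open>auto intro!: hat_nonneg_cont \<xi>_nc\<close>)
    also have "\<dots> \<le> (L * \<bar>s - t\<bar>) * A0" using L_nonneg mass_le[OF z zM] by (intro mult_left_mono) auto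
    finally show ?thesis by (simp add: mult_ac)
  qed
  then have "(L * A0)-lipschitz_on {0..} (\<lambda>t. I (\<xi> t))"
    using L_nonneg A0_nonneg by (intro lipschitz_onI) (auto simp: dist_real_def)
  then show ?thesis by (rule lipschitz_on_continuous_on)
qed

lemma R_time_cont: "continuous_on {0..} R"
proof -
  have num: "continuous_on {0..} (\<lambda>t. pairing (dI (\<xi> t)) (\<lambda>y. h y + \<xi>1 t y))"
    by (rule pairing_time_cont[OF h\<xi>1_cont h\<xi>1_le]) (auto intro!: continuous_intros \<xi>1_cont_time)
  have den: "continuous_on {0..} (\<lambda>t. pairing (dI (\<xi> t)) (\<lambda>y. \<xi> t y - y * \<xi>1 t y))"
    by (rule pairing_time_cont[OF psi_cont psi_le]) (use e0_pos in \<open>auto intro!: continuous_intros \<xi>1_cont_time \<xi>_cont_time\<close>)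
  have nz: "p * I (\<xi> t) + pairing (dI (\<xi> t)) (\<lambda>y. \<xi> t y - y * \<xi>1 t y) \<noteq> 0" if "0 \<le> t" for t
    using den_ge[OF that] \<delta>_pos by linarith
  have "continuous_on {0..} (\<lambda>t. (I (\<xi> t) + pairing (dI (\<xi> t)) (\<lambda>y. h y + \<xi>1 t y)) / (p * I (\<xi> t) + pairing (dI (\<xi> t)) (\<lambda>y. \<xi> t y - y * \<xi>1 t y)))"
    using nz by (intro continuous_intros num den I_time_cont) auto
  then show ?thesis
    by (rule continuous_on_eq) (use R_eq nz in \<open>auto simp: field_simps\<close>)
qed

lemma pairing_rhs: "0 \<le> t \<Longrightarrow> pairing (dI (\<xi> t)) (rhs t) = (p * R t - 1) * I (\<xi> t)"
proof -
  assume t: "0 \<le> t"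
  note i1 = pairing_integrable_above[OF \<xi>_nc[OF t] h\<xi>1_cont[OF t] h\<xi>1_le[OF t]]
  have i2: "set_integrable lborel {0<..} (\<lambda>y. dI (\<xi> t) y * (\<xi> t y - y * \<xi>1 t y))"
    by (rule pairing_integrable_above[OF \<xi>_nc[OF t] psi_cont[OF t] psi_le[OF t]]) (use e0_pos in auto)
  have "pairing (dI (\<xi> t)) (rhs t)
      = (LBINT y:{0<..}. dI (\<xi> t) y * (h y + \<xi>1 t y) - R t * (dI (\<xi> t) y * (\<xi> t y - y * \<xi>1 t y)))"
    unfolding pairing_def by (simp add: right_diff_distrib mult.left_commute)
  also have "\<dots> = pairing (dI (\<xi> t)) (\<lambda>y. h y + \<xi>1 t y) - R t * pairing (dI (\<xi> t)) (\<lambda>y. \<xi> t y - y * \<xi>1 t y)"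
    unfolding pairing_def using set_integral_diff(2)[OF i1 set_integrable_mult_right[OF i2, of "R t"]] by simp
  finally show ?thesis using R_eq[OF t] by (simp add: algebra_simps)
qed

text \<open>The gradient differentiates only along straight lines, so each chord of the curve is
  treated by the mean value theorem. The intermediate points converge uniformly after
  \<open>hat\<close>, while the difference quotients are bounded by \<open>L\<close> and converge
  pointwise by the equation.\<close>

lemma I_time_deriv:
  assumes t: "0 < t"
  shows "((\<lambda>s. I (\<xi> s)) has_real_derivative (p * R t - 1) * I (\<xi> t)) (at t)"
proof -
  have t0: "0 \<le> t" using t by simp
  have "((\<lambda>s. (I (\<xi> s) - I (\<xi> t)) / (s - t)) \<longlongrightarrow> pairing (dI (hat (\<xi> t))) (hat (rhs t))) (at t within {0<..})"
    unfolding tendsto_at_iff_sequentially o_def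
  proof (intro allI impI)
    fix X :: "nat \<Rightarrow> real"
    assume X: "\<forall>i. X i \<in> {0<..} - {t}" "X \<longlonglongrightarrow> t"
    have X0: "0 \<le> X n" "X n \<noteq> t" for n using X(1) by (auto simp: less_imp_le)
    have "\<exists>\<theta>. 0 \<le> \<theta> \<and> \<theta> \<le> 1 \<and> I (\<xi> (X n)) - I (\<xi> t) =
        pairing (dI (\<lambda>y. hat (\<xi> t) y + \<theta> * (hat (\<xi> (X n)) y - hat (\<xi> t) y))) (\<lambda>y. hat (\<xi> (X n)) y - hat (\<xi> t) y)" for n
      by (rule I_quotient[OF X0(1)[of n] t0]) blast
    then obtain \<theta> where \<theta>: "\<And>n. 0 \<le> \<theta> n" "\<And>n. \<theta> n \<le> 1" "\<And>n. I (\<xi> (X n)) - I (\<xi> t) =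
        pairing (dI (\<lambda>y. hat (\<xi> t) y + \<theta> n * (hat (\<xi> (X n)) y - hat (\<xi> t) y))) (\<lambda>y. hat (\<xi> (X n)) y - hat (\<xi> t) y)"
      by metis
    define z where "z n y = hat (\<xi> t) y + \<theta> n * (hat (\<xi> (X n)) y - hat (\<xi> t) y)" for n y
    define \<phi> where "\<phi> n y = (hat (\<xi> (X n)) y - hat (\<xi> t) y) / (X n - t)" for n y
    have z_nc: "z n \<in> nonneg_cont" for n
      unfolding z_def using X0 t0 \<theta> by (intro nonneg_cont_convex hat_nonneg_cont \<xi>_nc)
    have zl: "\<bar>z n y - hat (\<xi> t) y\<bar> \<le> L * \<bar>X n - t\<bar>" for n y
    proof -
      have "\<bar>z n y - hat (\<xi> t) y\<bar> = \<theta> n * \<bar>hat (\<xi> (X n)) y - hat (\<xi> t) y\<bar>"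
        using \<theta>(1)[of n] by (simp add: z_def abs_mult)
      also have "\<dots> \<le> 1 * (L * \<bar>X n - t\<bar>)"
        using \<theta> hat_time_lipschitz[OF t0 X0(1)] by (intro mult_mono) auto
      finally show ?thesis by simp
    qed
    have "(\<lambda>n. pairing (dI (z n)) (\<phi> n)) \<longlonglongrightarrow> pairing (dI (hat (\<xi> t))) (hat (rhs t))"
    proof (rule pairing_tendsto)
      show "(\<lambda>n. LBINT y:{0<..}. \<bar>dI (z n) y - dI (hat (\<xi> t)) y\<bar>) \<longlonglongrightarrow> 0"
      proof (rule Lim_null_comparison[OF always_eventually tendsto_lipschitz_zero[OF X(2)]], rule allI)
        show "norm (LBINT y:{0<..}. \<bar>dI (z n) y - dI (hat (\<xi> t)) y\<bar>) \<le> C * (L * \<bar>X n - t\<bar>)" for n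
          using dI_lipschitz[OF z_nc[of n] hat_nonneg_cont[OF \<xi>_nc[OF t0]] zl[of n]]
            Bochner_Integration.integral_nonneg[of lborel "\<lambda>y. indicator {0<..} y *\<^sub>R \<bar>dI (z n) y - dI (hat (\<xi> t)) y\<bar>"]
          by (simp add: set_lebesgue_integral_def)
      qed
      show "\<bar>\<phi> n y\<bar> \<le> L" for n y
        using hat_time_lipschitz[OF t0 X0(1)[of n], of y] X0(2)[of n] by (simp add: \<phi>_def pos_divide_le_eq)
      show "(\<lambda>n. \<phi> n y) \<longlonglongrightarrow> hat (rhs t) y" for y
      proof -
        let ?y = "max y e0"
        have "((\<lambda>s. (\<xi> s ?y - \<xi> t ?y) / (s - t)) \<longlongrightarrow> rhs t ?y) (at t)"
          using pde[OF t, of ?y] e0_pos by (auto simp: has_field_derivative_iff)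
        moreover have "filterlim X (at t) sequentially"
          unfolding filterlim_at using X X0 by auto
        ultimately have "(\<lambda>n. (\<xi> (X n) ?y - \<xi> t ?y) / (X n - t)) \<longlonglongrightarrow> rhs t ?y"
          by (rule filterlim_compose)
        then show ?thesis by (simp add: \<phi>_def hat_def)
      qed
      show "continuous_on {0<..} (\<phi> n)" for n
        unfolding \<phi>_def using X0 t0 by (intro continuous_intros nonneg_contD(1) hat_nonneg_cont \<xi>_nc) auto
      show "continuous_on {0<..} (hat (rhs t))"
        by (intro hat_cont continuous_on_diff h\<xi>1_cont continuous_on_mult continuous_on_const psi_cont t0)
    qed (auto intro!: dI_int z_nc hat_nonneg_cont \<xi>_nc t0)
    moreover have "pairing (dI (z n)) (\<phi> n) = (I (\<xi> (X n)) - I (\<xi> t)) / (X n - t)" for n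
      unfolding \<theta>(3)[of n] \<phi>_def pairing_def z_def[symmetric] by simp
    ultimately show "(\<lambda>n. (I (\<xi> (X n)) - I (\<xi> t)) / (X n - t)) \<longlonglongrightarrow> pairing (dI (hat (\<xi> t))) (hat (rhs t))"
      by simp
  qed
  moreover have "pairing (dI (hat (\<xi> t))) (hat (rhs t)) = pairing (dI (\<xi> t)) (rhs t)"
    by (rule pairing_hat[OF \<xi>_nc[OF t0] _ rhs_le[OF t0], symmetric])
      (intro continuous_on_diff h\<xi>1_cont continuous_on_mult continuous_on_const psi_cont t0)
  ultimately show ?thesis
    unfolding has_field_derivative_iff pairing_rhs[OF t0] using t by (simp add: at_within_open[of t "{0<..}"])
qed

end

section \<open>Monotone profiles, the sign of the rate and bounds on the growth factor\<close>

sublocale solution \<subseteq> flow p h_inf H h h1 h2 R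
  by unfold_locales (rule R_time_cont)

context solution
begin

text \<open>\<open>ln (I (\<xi> t))\<close> and \<open>p * ln (v t)\<close> have the same derivative
  \<open>p * R t - 1\<close>.\<close>

lemma I_v: "0 \<le> t \<Longrightarrow> I (\<xi> t) = I (\<xi> 0) * v t powr p"
proof -
  assume t: "0 \<le> t"
  have dv: "((\<lambda>s. ln (v s)) has_real_derivative \<omega> s) (at s)" if "0 < s" for s
    by (rule DERIV_cong[OF DERIV_chain2[OF DERIV_ln_divide[OF v_pos] v_deriv[OF that]]])
      (use v_pos[of s] in \<open>simp add: less_imp_neq[symmetric]\<close>)
  have dI: "((\<lambda>s. ln (I (\<xi> s))) has_real_derivative p * R s - 1) (at s)" if "0 < s" for s
  proof -
    have "0 < I (\<xi> s)" using I_pos[OF \<xi>_nc] that by simp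
    from DERIV_chain2[OF DERIV_ln_divide[OF this] I_time_deriv[OF that]] this show ?thesis by simp
  qed
  have "ln (I (\<xi> t)) - p * ln (v t) = ln (I (\<xi> 0)) - p * ln (v 0)"
  proof (cases "t = 0")
    case False
    then have "0 < t" using t by simp
    then show ?thesis
    proof (rule DERIV_isconst_end[of 0 t "\<lambda>s. ln (I (\<xi> s)) - p * ln (v s)"])
      show "continuous_on {0..t} (\<lambda>s. ln (I (\<xi> s)) - p * ln (v s))"
        using I_pos[OF \<xi>_nc] v_pos
        by (intro continuous_intros continuous_on_subset[OF I_time_cont] continuous_on_subset[OF v_cont])
          (auto simp: less_imp_neq[symmetric])
      show "((\<lambda>s. ln (I (\<xi> s)) - p * ln (v s)) has_real_derivative 0) (at s)" if "0 < s" for s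
        by (rule DERIV_cong[OF DERIV_diff[OF dI[OF that] DERIV_cmult[OF dv[OF that]]]]) (use p_pos in \<open>simp add: \<omega>_def algebra_simps\<close>)
    qed
  qed simp
  then have "ln (I (\<xi> t)) = ln (I (\<xi> 0)) + p * ln (v t)" by (simp add: v_def)
  then have "exp (ln (I (\<xi> t))) = exp (ln (I (\<xi> 0))) * exp (p * ln (v t))" by (simp add: exp_add)
  then show ?thesis using I_pos[OF \<xi>_nc] t less_imp_neq[OF v_pos[of t]] by (simp add: powr_def)
qed

lemma \<xi>_formula:
  assumes "0 \<le> t" "0 < y"
  shows "P t * \<xi> t y = \<xi> 0 (P t * y + Q t) + integral {0..t} (\<lambda>s. P s * h (Y t y s))"
    "P t * (\<xi> t y - xi y) = (\<xi> 0 (P t * y + Q t) - xi (P t * y + Q t)) - integral {0..t} (\<lambda>s. P s * \<omega> s * \<psi> (Y t y s))"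
  using characteristics[OF pde \<xi>_deriv \<xi>_cont \<xi>1_joint_cont assms] by auto

lemma Q_nonneg: "0 \<le> t \<Longrightarrow> 0 \<le> Q t"
  using Q_mono[of 0 t] by simp

lemma P_h_int: "0 \<le> t \<Longrightarrow> 0 < y \<Longrightarrow> (\<lambda>s. P s * h (Y t y s)) integrable_on {0..t}"
  using Y_pos by (intro integrable_continuous_interval continuous_intros continuous_on_subset[OF P_cont]
    continuous_on_compose2[OF h_cont Y_cont]) auto

text \<open>The flow preserves the order of points, and both the initial profile and
  \<open>h\<close> are decreasing.\<close>

lemma \<xi>_antimono: "0 \<le> t \<Longrightarrow> 0 < x \<Longrightarrow> x \<le> y \<Longrightarrow> \<xi> t y \<le> \<xi> t x"
proof -
  assume *: "0 \<le> t" "0 < x" "x \<le> y"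
  have Px: "P t * x \<le> P t * y" using * less_imp_le[OF P_pos[of t]] by (intro mult_left_mono) auto
  have "\<xi> 0 (P t * y + Q t) \<le> \<xi> 0 (P t * x + Q t)"
    using Px Q_nonneg[of t] * by (intro monotone_onD[OF \<xi>0_antimono]) (auto intro!: add_pos_nonneg)
  moreover have "integral {0..t} (\<lambda>s. P s * h (Y t y s)) \<le> integral {0..t} (\<lambda>s. P s * h (Y t x s))"
  proof (rule integral_le[OF P_h_int P_h_int])
    fix s assume s: "s \<in> {0..t}"
    have "Y t x s \<le> Y t y s" unfolding Y_def using Px less_imp_le[OF P_pos[of s]] by (intro divide_right_mono) auto
    then show "P s * h (Y t y s) \<le> P s * h (Y t x s)"
      using h_antimono[of "Y t x s" "Y t y s"] Y_pos[of x s t] * s less_imp_le[OF P_pos[of s]]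
      by (intro mult_left_mono) auto
  qed (use * in auto)
  ultimately have "P t * \<xi> t y \<le> P t * \<xi> t x" using \<xi>_formula(1) * by simp
  then show ?thesis by simp
qed

lemma \<xi>1_nonpos: "0 \<le> t \<Longrightarrow> 0 < y \<Longrightarrow> \<xi>1 t y \<le> 0"
proof (rule ccontr)
  assume *: "0 \<le> t" "0 < y" "\<not> \<xi>1 t y \<le> 0"
  then obtain d where d: "0 < d" "\<And>k. 0 < k \<Longrightarrow> k < d \<Longrightarrow> \<xi> t y < \<xi> t (y + k)"
    using DERIV_pos_inc_right[OF \<xi>_deriv[OF *(1,2)]] by (auto simp: not_le)
  show False using d(2)[of "d/2"] d(1) \<xi>_antimono[of t y "y + d/2"] * by auto
qed

lemma R_nonneg: "0 \<le> t \<Longrightarrow> 0 \<le> R t"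
proof -
  assume t: "0 \<le> t"
  have h_le: "\<bar>h y\<bar> \<le> h e0" if "e0 \<le> y" for y
    using h_antimono[OF e0_pos that] h_pos[of y] e0_pos that by simp
  note int1 = pairing_integrable_above[OF \<xi>_nc[OF t] h_cont h_le]
  note int2 = pairing_integrable_above[OF \<xi>_nc[OF t] \<xi>1_contin[OF t] \<xi>1_above[OF t e0_pos]]
  have "pairing (dI (\<xi> t)) (\<lambda>y. h y + \<xi>1 t y) = pairing (dI (\<xi> t)) h + pairing (dI (\<xi> t)) (\<xi>1 t)"
    unfolding pairing_def distrib_left by (rule set_integral_add(2)[OF int1 int2])
  moreover have "0 \<le> pairing (dI (\<xi> t)) (\<xi>1 t)"
    using pairing_nonpos[OF \<xi>_nc[OF t], of "\<lambda>y. - \<xi>1 t y"] \<xi>1_nonpos[OF t] e0_pos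
    by (auto simp: pairing_def set_lebesgue_integral_def)
  ultimately have "0 \<le> R t * (p * I (\<xi> t) + pairing (dI (\<xi> t)) (\<lambda>y. \<xi> t y - y * \<xi>1 t y))"
    using R_eq[OF t] I_h[OF \<xi>_nc[OF t]] by simp
  then show ?thesis using den_ge[OF t] \<delta>_pos by (simp add: zero_le_mult_iff)
qed

lemma v_bounds: "0 \<le> t \<Longrightarrow> (cI / I (\<xi> 0)) powr (1/p) \<le> v t" "0 \<le> t \<Longrightarrow> v t \<le> (I_max / I (\<xi> 0)) powr (1/p)"
proof -
  assume t: "0 \<le> t"
  have I0: "0 < I (\<xi> 0)" using I_pos[OF \<xi>_nc[of 0]] by simp
  have "v t = (v t powr p) powr (1/p)" using p_pos abs_of_pos[OF v_pos[of t]] by (simp add: powr_powr)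
  also have "v t powr p = I (\<xi> t) / I (\<xi> 0)" using I_v[OF t] I0 by (simp add: field_simps)
  finally have eq: "v t = (I (\<xi> t) / I (\<xi> 0)) powr (1/p)" .
  show "(cI / I (\<xi> 0)) powr (1/p) \<le> v t"
    unfolding eq using cI_pos I_ge[OF t] I0 p_pos by (intro powr_mono2 divide_right_mono) auto
  show "v t \<le> (I_max / I (\<xi> 0)) powr (1/p)"
    unfolding eq using I_le[OF t] I_pos[OF \<xi>_nc[OF t]] I0 p_pos by (intro powr_mono2 divide_right_mono divide_nonneg_nonneg) auto
qed

end

sublocale solution \<subseteq> bounded_flow p h_inf H h h1 h2 R "(cI / I (\<xi> 0)) powr (1/p)" "(I_max / I (\<xi> 0)) powr (1/p)"
proof unfold_locales
  show "0 < (cI / I (\<xi> 0)) powr (1/p)" using cI_pos I_pos[OF \<xi>_nc[of 0]] by simp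
qed (use R_nonneg v_bounds in auto)

section \<open>Convergence of the renormalized flow\<close>

context solution
begin

abbreviation "v_lo \<equiv> (cI / I (\<xi> 0)) powr (1/p)"
abbreviation "v_hi \<equiv> (I_max / I (\<xi> 0)) powr (1/p)"

text \<open>The negative of the right-hand side of the equation with 1/p in place of
  \<open>R t\<close>; it vanishes at the stationary profile.\<close>

definition G :: "real \<Rightarrow> real \<Rightarrow> real" where "G t y = (\<xi> t y - y * \<xi>1 t y) / p - (h y + \<xi>1 t y)"
definition den :: "real \<Rightarrow> real" where "den t = p * I (\<xi> t) + pairing (dI (\<xi> t)) (\<lambda>y. \<xi> t y - y * \<xi>1 t y)"

lemma G_cont: "0 \<le> t \<Longrightarrow> continuous_on {0<..} (G t)"
  unfolding G_def using p_pos by (intro continuous_on_diff h\<xi>1_cont continuous_on_divide psi_cont continuous_on_const) auto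

lemma G_abs_le: "0 \<le> t \<Longrightarrow> e0 \<le> y \<Longrightarrow> \<bar>G t y\<bar> \<le> 2 * M / p + (h e0 + M / e0)"
proof -
  assume t: "0 \<le> t" and y: "e0 \<le> y"
  have "\<bar>\<xi> t y - y * \<xi>1 t y\<bar> / p \<le> 2 * M / p"
    using psi_le[OF t, of y] y e0_pos p_pos by (intro divide_right_mono) auto
  then have "\<bar>(\<xi> t y - y * \<xi>1 t y) / p\<bar> \<le> 2 * M / p" using p_pos by simp
  then show ?thesis unfolding G_def using h\<xi>1_le[OF t y] by linarith
qed

text \<open>Subtracting \<open>den t / p\<close> from \<open>R t * den t\<close> cancels
  \<open>I (\<xi> t)\<close>; what is left is a single pairing.\<close>

lemma \<omega>_den: "0 \<le> t \<Longrightarrow> den t * \<omega> t = - pairing (dI (\<xi> t)) (G t)"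
proof -
  assume t: "0 \<le> t"
  note i1 = pairing_integrable_above[OF \<xi>_nc[OF t] h\<xi>1_cont[OF t] h\<xi>1_le[OF t]]
  have i2: "set_integrable lborel {0<..} (\<lambda>y. dI (\<xi> t) y * (\<xi> t y - y * \<xi>1 t y))"
    by (rule pairing_integrable_above[OF \<xi>_nc[OF t] psi_cont[OF t] psi_le[OF t]]) (use e0_pos in auto)
  have "pairing (dI (\<xi> t)) (G t)
      = (LBINT y:{0<..}. (1/p) * (dI (\<xi> t) y * (\<xi> t y - y * \<xi>1 t y)) - dI (\<xi> t) y * (h y + \<xi>1 t y))"
  proof -
    have "dI (\<xi> t) y * G t y = (1/p) * (dI (\<xi> t) y * (\<xi> t y - y * \<xi>1 t y)) - dI (\<xi> t) y * (h y + \<xi>1 t y)" for y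
      unfolding G_def by (simp add: right_diff_distrib diff_divide_distrib)
    then show ?thesis unfolding pairing_def by (simp only:)
  qed
  also have "\<dots> = (1/p) * pairing (dI (\<xi> t)) (\<lambda>y. \<xi> t y - y * \<xi>1 t y) - pairing (dI (\<xi> t)) (\<lambda>y. h y + \<xi>1 t y)"
    unfolding pairing_def set_integral_mult_right[symmetric]
    by (rule set_integral_diff(2)[OF set_integrable_mult_right[OF i2] i1])
  finally have pG: "pairing (dI (\<xi> t)) (G t) = (1/p) * pairing (dI (\<xi> t)) (\<lambda>y. \<xi> t y - y * \<xi>1 t y) - pairing (dI (\<xi> t)) (\<lambda>y. h y + \<xi>1 t y)" .
  have "den t * \<omega> t = R t * den t - den t / p" by (simp add: \<omega>_def algebra_simps)
  also have "\<dots> = I (\<xi> t) + pairing (dI (\<xi> t)) (\<lambda>y. h y + \<xi>1 t y) - den t / p"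
    using R_eq[OF t] by (simp add: den_def)
  finally show ?thesis using p_pos by (simp add: pG den_def add_divide_distrib)
qed

lemma den_bound: "0 \<le> t \<Longrightarrow> \<delta> \<le> den t"
  using den_ge by (simp add: den_def)

lemma \<omega>_sign:
  assumes t: "0 \<le> t"
  shows "(\<And>y. e0 \<le> y \<Longrightarrow> G t y \<le> 0) \<Longrightarrow> \<omega> t \<le> 0" "(\<And>y. e0 \<le> y \<Longrightarrow> 0 \<le> G t y) \<Longrightarrow> 0 \<le> \<omega> t"
proof -
  have d: "0 < den t" using den_bound[OF t] \<delta>_pos by simp
  show "\<omega> t \<le> 0" if "\<And>y. e0 \<le> y \<Longrightarrow> G t y \<le> 0"
  proof -
    have "den t * \<omega> t \<le> mass (\<xi> t) * 0"
      unfolding \<omega>_den[OF t] by (rule pairing_mono_above[OF \<xi>_nc[OF t] G_cont[OF t] G_abs_le[OF t] that])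
    then show ?thesis using d by (simp add: mult_le_0_iff)
  qed
  show "0 \<le> \<omega> t" if "\<And>y. e0 \<le> y \<Longrightarrow> 0 \<le> G t y"
  proof -
    have "pairing (dI (\<xi> t)) (G t) \<le> 0" by (rule pairing_nonpos[OF \<xi>_nc[OF t] that])
    then have "0 \<le> den t * \<omega> t" unfolding \<omega>_den[OF t] by simp
    then show ?thesis using d by (simp add: zero_le_mult_iff)
  qed
qed

definition A :: real where "A = A0 / \<delta>"

lemma A_nonneg: "0 \<le> A"
  using A0_nonneg \<delta>_pos by (simp add: A_def)

lemma \<omega>_upper:
  assumes t: "0 \<le> t" and \<sigma>: "\<sigma> \<in> {-1, 1}" and K: "0 \<le> K" "\<And>y. e0 \<le> y \<Longrightarrow> \<sigma> * G t y \<le> K"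
  shows "\<sigma> * \<omega> t \<le> A * K"
proof -
  have c: "continuous_on {0<..} (\<lambda>y. \<sigma> * G t y)" by (intro continuous_intros G_cont t)
  have b: "\<bar>\<sigma> * G t y\<bar> \<le> 2 * M / p + (h e0 + M / e0)" if "e0 \<le> y" for y
    using G_abs_le[OF t that] \<sigma> by auto
  have "den t * (\<sigma> * \<omega> t) = - pairing (dI (\<xi> t)) (\<lambda>y. \<sigma> * G t y)"
    using \<omega>_den[OF t] by (simp add: pairing_def mult.left_commute)
  also have "\<dots> \<le> mass (\<xi> t) * K" by (rule pairing_mono_above[OF \<xi>_nc[OF t] c b K(2)])
  also have "\<dots> \<le> A0 * K" using mass_le[OF \<xi>_nc[OF t] \<xi>_le[OF t]] K by (intro mult_right_mono)
  finally have le: "den t * (\<sigma> * \<omega> t) \<le> A0 * K" .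
  show ?thesis
  \<comment> \<open>\<open>den t\<close> is to be replaced by its lower bound
    \<open>\<delta>\<close>, which is legitimate only against a positive
    \<open>\<sigma> * \<omega> t\<close>.\<close>
  proof (cases "\<sigma> * \<omega> t \<le> 0")
    case True
    then show ?thesis using A_nonneg K(1) by (meson mult_nonneg_nonneg order_trans)
  next
    case False
    then have "\<delta> * (\<sigma> * \<omega> t) \<le> den t * (\<sigma> * \<omega> t)" using den_bound[OF t] by (intro mult_right_mono) auto
    then have "\<delta> * (\<sigma> * \<omega> t) \<le> A0 * K" using le by simp
    then show ?thesis using \<delta>_pos by (simp add: A_def field_simps)
  qed
qed

section \<open>Characteristic formulas for the solution, its derivatives and the difference from the
  stationary profile\<close>

lemma arg_pos: "0 \<le> t \<Longrightarrow> 0 < y \<Longrightarrow> 0 < P t * y + Q t"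
  and arg_ge: "0 \<le> t \<Longrightarrow> 0 < y \<Longrightarrow> P t * y \<le> P t * y + Q t"
  using Q_nonneg[of t] by (auto intro: add_pos_nonneg)

lemma P_omega_cont: "continuous_on {0..t} (\<lambda>s. P s * \<omega> s)" "continuous_on {0..t} P" "continuous_on {0..t} \<omega>"
  by (auto intro!: continuous_intros continuous_on_subset[OF P_cont] continuous_on_subset[OF \<omega>_cont])

lemma arg_deriv: "((\<lambda>y. P t * y + Q t) has_real_derivative P t) (at y)"
  by (auto intro!: derivative_eq_intros)

text \<open>Differentiation in space brings out \<open>P t / P s\<close>, which removes the factor
  \<open>P s\<close> under the integral and then \<open>P t\<close> throughout.\<close>

lemma \<xi>1_formula:
  assumes t: "0 \<le> t" and y: "0 < y"
  shows "\<xi>1 t y = \<xi>1 0 (P t * y + Q t) + integral {0..t} (\<lambda>s. h1 (Y t y s))"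
proof -
  have "((\<lambda>y. \<xi> 0 (P t * y + Q t) + integral {0..t} (\<lambda>s. P s * h (Y t y s))) has_real_derivative
      \<xi>1 0 (P t * y + Q t) * P t + integral {0..t} (\<lambda>s. P s * (P t / P s) * h1 (Y t y s))) (at y)"
    by (intro DERIV_add DERIV_chain2[OF \<xi>_deriv[OF order_refl arg_pos[OF t y]] arg_deriv]
      flow_leibniz[OF h_deriv h1_cont P_omega_cont(2) y])
  then have "((\<lambda>y. P t * \<xi> t y) has_real_derivative
      \<xi>1 0 (P t * y + Q t) * P t + integral {0..t} (\<lambda>s. P s * (P t / P s) * h1 (Y t y s))) (at y)"
    by (rule has_field_derivative_transform_within_open[where S = "{0<..}"]) (use y \<xi>_formula(1)[OF t] in auto)
  from DERIV_unique[OF DERIV_cmult[OF \<xi>_deriv[OF t y]] this]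
  have "P t * \<xi>1 t y = P t * (\<xi>1 0 (P t * y + Q t) + integral {0..t} (\<lambda>s. h1 (Y t y s)))"
    by (simp add: algebra_simps)
  then show ?thesis by simp
qed

definition D0 :: "real \<Rightarrow> real" where "D0 z = \<xi> 0 z - xi z"
definition D1 :: "real \<Rightarrow> real" where "D1 z = \<xi>1 0 z - xi1 z"
text \<open>The plus sign is due to the second derivative \<open>- p * h1 z / (p + z)\<close> of
  \<open>xi\<close>.\<close>

definition D2 :: "real \<Rightarrow> real" where "D2 z = \<xi>2 0 z + p * h1 z / (p + z)"

lemma D0_deriv: "0 < z \<Longrightarrow> (D0 has_real_derivative D1 z) (at z)"
  unfolding D0_def D1_def xi1_def by (intro DERIV_diff \<xi>_deriv xi_deriv) auto

lemma D1_deriv: "0 < z \<Longrightarrow> (D1 has_real_derivative D2 z) (at z)"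
  unfolding D1_def D2_def using DERIV_diff[OF \<xi>1_deriv[OF order_refl] xi1_deriv] by simp

lemma e_formula: "0 \<le> t \<Longrightarrow> 0 < y \<Longrightarrow>
    \<xi> t y - xi y = (1 / P t) * (D0 (P t * y + Q t) - integral {0..t} (\<lambda>s. P s * \<omega> s * \<psi> (Y t y s)))"
  using \<xi>_formula(2)[of t y] by (simp add: D0_def field_simps)

lemma e1_deriv:
  assumes t: "0 \<le> t" and y: "0 < y"
  shows "((\<lambda>y. \<xi> t y - xi y) has_real_derivative
      D1 (P t * y + Q t) - integral {0..t} (\<lambda>s. \<omega> s * \<psi>1 (Y t y s))) (at y)"
proof -
  have "((\<lambda>y. (1 / P t) * (D0 (P t * y + Q t) - integral {0..t} (\<lambda>s. P s * \<omega> s * \<psi> (Y t y s)))) has_real_derivative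
      (1 / P t) * (D1 (P t * y + Q t) * P t - integral {0..t} (\<lambda>s. P s * \<omega> s * (P t / P s) * \<psi>1 (Y t y s)))) (at y)"
    by (intro DERIV_cmult DERIV_diff DERIV_chain2[OF D0_deriv[OF arg_pos[OF t y]] arg_deriv]
      flow_leibniz[OF \<psi>_deriv \<psi>1_cont P_omega_cont(1) y])
  moreover have "integral {0..t} (\<lambda>s. P s * \<omega> s * (P t / P s) * \<psi>1 (Y t y s)) = P t * integral {0..t} (\<lambda>s. \<omega> s * \<psi>1 (Y t y s))"
    by (simp add: integral_mult_right[symmetric] mult_ac del: integral_mult_right)
  ultimately have "((\<lambda>y. (1 / P t) * (D0 (P t * y + Q t) - integral {0..t} (\<lambda>s. P s * \<omega> s * \<psi> (Y t y s)))) has_real_derivative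
      D1 (P t * y + Q t) - integral {0..t} (\<lambda>s. \<omega> s * \<psi>1 (Y t y s))) (at y)"
    by (simp add: right_diff_distrib)
  then show ?thesis
    by (rule has_field_derivative_transform_within_open[where S = "{0<..}"]) (use y e_formula[OF t] in auto)
qed

lemma e1_formula:
  assumes t: "0 \<le> t" and y: "0 < y"
  shows "\<xi>1 t y - xi1 y = D1 (P t * y + Q t) - integral {0..t} (\<lambda>s. \<omega> s * \<psi>1 (Y t y s))"
  by (rule DERIV_unique[OF DERIV_diff[OF \<xi>_deriv[OF t y] xi_deriv[OF y], folded xi1_def] e1_deriv[OF t y]])

lemma e2_formula:
  assumes t: "0 \<le> t" and y: "0 < y"
  shows "\<xi>2 t y + p * h1 y / (p + y) = D2 (P t * y + Q t) * P t - integral {0..t} (\<lambda>s. \<omega> s * (P t / P s) * \<psi>2 (Y t y s))"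
proof -
  have "((\<lambda>y. D1 (P t * y + Q t) - integral {0..t} (\<lambda>s. \<omega> s * \<psi>1 (Y t y s))) has_real_derivative
      D2 (P t * y + Q t) * P t - integral {0..t} (\<lambda>s. \<omega> s * (P t / P s) * \<psi>2 (Y t y s))) (at y)"
    by (intro DERIV_diff DERIV_chain2[OF D1_deriv[OF arg_pos[OF t y]] arg_deriv]
      flow_leibniz[OF \<psi>1_deriv \<psi>2_cont P_omega_cont(3) y])
  then have "((\<lambda>y. \<xi>1 t y - xi1 y) has_real_derivative
      D2 (P t * y + Q t) * P t - integral {0..t} (\<lambda>s. \<omega> s * (P t / P s) * \<psi>2 (Y t y s))) (at y)"
    by (rule has_field_derivative_transform_within_open[where S = "{0<..}"]) (use y e1_formula[OF t] in auto)
  from DERIV_unique[OF DERIV_diff[OF \<xi>1_deriv[OF t y] xi1_deriv[OF y]] this] show ?thesis by simp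
qed

section \<open>The contribution of the initial data and the convergence of the growth factor\<close>

lemma inv_P: "0 \<le> t \<Longrightarrow> 1 / P t \<le> exp (-t/p) / v_lo"
proof -
  assume t: "0 \<le> t"
  have "1 / P t = exp (-t/p) / v t" by (simp add: v_def)
  also have "\<dots> \<le> exp (-t/p) / v_lo" using v_ge[OF t] vl_pos by (intro divide_left_mono) auto
  finally show ?thesis .
qed

text \<open>The second term lacks the factor 1 / \<open>P t\<close>. It is supplied by the decay of
  \<open>g\<close>, because the foot of the characteristic lies at \<open>P t * y\<close> or
  beyond.\<close>

lemma boundary_term_le:
  fixes f g :: "real \<Rightarrow> real"
  assumes t: "0 \<le> t" and y: "e0 \<le> y"
    and f: "\<And>z. 0 < z \<Longrightarrow> \<bar>f z\<bar> \<le> E" and g: "\<And>z. 0 < z \<Longrightarrow> z * \<bar>g z\<bar> \<le> E"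
  shows "\<bar>f (P t * y + Q t) / (p * P t) - (1 + y/p) * g (P t * y + Q t)\<bar> \<le> E * (2/p + 1/e0) / v_lo * exp (-t/p)"
proof -
  have y0: "0 < y" using y e0_pos by simp
  let ?x = "P t * y + Q t"
  have x: "0 < ?x" "P t * y \<le> ?x" using arg_pos[OF t y0] arg_ge[OF t y0] by auto
  have E: "0 \<le> E" using f[of 1] by auto
  have "\<bar>f ?x / (p * P t)\<bar> \<le> E / (p * P t)"
    using divide_right_mono[OF f[OF x(1)], of "p * P t"] p_pos less_imp_le[OF P_pos[of t]] by simp
  moreover have "\<bar>g ?x\<bar> \<le> E / (P t * y)"
  proof -
    have "P t * y * \<bar>g ?x\<bar> \<le> ?x * \<bar>g ?x\<bar>" using x by (intro mult_right_mono) auto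
    then have "P t * y * \<bar>g ?x\<bar> \<le> E" using g[OF x(1)] by simp
    then show ?thesis using y0 by (simp add: pos_le_divide_eq mult.commute)
  qed
  then have "\<bar>(1 + y/p) * g ?x\<bar> \<le> (1 + y/p) * (E / (P t * y))"
    unfolding abs_mult using y0 p_pos by (intro mult_mono) auto
  moreover have "(1 + y/p) * (E / (P t * y)) = E * (1/y + 1/p) * (1 / P t)" using y0 p_pos by (simp add: field_simps)
  moreover have "E * (1/y + 1/p) * (1 / P t) \<le> E * (1/e0 + 1/p) * (1 / P t)"
    using E y e0_pos less_imp_le[OF P_pos[of t]] by (intro mult_right_mono mult_left_mono add_mono) (auto simp: frac_le)
  ultimately have "\<bar>f ?x / (p * P t) - (1 + y/p) * g ?x\<bar> \<le> E / (p * P t) + E * (1/e0 + 1/p) * (1 / P t)" by linarith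
  also have "\<dots> = E * (2/p + 1/e0) * (1 / P t)" using p_pos by (simp add: field_simps)
  also have "\<dots> \<le> E * (2/p + 1/e0) * (exp (-t/p) / v_lo)"
    using inv_P[OF t] E p_pos e0_pos by (intro mult_left_mono) auto
  finally show ?thesis by simp
qed

definition Ci :: real where "Ci = M * (2/p + 1/e0) / v_lo"

text \<open>When the characteristic formulas for \<open>\<xi>\<close> and \<open>\<xi>1\<close> are
  inserted into \<open>G\<close>, the integrals assemble into the memory term; besides
  \<open>- h y\<close> there remains only initial data at the foot of the characteristic.\<close>

lemma G_memory:
  assumes t: "0 \<le> t" and y: "e0 \<le> y"
  shows "\<bar>G t y - (mem y t - h y)\<bar> \<le> Ci * exp (-t/p)"
proof -
  have y0: "0 < y" using y e0_pos by simp
  have memory: "mem y t = integral {0..t} (\<lambda>s. P s * h (Y t y s)) / (p * P t) - (1 + y/p) * integral {0..t} (\<lambda>s. h1 (Y t y s))"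
  proof -
    have YX: "(y + integral {s..t} (\<lambda>s. P s / P t)) / (P s / P t) = Y t y s" if "s \<in> {0..t}" for s
      using Q_diff[of s t] that by (simp add: Y_def field_simps)
    have "mem y t = integral {0..t} (\<lambda>s. (1 / (p * P t)) * (P s * h (Y t y s)) - (1 + y/p) * h1 (Y t y s))"
      unfolding memory_def by (rule integral_cong) (simp only: YX, simp)
    also have "\<dots> = (1 / (p * P t)) * integral {0..t} (\<lambda>s. P s * h (Y t y s)) - (1 + y/p) * integral {0..t} (\<lambda>s. h1 (Y t y s))"
      unfolding integral_mult_right[symmetric]
      by (rule integral_diff; intro integrable_continuous_interval continuous_intros P_omega_cont
        continuous_on_compose2[OF h_cont Y_cont] continuous_on_compose2[OF h1_cont Y_cont])
        (use Y_pos[OF y0] in auto)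
    finally show ?thesis by simp
  qed
  have "\<xi> t y = \<xi> 0 (P t * y + Q t) / P t + integral {0..t} (\<lambda>s. P s * h (Y t y s)) / P t"
    using \<xi>_formula(1)[OF t y0] by (simp add: field_simps)
  then have "G t y - (mem y t - h y) = \<xi> 0 (P t * y + Q t) / (p * P t) - (1 + y/p) * \<xi>1 0 (P t * y + Q t)"
    unfolding G_def memory \<xi>1_formula[OF t y0] using p_pos by (simp add: field_simps)
  then show ?thesis
    unfolding Ci_def using boundary_term_le[OF t y, of "\<xi> 0" M "\<xi>1 0"] \<xi>_le[of 0] \<xi>_nonneg[of 0] \<xi>1_le[of 0] by auto
qed

lemma v_converges: obtains l where "(v \<longlongrightarrow> l) at_top"
proof -
  \<comment> \<open>One constant for the maximum principle: it dominates the weight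
    \<open>Cm e0\<close> and, after multiplication by \<open>v t \<le> v_hi\<close>, the two errors
    of order exp (- t/p), namely \<open>Ci\<close> from the initial data and \<open>h e0\<close>
    from the remainder in \<open>memory_exp\<close>.\<close>
  define Cb where "Cb = max (Cm e0) (v_hi * (Ci + h e0))"
  have Cm: "Cm e0 \<le> Cb" and Cv: "v_hi * (Ci + h e0) \<le> Cb" by (auto simp: Cb_def)
  have h0: "0 < h e0" using h_pos[OF e0_pos] .
  have Ci0: "0 \<le> Ci" using M_nonneg p_pos e0_pos by (simp add: Ci_def)
  have Cb0: "0 \<le> Cb"
    using order_trans[OF _ Cv, of 0] v_ge[of 0] v_le[of 0] vl_pos Ci0 h0 by simp
  have J0: "0 \<le> Jp t" "0 \<le> Jm t" if "0 \<le> t" for t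
    unfolding Jp_def Jm_def using that p_pos
    by (auto intro!: integral_nonneg integrable_continuous_interval continuous_intros continuous_on_subset[OF v_cont])
  have Ce: "v t * ((Ci + h e0) * exp (-t/p)) \<le> Cb * exp (-t/p)" if "0 \<le> t" for t
  proof -
    have "v t * (Ci + h e0) \<le> v_hi * (Ci + h e0)" using v_le[OF that] Ci0 h0 by (intro mult_right_mono) auto
    then have "v t * (Ci + h e0) * exp (-t/p) \<le> Cb * exp (-t/p)" using Cv by (intro mult_right_mono) auto
    then show ?thesis by (simp add: mult.assoc)
  qed
  have "\<exists>l. (v \<longlongrightarrow> l) at_top"
  proof (rule max_principle_convergence[OF v_deriv v_cont _ p_pos _ Cb0, where V = v_hi and c = "h_inf / p"])
    show "\<bar>v t\<bar> \<le> v_hi" if "0 \<le> t" for t using v_le[OF that] by (simp add: abs_of_pos[OF v_pos])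
    show "0 < h_inf / p" using h_inf_pos p_pos by simp
    fix t :: real assume t: "0 < t"
    have t0: "0 \<le> t" using t by simp
    have pos: "0 \<le> h e0 * exp (-t/p)" "0 \<le> Ci * exp (-t/p)" using h0 Ci0 by auto
    show "\<omega> t * v t \<le> 0"
      if le: "Cb * integral {0..t} (\<lambda>s. exp (- (t - s) / p) * max 0 (v s - v t)) + Cb * exp (- t / p)
        \<le> h_inf / p * integral {0..t} (\<lambda>s. exp (- (t - s) / p) * max 0 (v t - v s))"
    proof -
      have "\<omega> t \<le> 0"
      proof (rule \<omega>_sign(1)[OF t0])
        fix y assume y: "e0 \<le> y"
        have "Cm e0 * Jp t \<le> Cb * Jp t" using Cm J0[OF t0] by (intro mult_right_mono)
        then have "Cm e0 * Jp t - h_inf / p * Jm t \<le> - (Cb * exp (-t/p))" using le by (simp add: Jp_def Jm_def)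
        also have "\<dots> \<le> - (v t * ((Ci + h e0) * exp (-t/p)))" using Ce[OF t0] by simp
        finally have "(Cm e0 * Jp t - h_inf / p * Jm t) / v t \<le> - (v t * ((Ci + h e0) * exp (-t/p))) / v t"
          using v_pos[of t] by (intro divide_right_mono) auto
        then have "(Cm e0 * Jp t - h_inf / p * Jm t) / v t \<le> - ((Ci + h e0) * exp (-t/p))"
          using v_pos[of t] by simp
        then show "G t y \<le> 0"
          using memory_bounds(1)[OF e0_pos y t0] G_memory[OF t0 y] pos unfolding distrib_right by linarith
      qed
      then show ?thesis using v_pos[of t] by (simp add: mult_le_0_iff)
    qed
    show "0 \<le> \<omega> t * v t"
      if le: "Cb * integral {0..t} (\<lambda>s. exp (- (t - s) / p) * max 0 (v t - v s)) + Cb * exp (- t / p)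
        \<le> h_inf / p * integral {0..t} (\<lambda>s. exp (- (t - s) / p) * max 0 (v s - v t))"
    proof -
      have "0 \<le> \<omega> t"
      proof (rule \<omega>_sign(2)[OF t0])
        fix y assume y: "e0 \<le> y"
        have "Cm e0 * Jm t \<le> Cb * Jm t" using Cm J0[OF t0] by (intro mult_right_mono)
        then have "Cb * exp (-t/p) \<le> h_inf / p * Jp t - Cm e0 * Jm t" using le by (simp add: Jp_def Jm_def)
        then have "v t * ((Ci + h e0) * exp (-t/p)) \<le> h_inf / p * Jp t - Cm e0 * Jm t"
          by (rule order_trans[OF Ce[OF t0]])
        then have "v t * ((Ci + h e0) * exp (-t/p)) / v t \<le> (h_inf / p * Jp t - Cm e0 * Jm t) / v t"
          using v_pos[of t] by (intro divide_right_mono) auto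
        then have "(Ci + h e0) * exp (-t/p) \<le> (h_inf / p * Jp t - Cm e0 * Jm t) / v t"
          using v_pos[of t] by simp
        moreover have "0 \<le> g" if "(a + b) * e \<le> X" "X - e * b \<le> m" "\<bar>g - m\<bar> \<le> a * e" for a b e X m g :: real
          using that by (simp add: abs_le_iff algebra_simps)
        ultimately show "0 \<le> G t y"
          using memory_bounds(2)[OF e0_pos y t0] G_memory[OF t0 y] by blast
      qed
      then show ?thesis using v_pos[of t] by simp
    qed
  qed
  then show thesis using that by blast
qed

lemma v_ratio_close:
  assumes "0 < \<epsilon>"
  obtains T where "0 \<le> T" "\<And>s t. T \<le> s \<Longrightarrow> T \<le> t \<Longrightarrow> \<bar>v s / v t - 1\<bar> \<le> \<epsilon>"
proof -
  obtain l where l: "(v \<longlongrightarrow> l) at_top" by (rule v_converges)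
  have "0 < \<epsilon> * v_lo / 2" using assms vl_pos by simp
  then have "eventually (\<lambda>t. dist (v t) l < \<epsilon> * v_lo / 2) at_top" by (rule tendstoD[OF l])
  then obtain T0 where T0: "\<And>t. T0 \<le> t \<Longrightarrow> \<bar>v t - l\<bar> < \<epsilon> * v_lo / 2"
    by (auto simp: eventually_at_top_linorder dist_real_def)
  have "\<bar>v s / v t - 1\<bar> \<le> \<epsilon>" if "max T0 0 \<le> s" "max T0 0 \<le> t" for s t
  proof -
    have "\<bar>v s - v t\<bar> \<le> \<epsilon> * v_lo" using T0[of s] T0[of t] that by (simp add: abs_if split: if_splits)
    also have "\<dots> \<le> \<epsilon> * v t" using v_ge[of t] that assms by (intro mult_left_mono) auto
    finally have "\<bar>v s - v t\<bar> / v t \<le> \<epsilon>" using v_pos[of t] by (simp add: pos_divide_le_eq)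
    moreover have "v s / v t - 1 = (v s - v t) / v t" using less_imp_neq[OF v_pos[of t]] by (simp add: diff_divide_distrib)
    ultimately show ?thesis by (simp add: abs_of_pos[OF v_pos])
  qed
  then show thesis using that[of "max T0 0"] by auto
qed

end

section \<open>The rate of convergence\<close>

context solution
begin

text \<open>A common constant for the weighted bounds on \<open>D0\<close>, \<open>D1\<close> and
  \<open>D2\<close>; \<open>\<psi>_max\<close> enters through
  \<open>z * xi1 z = xi z - \<psi> z\<close>.\<close>

definition E :: real where "E = M + xi_max + \<psi>_max + p * H"

lemma xi_max_nonneg: "0 \<le> xi_max"
  using xi_nonneg[of 1] xi_le[of 1] by auto

lemma E_ge: "M + xi_max + \<psi>_max \<le> E" "M + p * H \<le> E" "0 \<le> E"
  using M_nonneg xi_max_nonneg \<psi>_max_nonneg H_nonneg p_pos by (auto simp: E_def)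

lemma D_bounds:
  assumes z: "0 < z"
  shows "\<bar>D0 z\<bar> \<le> E" "z * \<bar>D1 z\<bar> \<le> E" "z\<^sup>2 * \<bar>D2 z\<bar> \<le> E"
proof -
  note b = \<xi>_le[of 0, OF order_refl z] \<xi>_nonneg[of 0, OF order_refl z] xi_le[OF z] xi_nonneg[OF z] \<psi>_le[OF z] \<psi>_nonneg[OF z]
  show "\<bar>D0 z\<bar> \<le> E" unfolding D0_def using b E_ge(1) \<psi>_max_nonneg by linarith
  have "z * xi1 z = xi z - \<psi> z" by (simp add: \<psi>_def)
  moreover have "\<bar>z * \<xi>1 0 z\<bar> \<le> M" using \<xi>1_le[of 0, OF order_refl z] z by (simp add: abs_mult)
  ultimately have "\<bar>z * \<xi>1 0 z - z * xi1 z\<bar> \<le> E" using b E_ge(1) by linarith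
  moreover have "z * \<bar>D1 z\<bar> = \<bar>z * \<xi>1 0 z - z * xi1 z\<bar>" using z by (simp add: D1_def abs_mult right_diff_distrib[symmetric])
  ultimately show "z * \<bar>D1 z\<bar> \<le> E" by simp
  have "z\<^sup>2 * \<bar>p * h1 z / (p + z)\<bar> \<le> p * H"
  proof -
    have "z\<^sup>2 * \<bar>p * h1 z / (p + z)\<bar> = p * (z / (p + z)) * (z * \<bar>h1 z\<bar>)"
      using z p_pos by (simp add: abs_mult power2_eq_square)
    also have "\<dots> \<le> p * 1 * H" using z p_pos h1_bound[OF z] by (intro mult_mono) auto
    finally show ?thesis by simp
  qed
  moreover have "z\<^sup>2 * \<bar>D2 z\<bar> \<le> z\<^sup>2 * \<bar>\<xi>2 0 z\<bar> + z\<^sup>2 * \<bar>p * h1 z / (p + z)\<bar>"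
    unfolding D2_def distrib_left[symmetric] by (intro mult_left_mono abs_triangle_ineq) auto
  ultimately show "z\<^sup>2 * \<bar>D2 z\<bar> \<le> E" using \<xi>2_le[of 0, OF order_refl z] E_ge(2) by linarith
qed

section \<open>The Volterra equation for the rescaled rate\<close>

definition w :: "real \<Rightarrow> real" where "w t = exp (t/p) * \<omega> t"
definition W :: "real \<Rightarrow> real" where "W t = integral {0..t} w"

lemma w_cont: "continuous_on {0..} w"
  unfolding w_def using p_pos by (intro continuous_intros \<omega>_cont) auto

lemma W_props: "W 0 = 0" "continuous_on {0..} W" "0 < t \<Longrightarrow> (W has_real_derivative w t) (at t)"
  unfolding W_def using antiderivative_from_zero[OF w_cont] by auto

definition C2 :: real where "C2 = E * (2/p + 1/e0) / v_lo"

lemma N_cont: "0 \<le> t \<Longrightarrow> 0 < y \<Longrightarrow> continuous_on {0..t} (N t y)"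
  unfolding N_def using p_pos Y_pos
  by (intro continuous_intros continuous_on_subset[OF v_cont] continuous_on_compose2[OF \<psi>_cont Y_cont]
    continuous_on_compose2[OF \<psi>1_cont Y_cont]) auto

lemma SY1_cont: "0 \<le> t \<Longrightarrow> 0 < y \<Longrightarrow> continuous_on {0..t} (\<lambda>s. S (Y1 t y s))"
proof -
  assume t: "0 \<le> t" and y: "0 < y"
  have "continuous_on {0<..} S"
    by (rule DERIV_continuous_on[OF has_field_derivative_at_within[OF S_deriv]]) auto
  moreover have "continuous_on {0..t} (Y1 t y)" unfolding Y1_def using p_pos by (intro continuous_intros) auto
  ultimately show ?thesis
    by (rule continuous_on_compose2) (use Y1_ge[OF y] y in \<open>force intro: less_le_trans\<close>)
qed

lemma w_cont': "continuous_on {0..t} w"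
  by (rule continuous_on_subset[OF w_cont]) auto

text \<open>The stationary profile has zero defect, so \<open>G\<close> is linear in the difference
  from it. Inserting the formulas for the difference yields the kernel \<open>N\<close>, and the
  factor exp (t/p) is exactly what keeps the contribution of the initial data bounded.\<close>

lemma G_kernel:
  assumes t: "0 \<le> t" and y: "e0 \<le> y"
  shows "\<bar>exp (t/p) * G t y + integral {0..t} (\<lambda>s. w s * N t y s)\<bar> \<le> C2"
proof -
  have y0: "0 < y" using y e0_pos by simp
  let ?x = "P t * y + Q t"
  have c: "continuous_on {0..t} (\<lambda>s. P s * \<omega> s * \<psi> (Y t y s))" "continuous_on {0..t} (\<lambda>s. \<omega> s * \<psi>1 (Y t y s))"
    using Y_pos[OF y0] by (auto intro!: continuous_intros P_omega_cont continuous_on_compose2[OF \<psi>_cont Y_cont]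
      continuous_on_compose2[OF \<psi>1_cont Y_cont])
  have PP: "P s = P t * (exp (-(t-s)/p) * (v s / v t))" for s
    using P_ratio[of s t] by (simp add: field_simps)
  have e1: "exp (s/p) * exp ((t-s)/p) = exp (t/p)" "exp ((t-s)/p) * exp (-(t-s)/p) = 1" for s
    by (auto simp: exp_add[symmetric] add_divide_distrib[symmetric])
  have "w s * N t y s = exp (t/p) * ((1 / (p * P t)) * (P s * \<omega> s * \<psi> (Y t y s)) - (1 + y/p) * (\<omega> s * \<psi>1 (Y t y s)))" for s
  proof -
    have "exp (t/p) * ((1 / (p * P t)) * (P s * \<omega> s * \<psi> (Y t y s)))
        = (exp (s/p) * exp ((t-s)/p)) * (1/p) * exp (-(t-s)/p) * (v s / v t) * \<omega> s * \<psi> (Y t y s)"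
      unfolding PP[of s] e1 by simp
    also have "\<dots> = exp (s/p) * \<omega> s * (v s / v t * \<psi> (Y t y s) / p) * (exp ((t-s)/p) * exp (-(t-s)/p))"
      by (simp add: mult_ac)
    finally have "exp (t/p) * ((1 / (p * P t)) * (P s * \<omega> s * \<psi> (Y t y s))) = w s * (v s / v t * \<psi> (Y t y s) / p)"
      unfolding e1 w_def by simp
    moreover have "exp (t/p) * ((1 + y/p) * (\<omega> s * \<psi>1 (Y t y s))) = w s * ((1 + y/p) * exp ((t-s)/p) * \<psi>1 (Y t y s))"
      unfolding w_def e1(1)[of s, symmetric] by (simp add: mult_ac)
    ultimately show ?thesis unfolding N_def right_diff_distrib by (simp only:)
  qed
  then have "integral {0..t} (\<lambda>s. w s * N t y s)
      = exp (t/p) * integral {0..t} (\<lambda>s. (1 / (p * P t)) * (P s * \<omega> s * \<psi> (Y t y s)) - (1 + y/p) * (\<omega> s * \<psi>1 (Y t y s)))"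
    by (simp only: integral_mult_right)
  also have "integral {0..t} (\<lambda>s. (1 / (p * P t)) * (P s * \<omega> s * \<psi> (Y t y s)) - (1 + y/p) * (\<omega> s * \<psi>1 (Y t y s)))
      = (1 / (p * P t)) * integral {0..t} (\<lambda>s. P s * \<omega> s * \<psi> (Y t y s)) - (1 + y/p) * integral {0..t} (\<lambda>s. \<omega> s * \<psi>1 (Y t y s))"
    unfolding integral_mult_right[symmetric]
    by (rule integral_diff; intro integrable_continuous_interval continuous_on_mult continuous_on_const c)
  finally have int: "integral {0..t} (\<lambda>s. w s * N t y s) = exp (t/p) * ((1 / (p * P t)) * integral {0..t} (\<lambda>s. P s * \<omega> s * \<psi> (Y t y s))
      - (1 + y/p) * integral {0..t} (\<lambda>s. \<omega> s * \<psi>1 (Y t y s)))" .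
  have G_eq: "G t y = (\<xi> t y - xi y) / p - (1 + y/p) * (\<xi>1 t y - xi1 y)"
  proof -
    have "(p + y) * xi1 y = xi y - p * h y" using p_pos y0 by (simp add: xi1_def)
    then have hy: "h y = xi y / p - (1 + y/p) * xi1 y" using p_pos by (simp add: field_simps)
    show ?thesis unfolding G_def hy by (simp add: algebra_simps diff_divide_distrib)
  qed
  have "G t y = D0 ?x / (p * P t) - (1 + y/p) * D1 ?x
      - ((1 / (p * P t)) * integral {0..t} (\<lambda>s. P s * \<omega> s * \<psi> (Y t y s)) - (1 + y/p) * integral {0..t} (\<lambda>s. \<omega> s * \<psi>1 (Y t y s)))"
    unfolding G_eq e_formula[OF t y0] e1_formula[OF t y0] by (simp add: algebra_simps diff_divide_distrib)
  then have "exp (t/p) * G t y + integral {0..t} (\<lambda>s. w s * N t y s) = exp (t/p) * (D0 ?x / (p * P t) - (1 + y/p) * D1 ?x)"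
    unfolding int by (simp add: right_diff_distrib)
  moreover have "\<bar>exp (t/p) * (D0 ?x / (p * P t) - (1 + y/p) * D1 ?x)\<bar> \<le> exp (t/p) * (C2 * exp (-t/p))"
    unfolding abs_mult C2_def abs_exp_cancel by (intro mult_left_mono boundary_term_le[OF t y] D_bounds) auto
  moreover have "exp (t/p) * (C2 * exp (-t/p)) = C2" by (simp add: exp_minus)
  ultimately show ?thesis by (simp only:)
qed

lemma KB_nonneg: "0 \<le> KB e0" "0 \<le> S_max" "0 \<le> KN e0"
proof -
  show "0 \<le> KB e0" using order_trans[OF abs_ge_zero kernel_bound[of e0 e0 0 0]] e0_pos by simp
  show "0 \<le> S_max" using S_nonneg[of 1] S_le[of 1] by simp
  show "0 \<le> KN e0" using order_trans[OF abs_ge_zero kernel_close[of e0 e0 0 0 "1/2"]] e0_pos by simp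
qed

text \<open>Up to a late time only crude kernel bounds hold, but that stretch contributes at most a
  fixed constant; after it the ratios of \<open>v\<close> are near 1 and \<open>kernel_close\<close>
  applies.\<close>

lemma kernel_error:
  assumes \<epsilon>: "0 < \<epsilon>"
  obtains K where "0 \<le> K" "\<And>t y. 0 \<le> t \<Longrightarrow> e0 \<le> y \<Longrightarrow>
    \<bar>integral {0..t} (\<lambda>s. w s * N t y s) - integral {0..t} (\<lambda>s. w s * S (Y1 t y s))\<bar> \<le> K + \<epsilon> * integral {0..t} (\<lambda>s. \<bar>w s\<bar>)"
proof -
  \<comment> \<open>\<open>kernel_close\<close> requires d \<le> 1/2; the other bound gives
    \<open>KN e0 * d \<le> \<epsilon>\<close>, with + 1 to allow \<open>KN e0 = 0\<close>.\<close>
  define d where "d = min (1/2) (\<epsilon> / (KN e0 + 1))"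
  have d: "0 < d" using \<epsilon> KB_nonneg by (auto simp: d_def)
  have d2: "d \<le> 1/2" unfolding d_def by (rule min.cobounded1)
  have "KN e0 * d \<le> KN e0 * (\<epsilon> / (KN e0 + 1))" using KB_nonneg by (intro mult_left_mono) (auto simp: d_def)
  also have "\<dots> = \<epsilon> * (KN e0 / (KN e0 + 1))" by simp
  also have "\<dots> \<le> \<epsilon> * 1" using \<epsilon> KB_nonneg by (intro mult_left_mono) auto
  finally have KNd: "KN e0 * d \<le> \<epsilon>" by simp
  obtain T where T: "0 \<le> T" "\<And>s t. T \<le> s \<Longrightarrow> T \<le> t \<Longrightarrow> \<bar>v s / v t - 1\<bar> \<le> d"
    by (rule v_ratio_close[OF d]) blast
  let ?B = "KB e0 + S_max"
  define K where "K = ?B * integral {0..T} (\<lambda>s. \<bar>w s\<bar>)"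
  have w_int: "(\<lambda>s. \<bar>w s\<bar>) integrable_on {a..b}" if "0 \<le> a" for a b
    by (intro integrable_continuous_interval continuous_intros continuous_on_subset[OF w_cont]) (use that in auto)
  have w_nonneg: "0 \<le> integral {a..b} (\<lambda>s. \<bar>w s\<bar>)" if "0 \<le> a" for a b
    using w_int[OF that] by (intro integral_nonneg) auto
  have K0: "0 \<le> K" using KB_nonneg w_nonneg[of 0 T] by (simp add: K_def)
  have "\<bar>integral {0..t} (\<lambda>s. w s * N t y s) - integral {0..t} (\<lambda>s. w s * S (Y1 t y s))\<bar> \<le> K + \<epsilon> * integral {0..t} (\<lambda>s. \<bar>w s\<bar>)"
    if t: "0 \<le> t" and y: "e0 \<le> y" for t y
  proof -
    have y0: "0 < y" using y e0_pos by simp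
    let ?f = "\<lambda>s. w s * (N t y s - S (Y1 t y s))"
    have fc: "continuous_on {0..t} ?f" by (intro continuous_intros w_cont' N_cont SY1_cont t y0)
    have rough: "\<bar>?f s\<bar> \<le> ?B * \<bar>w s\<bar>" if "s \<in> {0..t}" for s
    proof -
      have "0 \<le> S (Y1 t y s)" "S (Y1 t y s) \<le> S_max"
        using Y1_ge[OF y0, of s t] y0 that by (auto intro!: S_nonneg S_le)
      then have "\<bar>N t y s - S (Y1 t y s)\<bar> \<le> ?B" using kernel_bound[OF e0_pos y, of s t] that by (simp add: abs_le_iff)
      then show ?thesis unfolding abs_mult by (simp add: mult.commute mult_left_mono)
    qed
    have fine: "\<bar>?f s\<bar> \<le> \<epsilon> * \<bar>w s\<bar>" if "s \<in> {T..t}" for s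
    proof -
      have "\<bar>N t y s - S (Y1 t y s)\<bar> \<le> KN e0 * d"
        by (rule kernel_close[OF e0_pos y]) (use that T d d2 in auto)
      then have "\<bar>N t y s - S (Y1 t y s)\<bar> \<le> \<epsilon>" using KNd by simp
      from mult_left_mono[OF this, of "\<bar>w s\<bar>"] show ?thesis unfolding abs_mult by (simp add: mult.commute)
    qed
    have bound: "\<bar>integral {a..b} ?f\<bar> \<le> k * integral {a..b} (\<lambda>s. \<bar>w s\<bar>)"
      if "0 \<le> a" "b \<le> t" "\<And>s. s \<in> {a..b} \<Longrightarrow> \<bar>?f s\<bar> \<le> k * \<bar>w s\<bar>" for a b k
    proof -
      have "norm (integral {a..b} ?f) \<le> integral {a..b} (\<lambda>s. k * \<bar>w s\<bar>)"
        using that by (intro integral_norm_bound_integral integrable_continuous_interval continuous_on_subset[OF fc]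
          integrable_on_mult_right w_int) auto
      then show ?thesis by simp
    qed
    have "\<bar>integral {0..t} ?f\<bar> \<le> K + \<epsilon> * integral {0..t} (\<lambda>s. \<bar>w s\<bar>)"
    proof (cases "t \<le> T")
      case True
      have "\<bar>integral {0..t} ?f\<bar> \<le> ?B * integral {0..t} (\<lambda>s. \<bar>w s\<bar>)" by (rule bound) (use rough in auto)
      also have "\<dots> \<le> K" unfolding K_def
        using True t KB_nonneg by (intro mult_left_mono integral_subset_le w_int) auto
      finally show ?thesis using \<epsilon> w_nonneg[of 0 t] by (simp add: add_increasing2)
    next
      case False
      have "integral {0..t} ?f = integral {0..T} ?f + integral {T..t} ?f"
        using False T integrable_continuous_interval[OF fc] by (intro Henstock_Kurzweil_Integration.integral_combine[symmetric]) auto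
      moreover have "\<bar>integral {0..T} ?f\<bar> \<le> K" unfolding K_def by (rule bound) (use rough False in auto)
      moreover have "\<bar>integral {T..t} ?f\<bar> \<le> \<epsilon> * integral {T..t} (\<lambda>s. \<bar>w s\<bar>)" by (rule bound) (use fine T in auto)
      moreover have "\<epsilon> * integral {T..t} (\<lambda>s. \<bar>w s\<bar>) \<le> \<epsilon> * integral {0..t} (\<lambda>s. \<bar>w s\<bar>)"
        using T \<epsilon> by (intro mult_left_mono integral_subset_le w_int) auto
      ultimately show ?thesis by linarith
    qed
    moreover have "integral {0..t} ?f = integral {0..t} (\<lambda>s. w s * N t y s) - integral {0..t} (\<lambda>s. w s * S (Y1 t y s))"
      unfolding right_diff_distrib
      by (rule integral_diff; intro integrable_continuous_interval continuous_intros w_cont' N_cont SY1_cont t y0)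
    ultimately show ?thesis by simp
  qed
  then show thesis using that K0 by blast
qed

text \<open>
  At a time where \<open>\<bar>W\<bar>\<close> attains its running maximum, the linearized
  kernel term has a favourable sign by integration by parts, since \<open>S (Y1 t y
  s)\<close> increases with \<open>s\<close>.
\<close>

lemma w_growth:
  assumes \<eta>: "0 < \<eta>"
  obtains B where "0 \<le> B" "\<And>t. 0 \<le> t \<Longrightarrow> \<bar>w t\<bar> \<le> B * exp (\<eta> * t)"
proof (rule volterra_growth[where W = W and w = w and D = "A * (2 * S_max)", OF W_props(1,3,2) w_cont _ _ \<eta>])
  show "0 \<le> A * (2 * S_max)" using A_nonneg KB_nonneg by simp
  fix \<epsilon> :: real assume "0 < \<epsilon>"
  \<comment> \<open>\<open>\<omega>_upper\<close> multiplies every error by \<open>A\<close>, hence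
    the division; + 1 covers \<open>A = 0\<close>.\<close>
  define \<epsilon>' where "\<epsilon>' = \<epsilon> / (A + 1)"
  have "0 < \<epsilon>'" using \<open>0 < \<epsilon>\<close> A_nonneg by (simp add: \<epsilon>'_def)
  have A\<epsilon>: "A * \<epsilon>' \<le> \<epsilon>" using \<open>0 < \<epsilon>\<close> A_nonneg by (simp add: \<epsilon>'_def field_simps)
  obtain K where K: "0 \<le> K" "\<And>t y. 0 \<le> t \<Longrightarrow> e0 \<le> y \<Longrightarrow>
    \<bar>integral {0..t} (\<lambda>s. w s * N t y s) - integral {0..t} (\<lambda>s. w s * S (Y1 t y s))\<bar> \<le> K + \<epsilon>' * integral {0..t} (\<lambda>s. \<bar>w s\<bar>)"
    using kernel_error[OF \<open>0 < \<epsilon>'\<close>] by blast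
  have C2_nonneg: "0 \<le> C2" using E_ge p_pos e0_pos by (simp add: C2_def)
  have Iw: "0 \<le> integral {0..t} (\<lambda>s. \<bar>w s\<bar>)" for t
    by (intro integral_nonneg integrable_continuous_interval continuous_intros w_cont') auto
  \<comment> \<open>Used with X = 0 at a running maximum of \<open>\<bar>W\<bar>\<close>, where the
    linearized term has the favourable sign, and with \<open>2 * S_max * m\<close> in
    general.\<close>
  have from_G: "\<sigma> * w t \<le> A * (X + K + C2) + \<epsilon> * integral {0..t} (\<lambda>s. \<bar>w s\<bar>)"
    if t: "0 \<le> t" and \<sigma>: "\<sigma> \<in> {-1, 1}" and X: "0 \<le> X"
      and S: "\<And>y. e0 \<le> y \<Longrightarrow> - (\<sigma> * integral {0..t} (\<lambda>s. w s * S (Y1 t y s))) \<le> X" for t \<sigma> X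
  proof -
    define Z where "Z = X + K + C2 + \<epsilon>' * integral {0..t} (\<lambda>s. \<bar>w s\<bar>)"
    have Z: "0 \<le> Z" using X K C2_nonneg \<open>0 < \<epsilon>'\<close> Iw[of t] by (simp add: Z_def)
    have "\<sigma> * \<omega> t \<le> A * (exp (-t/p) * Z)"
    proof (rule \<omega>_upper[OF t \<sigma>])
      fix y assume y: "e0 \<le> y"
      have le: "\<sigma> * (exp (t/p) * G t y) \<le> Z"
        using S[OF y] K(2)[OF t y] G_kernel[OF t y] \<sigma> unfolding Z_def by auto
      have ee: "exp (-t/p) * exp (t/p) = 1" by (simp add: exp_add[symmetric])
      have "\<sigma> * G t y = (exp (-t/p) * exp (t/p)) * (\<sigma> * G t y)" by (simp only: ee mult_1_left)
      also have "\<dots> = exp (-t/p) * (\<sigma> * (exp (t/p) * G t y))" by (simp only: mult_ac)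
      also have "\<dots> \<le> exp (-t/p) * Z" by (rule mult_left_mono[OF le]) simp
      finally show "\<sigma> * G t y \<le> exp (-t/p) * Z" .
    qed (use Z in simp)
    then have "exp (t/p) * (\<sigma> * \<omega> t) \<le> exp (t/p) * (A * (exp (-t/p) * Z))" by (intro mult_left_mono) auto
    also have "\<dots> = (exp (t/p) * exp (-t/p)) * (A * Z)" by (simp only: mult_ac)
    also have "exp (t/p) * exp (-t/p) = 1" by (simp add: exp_add[symmetric])
    finally have "\<sigma> * w t \<le> A * Z" by (simp add: w_def mult_ac)
    also have "\<dots> = A * (X + K + C2) + A * \<epsilon>' * integral {0..t} (\<lambda>s. \<bar>w s\<bar>)" by (simp add: Z_def distrib_left mult.assoc)
    also have "\<dots> \<le> A * (X + K + C2) + \<epsilon> * integral {0..t} (\<lambda>s. \<bar>w s\<bar>)" using A\<epsilon> Iw[of t] by (intro add_left_mono mult_right_mono)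
    finally show ?thesis .
  qed
  have parts: "\<bar>integral {0..t} (\<lambda>s. w s * S (Y1 t y s))\<bar> \<le> 2 * S_max * m"
    "\<bar>W t\<bar> = m \<Longrightarrow> 0 \<le> sgn (W t) * integral {0..t} (\<lambda>s. w s * S (Y1 t y s))"
    if "0 \<le> t" "e0 \<le> y" "\<forall>s\<in>{0..t}. \<bar>W s\<bar> \<le> m" for t y m
    using kernel_parts[of t y W w m] that e0_pos W_props continuous_on_subset[OF W_props(2), of "{0..t}"] w_cont' by auto
  show "\<exists>K\<ge>0. \<forall>t\<ge>0. ((\<forall>s\<in>{0..t}. \<bar>W s\<bar> \<le> \<bar>W t\<bar>) \<longrightarrow> sgn (W t) * w t \<le> K + \<epsilon> * integral {0..t} (\<lambda>s. \<bar>w s\<bar>)) \<and>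
      (\<forall>m. (\<forall>s\<in>{0..t}. \<bar>W s\<bar> \<le> m) \<longrightarrow> \<bar>w t\<bar> \<le> K + A * (2 * S_max) * m + \<epsilon> * integral {0..t} (\<lambda>s. \<bar>w s\<bar>))"
  proof (intro exI[of _ "A * (K + C2)"] conjI allI impI)
    show nn: "0 \<le> A * (K + C2)" using A_nonneg K C2_nonneg by simp
    fix t :: real assume t: "0 \<le> t"
    show "sgn (W t) * w t \<le> A * (K + C2) + \<epsilon> * integral {0..t} (\<lambda>s. \<bar>w s\<bar>)" if mx: "\<forall>s\<in>{0..t}. \<bar>W s\<bar> \<le> \<bar>W t\<bar>"
    proof (cases "W t = 0")
      case True
      then show ?thesis using nn \<open>0 < \<epsilon>\<close> Iw[of t] by simp
    next
      case False
      then have "sgn (W t) \<in> {-1, 1}" by (auto simp: sgn_if)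
      from from_G[OF t this, of 0] parts(2)[OF t _ mx] show ?thesis by simp
    qed
    fix m assume m: "\<forall>s\<in>{0..t}. \<bar>W s\<bar> \<le> m"
    then have m0: "0 \<le> m" using t by (auto intro: order_trans[OF abs_ge_zero])
    have X0: "0 \<le> 2 * S_max * m" using KB_nonneg m0 by simp
    have "- (\<sigma> * integral {0..t} (\<lambda>s. w s * S (Y1 t y s))) \<le> 2 * S_max * m" if "\<sigma> \<in> {-1, 1}" "e0 \<le> y" for \<sigma> y
      using parts(1)[OF t that(2) m] that(1) by auto
    from from_G[OF t _ X0 this, of 1] from_G[OF t _ X0 this, of "-1"]
    show "\<bar>w t\<bar> \<le> A * (K + C2) + A * (2 * S_max) * m + \<epsilon> * integral {0..t} (\<lambda>s. \<bar>w s\<bar>)"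
      by (simp add: abs_le_iff algebra_simps)
  qed
qed (simp, rule that)

section \<open>Decay of the profile and its derivatives\<close>

lemma exp_convolution:
  assumes q: "p < q" and t: "0 \<le> t"
  shows "((\<lambda>s. exp (-(t-s)/p) * exp (-s/q)) has_integral (exp (-t/q) - exp (-t/p)) / (1/p - 1/q)) {0..t}"
proof -
  define \<eta> where "\<eta> = 1/p - 1/q"
  have \<eta>: "0 < \<eta>" using q p_pos by (simp add: \<eta>_def field_simps)
  have eq: "exp (-(t-s)/p) * exp (-s/q) = exp (-t/p) * exp (\<eta> * s)" for s
    by (simp add: \<eta>_def exp_add[symmetric] algebra_simps diff_divide_distrib)
  have "((\<lambda>s. exp (-t/p) * exp (\<eta> * s)) has_integral exp (-t/p) * exp (\<eta> * t) / \<eta> - exp (-t/p) * exp (\<eta> * 0) / \<eta>) {0..t}"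
    by (rule fundamental_theorem_of_calculus)
      (use \<eta> t in \<open>auto simp: has_real_derivative_iff_has_vector_derivative[symmetric] intro!: derivative_eq_intros\<close>)
  moreover have "exp (-t/p) * exp (\<eta> * t) = exp (-t/q)" using eq[of t] by simp
  ultimately show ?thesis unfolding eq \<eta>_def[symmetric] by (simp add: diff_divide_distrib)
qed

text \<open>All three orders of derivative reduce to one convolution of
  \<open>\<bar>\<omega>\<bar>\<close> with the weight \<open>P s / P t\<close>: since
  \<open>y \<le> P s / P t * Y t y s\<close>, powers of y are traded for powers of the position,
  against which \<open>\<psi>1\<close> and \<open>\<psi>2\<close> are bounded.\<close>

lemma convergence_rate:
  assumes q: "p < q"
  obtains Cq where "\<And>t y. 0 \<le> t \<Longrightarrow> 0 < y \<Longrightarrow>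
    \<bar>\<xi> t y - xi y\<bar> + y * \<bar>\<xi>1 t y - xi1 y\<bar> + y\<^sup>2 * \<bar>\<xi>2 t y + p * h1 y / (p + y)\<bar> \<le> Cq * exp (-t/q)"
proof -
  \<comment> \<open>Chosen so that \<open>exp (-t/p) * exp (\<eta> * t) = exp (-t/q)\<close>; it is
    positive because q > p.\<close>
  define \<eta> where "\<eta> = 1/p - 1/q"
  have \<eta>: "0 < \<eta>" using q p_pos by (simp add: \<eta>_def field_simps)
  obtain B where B: "0 \<le> B" "\<And>t. 0 \<le> t \<Longrightarrow> \<bar>w t\<bar> \<le> B * exp (\<eta> * t)"
    using w_growth[OF \<eta>] by blast
  have \<omega>_le: "\<bar>\<omega> t\<bar> \<le> B * exp (-t/q)" if "0 \<le> t" for t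
  proof -
    have "\<bar>\<omega> t\<bar> = exp (-t/p) * \<bar>w t\<bar>" by (simp add: w_def abs_mult exp_minus)
    also have "\<dots> \<le> exp (-t/p) * (B * exp (\<eta> * t))" using B(2)[OF that] by (intro mult_left_mono) auto
    also have "\<dots> = B * exp (-t/q)" by (simp add: \<eta>_def exp_add[symmetric] algebra_simps)
    finally show ?thesis .
  qed
  define V where "V = v_hi / v_lo"
  have V: "0 \<le> V" by (simp add: V_def)
  have ratio: "P s / P t \<le> V * exp (-(t-s)/p)" if "0 \<le> s" "0 \<le> t" for s t
  proof -
    have "v s / v t \<le> V" unfolding V_def using v_le[OF that(1)] v_ge[OF that(2)] vl_pos by (intro frac_le) auto
    then show ?thesis unfolding P_ratio mult.commute[of V] by (rule mult_left_mono) simp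
  qed
  define Z where "Z = \<psi>_max + p * H + 2 * p * H"
  have Z: "\<psi>_max \<le> Z" "p * H \<le> Z" "2 * p * H \<le> Z" "0 \<le> Z"
    using \<psi>_max_nonneg p_pos H_nonneg by (auto simp: Z_def)
  have int_le: "\<bar>integral {0..t} f\<bar> \<le> B * V * Z / \<eta> * exp (-t/q)"
    if t: "0 \<le> t" and f: "continuous_on {0..t} f" and le: "\<And>s. s \<in> {0..t} \<Longrightarrow> \<bar>f s\<bar> \<le> \<bar>\<omega> s\<bar> * (P s / P t * Z)" for t f
  proof -
    have "norm (integral {0..t} f) \<le> integral {0..t} (\<lambda>s. B * V * Z * (exp (-(t-s)/p) * exp (-s/q)))"
    proof (rule integral_norm_bound_integral)
      fix s assume s: "s \<in> {0..t}"
      have "norm (f s) \<le> \<bar>\<omega> s\<bar> * (P s / P t * Z)" using le[OF s] by simp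
      also have "\<dots> \<le> (B * exp (-s/q)) * ((V * exp (-(t-s)/p)) * Z)"
        using \<omega>_le[of s] ratio[of s t] s t Z(4) B(1) V by (intro mult_mono) auto
      finally show "norm (f s) \<le> B * V * Z * (exp (-(t-s)/p) * exp (-s/q))" by (simp add: mult_ac)
    qed (rule integrable_continuous_interval[OF f] has_integral_integrable[OF has_integral_mult_right[OF exp_convolution[OF q t]]])+
    also have "\<dots> = B * V * Z * ((exp (-t/q) - exp (-t/p)) / \<eta>)"
      unfolding \<eta>_def by (rule integral_unique[OF has_integral_mult_right[OF exp_convolution[OF q t]]])
    also have "\<dots> \<le> B * V * Z * (exp (-t/q) / \<eta>)"
      using B V Z \<eta> by (intro mult_left_mono divide_right_mono) auto
    finally show ?thesis by simp
  qed
  \<comment> \<open>For each of the three orders, one summand for the initial data and one for the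
    source.\<close>
  define Cq where "Cq = 3 * (E / v_lo + B * V * Z / \<eta>)"
  have exp_le: "exp (-t/p) \<le> exp (-t/q)" if "0 \<le> t" for t
    using divide_left_mono[of p q t] q p_pos that by simp
  have "\<bar>\<xi> t y - xi y\<bar> + y * \<bar>\<xi>1 t y - xi1 y\<bar> + y\<^sup>2 * \<bar>\<xi>2 t y + p * h1 y / (p + y)\<bar> \<le> Cq * exp (-t/q)"
    if t: "0 \<le> t" and y: "0 < y" for t y
  proof -
    let ?x = "P t * y + Q t"
    have x: "0 < ?x" "P t * y \<le> ?x" using arg_pos[OF t y] arg_ge[OF t y] by auto
    have yY: "y \<le> P s / P t * Y t y s" if "s \<in> {0..t}" for s
      using PY_ge[of s t y] that by (simp add: pos_le_divide_eq mult.commute)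
    have Yp: "0 < Y t y s" if "s \<in> {0..t}" for s using Y_pos[OF y] that by auto
    have EP: "E * (1 / P t) \<le> E / v_lo * exp (-t/q)"
    proof -
      have "1 / P t \<le> exp (-t/q) / v_lo"
        using inv_P[OF t] divide_right_mono[OF exp_le[OF t], of v_lo] vl_pos by simp
      from mult_left_mono[OF this E_ge(3)] show ?thesis by simp
    qed
    have yx: "y / ?x \<le> 1 / P t"
      using x y by (simp add: field_simps)
    let ?I0 = "integral {0..t} (\<lambda>s. (1 / P t) * (P s * \<omega> s * \<psi> (Y t y s)))"
    let ?I1 = "integral {0..t} (\<lambda>s. y * (\<omega> s * \<psi>1 (Y t y s)))"
    let ?I2 = "integral {0..t} (\<lambda>s. y\<^sup>2 * (\<omega> s * (P t / P s) * \<psi>2 (Y t y s)))"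
    have \<psi>Y: "continuous_on {0..t} (\<lambda>s. \<psi> (Y t y s))" "continuous_on {0..t} (\<lambda>s. \<psi>1 (Y t y s))" "continuous_on {0..t} (\<lambda>s. \<psi>2 (Y t y s))"
      using Yp by (auto intro!: continuous_on_compose2[OF \<psi>_cont Y_cont] continuous_on_compose2[OF \<psi>1_cont Y_cont]
        continuous_on_compose2[OF \<psi>2_cont Y_cont])
    have I0: "\<bar>?I0\<bar> \<le> B * V * Z / \<eta> * exp (-t/q)"
    proof (rule int_le[OF t])
      fix s assume s: "s \<in> {0..t}"
      have "\<bar>(1 / P t) * (P s * \<omega> s * \<psi> (Y t y s))\<bar> = \<bar>\<omega> s\<bar> * (P s / P t * \<psi> (Y t y s))"
        using \<psi>_nonneg[OF Yp[OF s]] by (simp add: abs_mult)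
      also have "\<dots> \<le> \<bar>\<omega> s\<bar> * (P s / P t * Z)"
        using \<psi>_le[OF Yp[OF s]] Z by (intro mult_left_mono) auto
      finally show "\<bar>(1 / P t) * (P s * \<omega> s * \<psi> (Y t y s))\<bar> \<le> \<bar>\<omega> s\<bar> * (P s / P t * Z)" .
    qed (intro continuous_intros P_omega_cont \<psi>Y)
    have I1: "\<bar>?I1\<bar> \<le> B * V * Z / \<eta> * exp (-t/q)"
    proof (rule int_le[OF t])
      fix s assume s: "s \<in> {0..t}"
      have "\<bar>y * (\<omega> s * \<psi>1 (Y t y s))\<bar> = \<bar>\<omega> s\<bar> * (y * \<bar>\<psi>1 (Y t y s)\<bar>)"
        using y by (simp add: abs_mult)
      also have "\<dots> \<le> \<bar>\<omega> s\<bar> * ((P s / P t * Y t y s) * \<bar>\<psi>1 (Y t y s)\<bar>)"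
        using yY[OF s] by (intro mult_left_mono mult_right_mono) auto
      also have "\<dots> = \<bar>\<omega> s\<bar> * (P s / P t * (Y t y s * \<bar>\<psi>1 (Y t y s)\<bar>))" by simp
      also have "\<dots> \<le> \<bar>\<omega> s\<bar> * (P s / P t * Z)"
        using order_trans[OF \<psi>1_bound[OF Yp[OF s]] Z(2)] by (intro mult_left_mono) auto
      finally show "\<bar>y * (\<omega> s * \<psi>1 (Y t y s))\<bar> \<le> \<bar>\<omega> s\<bar> * (P s / P t * Z)" .
    qed (intro continuous_intros P_omega_cont \<psi>Y)
    have I2: "\<bar>?I2\<bar> \<le> B * V * Z / \<eta> * exp (-t/q)"
    proof (rule int_le[OF t])
      fix s assume s: "s \<in> {0..t}"
      have "\<bar>y\<^sup>2 * (\<omega> s * (P t / P s) * \<psi>2 (Y t y s))\<bar> = \<bar>\<omega> s\<bar> * (P t / P s * (y\<^sup>2 * \<bar>\<psi>2 (Y t y s)\<bar>))"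
        by (simp add: abs_mult)
      \<comment> \<open>The two factors \<open>P s / P t\<close> gained from y^2 outweigh the one
        factor \<open>P t / P s\<close> that the second differentiation produced.\<close>
      also have "\<dots> \<le> \<bar>\<omega> s\<bar> * (P t / P s * ((P s / P t * Y t y s)\<^sup>2 * \<bar>\<psi>2 (Y t y s)\<bar>))"
        using yY[OF s] y by (intro mult_left_mono mult_right_mono power_mono) auto
      also have "\<dots> = \<bar>\<omega> s\<bar> * (P s / P t * ((Y t y s)\<^sup>2 * \<bar>\<psi>2 (Y t y s)\<bar>))"
        by (simp add: power2_eq_square field_simps)
      also have "\<dots> \<le> \<bar>\<omega> s\<bar> * (P s / P t * Z)"
        using order_trans[OF \<psi>2_bound[OF Yp[OF s]] Z(3)] by (intro mult_left_mono) auto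
      finally show "\<bar>y\<^sup>2 * (\<omega> s * (P t / P s) * \<psi>2 (Y t y s))\<bar> \<le> \<bar>\<omega> s\<bar> * (P s / P t * Z)" .
    qed (intro continuous_intros P_omega_cont \<psi>Y; simp)
    have t0: "\<bar>\<xi> t y - xi y\<bar> \<le> E / v_lo * exp (-t/q) + B * V * Z / \<eta> * exp (-t/q)"
    proof -
      have "\<xi> t y - xi y = D0 ?x * (1 / P t) - ?I0"
        unfolding e_formula[OF t y] by (simp add: right_diff_distrib diff_divide_distrib)
      moreover have "\<bar>D0 ?x * (1 / P t)\<bar> \<le> E * (1 / P t)"
        unfolding abs_mult using D_bounds(1)[OF x(1)] by (intro mult_mono) auto
      ultimately show ?thesis using I0 EP by linarith
    qed
    have t1: "y * \<bar>\<xi>1 t y - xi1 y\<bar> \<le> E / v_lo * exp (-t/q) + B * V * Z / \<eta> * exp (-t/q)"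
    proof -
      have "y * (\<xi>1 t y - xi1 y) = y * D1 ?x - ?I1"
        unfolding e1_formula[OF t y] by (simp add: right_diff_distrib)
      moreover have "y * \<bar>D1 ?x\<bar> \<le> E * (1 / P t)"
      proof -
        have "y * \<bar>D1 ?x\<bar> = (?x * \<bar>D1 ?x\<bar>) * (y / ?x)" using x by simp
        also have "\<dots> \<le> E * (1 / P t)" using D_bounds(2)[OF x(1)] yx x y E_ge by (intro mult_mono) auto
        finally show ?thesis .
      qed
      then have "\<bar>y * D1 ?x\<bar> \<le> E * (1 / P t)" using y by (simp add: abs_mult)
      ultimately have "\<bar>y * (\<xi>1 t y - xi1 y)\<bar> \<le> E / v_lo * exp (-t/q) + B * V * Z / \<eta> * exp (-t/q)"
        using I1 EP by linarith
      then show ?thesis using y by (simp add: abs_mult)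
    qed
    have t2: "y\<^sup>2 * \<bar>\<xi>2 t y + p * h1 y / (p + y)\<bar> \<le> E / v_lo * exp (-t/q) + B * V * Z / \<eta> * exp (-t/q)"
    proof -
      have "y\<^sup>2 * (\<xi>2 t y + p * h1 y / (p + y)) = y\<^sup>2 * (D2 ?x * P t) - ?I2"
        unfolding e2_formula[OF t y] by (simp only: right_diff_distrib integral_mult_right)
      moreover have "\<bar>y\<^sup>2 * (D2 ?x * P t)\<bar> \<le> E * (1 / P t)"
      proof -
        have "\<bar>y\<^sup>2 * (D2 ?x * P t)\<bar> = (?x\<^sup>2 * \<bar>D2 ?x\<bar>) * ((y / ?x) * (y / ?x) * P t)"
          using x by (simp add: abs_mult power2_eq_square)
        also have "\<dots> \<le> E * ((1 / P t) * (1 / P t) * P t)"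
          using D_bounds(3)[OF x(1)] yx x y E_ge by (intro mult_mono mult_right_mono) auto
        finally show ?thesis by simp
      qed
      ultimately have "\<bar>y\<^sup>2 * (\<xi>2 t y + p * h1 y / (p + y))\<bar> \<le> E / v_lo * exp (-t/q) + B * V * Z / \<eta> * exp (-t/q)"
        using I2 EP by linarith
      then show ?thesis by (simp add: abs_mult)
    qed
    have "Cq * exp (-t/q) = 3 * (E / v_lo * exp (-t/q) + B * V * Z / \<eta> * exp (-t/q))"
      by (simp add: Cq_def algebra_simps)
    moreover have "a + b + c \<le> 3 * k" if "a \<le> k" "b \<le> k" "c \<le> k" for a b c k :: real using that by linarith
    ultimately show ?thesis using t0 t1 t2 by metis
  qed
  then show thesis by (rule that)
qed

end

section \<open>From the hypotheses of the theorem to the locale assumptions\<close>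

lemma C_posD:
  assumes "C_pos 2 f" "0 < y"
  shows "(f has_real_derivative deriv f y) (at y)" "(deriv f has_real_derivative (deriv ^^ 2) f y) (at y)"
proof -
  have "(deriv ^^ 0) f differentiable_on {0<..}" "(deriv ^^ 1) f differentiable_on {0<..}"
    using assms(1) unfolding C_pos_def by (meson one_less_numeral_iff semiring_norm(76) zero_less_numeral)+
  then have "f field_differentiable (at y)" "deriv f field_differentiable (at y)"
    using assms(2) by (auto simp: differentiable_on_eq_differentiable_at field_differentiable_def real_differentiable_def)
  then show "(f has_real_derivative deriv f y) (at y)" "(deriv f has_real_derivative (deriv ^^ 2) f y) (at y)"
    by (auto simp: DERIV_deriv_iff_field_differentiable numeral_2_eq_2)
qed

lemma SUP_ereal_bound:
  assumes "(SUP y\<in>A. ereal (f y)) < \<infinity>"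
  obtains M where "\<And>y. y \<in> A \<Longrightarrow> f y \<le> M"
proof (cases "A = {}")
  case False
  then obtain a where "a \<in> A" by blast
  then have "ereal (f a) \<le> (SUP y\<in>A. ereal (f y))" by (rule SUP_upper)
  then obtain M where "(SUP y\<in>A. ereal (f y)) = ereal M" using assms by (cases "SUP y\<in>A. ereal (f y)") auto
  then show thesis using that[of M] SUP_upper[of _ A "\<lambda>y. ereal (f y)"] by auto
qed (use that in auto)

lemma wnorm_2_le_iff:
  "wnorm 2 f \<le> ereal M \<longleftrightarrow> (\<forall>y>0. \<bar>f y\<bar> + y * \<bar>deriv f y\<bar> + y\<^sup>2 * \<bar>(deriv ^^ 2) f y\<bar> \<le> M)"
  by (auto simp: wnorm_def SUP_le_iff numeral_2_eq_2)

lemma wnorm_2_bound: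
  assumes "wnorm 2 f \<le> ereal M" "0 < y"
  shows "\<bar>f y\<bar> \<le> M" "y * \<bar>deriv f y\<bar> \<le> M" "y\<^sup>2 * \<bar>(deriv ^^ 2) f y\<bar> \<le> M"
proof -
  have "0 \<le> y * \<bar>deriv f y\<bar>" "0 \<le> y\<^sup>2 * \<bar>(deriv ^^ 2) f y\<bar>" using assms(2) by auto
  then show "\<bar>f y\<bar> \<le> M" "y * \<bar>deriv f y\<bar> \<le> M" "y\<^sup>2 * \<bar>(deriv ^^ 2) f y\<bar> \<le> M"
    using assms unfolding wnorm_2_le_iff by (smt (verit))+
qed

lemma antimono_limit_le:
  fixes h :: "real \<Rightarrow> real"
  assumes "antimono_on {0<..} h" "(h \<longlongrightarrow> l) at_top" "0 < y"
  shows "l \<le> h y"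
proof (rule tendsto_upperbound[OF assms(2)])
  show "eventually (\<lambda>x. h x \<le> h y) at_top"
    using eventually_ge_at_top[of y] by eventually_elim (use assms monotone_onD[OF assms(1), of y] in auto)
qed simp

lemma antimono_deriv_nonpos:
  fixes f :: "real \<Rightarrow> real"
  assumes "antimono_on {0<..} f" "(f has_real_derivative d) (at y)" "0 < y"
  shows "d \<le> 0"
proof (rule ccontr)
  assume "\<not> d \<le> 0"
  then obtain e where e: "0 < e" "\<And>k. 0 < k \<Longrightarrow> k < e \<Longrightarrow> f y < f (y + k)"
    using DERIV_pos_inc_right[OF assms(2)] by auto
  then have "f y < f (y + e/2)" by (intro e(2)) auto
  moreover have "f (y + e/2) \<le> f y" using e(1) assms(3) by (intro monotone_onD[OF assms(1)]) auto
  ultimately show False by simp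
qed

theorem theorem1p2:
  fixes p h_inf :: real
    and h :: "real \<Rightarrow> real"
    and I :: "(real \<Rightarrow> real) \<Rightarrow> real"
    and dI :: "(real \<Rightarrow> real) \<Rightarrow> real \<Rightarrow> real"
    and \<xi> :: "real \<Rightarrow> real \<Rightarrow> real"
  assumes p_pos: "0 < p"
    and h_C2: "C_pos 2 h"
    and h_pos: "\<And>y. 0 < y \<Longrightarrow> 0 < h y"
    and h_decr: "antimono_on {0<..} h"
    and h_lim: "(h \<longlongrightarrow> h_inf) at_top" "0 < h_inf"
    and h_int: "set_integrable lborel {0<..1} h"
    and h_bdd: "(SUP y\<in>{0<..}. ereal (y * \<bar>deriv h y\<bar> + y\<^sup>2 * \<bar>(deriv ^^ 2) h y\<bar>)) < \<infinity>"
    and h_ineq: "\<And>y. 0 < y \<Longrightarrow> 0 \<le> y * (deriv ^^ 2) h y + deriv h y"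
    and h_decr2: "antimono_on {0<..} (\<lambda>y. y\<^sup>2 * (deriv ^^ 2) h y)"
    and I_pos: "positive_functional I"
    and I_grad: "is_gradient I dI"
    and I_a: "property_a I"
    and I_b: "property_b dI"
    and I_c: "property_c I"
    and I_d: "property_d h I dI"
    and init_C2: "C_pos 2 (\<xi> 0)"
    and init_nonneg: "\<And>y. 0 < y \<Longrightarrow> 0 \<le> \<xi> 0 y"
    and init_decr: "antimono_on {0<..} (\<xi> 0)"
    and init_norm: "wnorm 2 (\<xi> 0) < \<infinity>"
    and init_denom: "0 < rho_denom p I dI (\<xi> 0)"
    and sol: "global_solution p h I dI \<xi>"
    and sol_bdd: "(SUP t\<in>{0..}. wnorm 2 (\<xi> t)) < \<infinity>"
    and sol_denom: "\<exists>\<delta>>0. \<forall>t\<ge>0. \<delta> \<le> rho_denom p I dI (\<xi> t)"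
  shows "\<forall>q>p. \<exists>C. \<forall>t\<ge>0. wnorm 2 (\<lambda>y. \<xi> t y - xi_stat p h y) \<le> ereal (C * exp (- t / q))"
proof (intro allI impI)
  fix q assume q: "p < q"
  obtain H where H: "\<And>y. 0 < y \<Longrightarrow> y * \<bar>deriv h y\<bar> + y\<^sup>2 * \<bar>(deriv ^^ 2) h y\<bar> \<le> H"
    by (rule SUP_ereal_bound[OF h_bdd]) auto
  have H1: "y * \<bar>deriv h y\<bar> \<le> H" and H2: "y\<^sup>2 * \<bar>(deriv ^^ 2) h y\<bar> \<le> H" if "0 < y" for y
  proof -
    have "0 \<le> y * \<bar>deriv h y\<bar>" "0 \<le> y\<^sup>2 * \<bar>(deriv ^^ 2) h y\<bar>" using that by auto
    then show "y * \<bar>deriv h y\<bar> \<le> H" "y\<^sup>2 * \<bar>(deriv ^^ 2) h y\<bar> \<le> H" using H[OF that] by linarith+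
  qed
  \<comment> \<open>The supremum is an \<open>ereal\<close> below infinity; the value of the initial
    profile at y = 1 excludes minus infinity, so it is a real number.\<close>
  obtain M where M: "\<And>t. 0 \<le> t \<Longrightarrow> wnorm 2 (\<xi> t) \<le> ereal M"
  proof -
    have le: "wnorm 2 (\<xi> t) \<le> (SUP t\<in>{0..}. wnorm 2 (\<xi> t))" if "0 \<le> t" for t
      using that by (intro SUP_upper) auto
    have "ereal \<bar>\<xi> 0 1\<bar> \<le> wnorm 2 (\<xi> 0)"
    proof -
      have "ereal (\<bar>\<xi> 0 1\<bar>) \<le> ereal (\<Sum>k\<le>2. 1 ^ k * \<bar>(deriv ^^ k) (\<xi> 0) 1\<bar>)" by (simp add: numeral_2_eq_2)
      also have "\<dots> \<le> wnorm 2 (\<xi> 0)" unfolding wnorm_def by (rule SUP_upper) simp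
      finally show ?thesis .
    qed
    then have "(SUP t\<in>{0..}. wnorm 2 (\<xi> t)) \<noteq> - \<infinity>" using le[of 0] by auto
    then obtain M where "(SUP t\<in>{0..}. wnorm 2 (\<xi> t)) = ereal M"
      using sol_bdd by (cases "SUP t\<in>{0..}. wnorm 2 (\<xi> t)") auto
    then show thesis using le by (intro that[of M]) simp
  qed
  note M_bounds = wnorm_2_bound[OF M]
  obtain \<delta> where \<delta>: "0 < \<delta>" "\<And>t. 0 \<le> t \<Longrightarrow> \<delta> \<le> rho_denom p I dI (\<xi> t)" using sol_denom by blast
  obtain e0 where e0: "0 < e0" "\<And>\<zeta>1 \<zeta>2. \<zeta>1 \<in> nonneg_cont \<Longrightarrow> \<zeta>2 \<in> nonneg_cont \<Longrightarrow> (\<And>y. e0 \<le> y \<Longrightarrow> \<zeta>1 y = \<zeta>2 y) \<Longrightarrow> I \<zeta>1 = I \<zeta>2"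
    using I_a unfolding property_a_def by blast
  obtain C where C: "0 < C" "\<And>\<zeta>1 \<zeta>2. \<zeta>1 \<in> nonneg_cont \<Longrightarrow> \<zeta>2 \<in> nonneg_cont \<Longrightarrow>
        ereal (LBINT y:{0<..}. \<bar>dI \<zeta>1 y - dI \<zeta>2 y\<bar>) \<le> ereal C * sup_norm (\<lambda>y. \<zeta>1 y - \<zeta>2 y)"
    using I_b unfolding property_b_def by blast
  have C2: "C_pos 2 (\<xi> t)" and nonneg: "\<And>y. 0 < y \<Longrightarrow> 0 \<le> \<xi> t y" if "0 \<le> t" for t
    using sol that unfolding global_solution_def by auto
  have nc: "\<xi> t \<in> nonneg_cont" if "0 \<le> t" for t
    unfolding nonneg_cont_def using nonneg[OF that]
    by (auto intro: DERIV_continuous_on[OF has_field_derivative_at_within[OF C_posD(1)[OF C2[OF that]]]])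
  have M0: "0 \<le> M" using M_bounds(1)[of 0 1] by auto
  obtain cI where cI: "0 < cI" "\<And>\<zeta>. \<zeta> \<in> nonneg_cont \<Longrightarrow> sup_norm \<zeta> \<le> ereal M \<Longrightarrow> cI \<le> I \<zeta>"
    using I_c M0 unfolding property_c_def by blast
  have rho_eq: "rho p h I dI (\<xi> t) * (p * I (\<xi> t) + pairing (dI (\<xi> t)) (\<lambda>y. \<xi> t y - y * deriv (\<xi> t) y))
        = I (\<xi> t) + pairing (dI (\<xi> t)) (\<lambda>y. h y + deriv (\<xi> t) y)" if "0 \<le> t" for t
    using \<delta>(1) \<delta>(2)[OF that] by (simp add: rho_def rho_denom_def)
  interpret solution p h_inf H h "deriv h" "(deriv ^^ 2) h" I dI e0 C \<xi> "\<lambda>t. deriv (\<xi> t)" "\<lambda>t. (deriv ^^ 2) (\<xi> t)"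
    "\<lambda>t. rho p h I dI (\<xi> t)" M \<delta> cI
  proof
    show "(h has_real_derivative deriv h y) (at y)" "(deriv h has_real_derivative (deriv ^^ 2) h y) (at y)" if "0 < y" for y
      using C_posD[OF h_C2 that] .
    show "continuous_on {0<..} ((deriv ^^ 2) h)" using h_C2 by (simp add: C_pos_def)
    show "h_inf \<le> h y" if "0 < y" for y by (rule antimono_limit_le[OF h_decr h_lim(1) that])
    show "deriv h y \<le> 0" if "0 < y" for y by (rule antimono_deriv_nonpos[OF h_decr C_posD(1)[OF h_C2 that] that])
    show "set_integrable lborel {0<..} (dI \<zeta>)" if "\<zeta> \<in> nonneg_cont" for \<zeta>
      using I_b that unfolding property_b_def by blast
    show "AE y in lborel. 0 < y \<longrightarrow> dI \<zeta> y \<le> 0" if "\<zeta> \<in> nonneg_cont" for \<zeta>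
      using I_d that unfolding property_d_def by blast
    show "0 < I \<zeta>" if "\<zeta> \<in> nonneg_cont" for \<zeta>
      using I_pos that unfolding positive_functional_def by blast
    show "0 \<le> I \<zeta> + pairing (dI \<zeta>) h" if "\<zeta> \<in> nonneg_cont" for \<zeta>
    proof -
      have "0 < (INF \<zeta>\<in>nonneg_cont. ereal (I \<zeta> + pairing (dI \<zeta>) h))" using I_d unfolding property_d_def by blast
      also have "\<dots> \<le> ereal (I \<zeta> + pairing (dI \<zeta>) h)" by (rule INF_lower[OF that])
      finally show ?thesis by simp
    qed
    fix t y :: real assume t: "0 \<le> t"
    show "rho p h I dI (\<xi> t) * (p * I (\<xi> t) + pairing (dI (\<xi> t)) (\<lambda>y. \<xi> t y - y * deriv (\<xi> t) y))
        = I (\<xi> t) + pairing (dI (\<xi> t)) (\<lambda>y. h y + deriv (\<xi> t) y)" by (rule rho_eq[OF t])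
    show "\<delta> \<le> p * I (\<xi> t) + pairing (dI (\<xi> t)) (\<lambda>y. \<xi> t y - y * deriv (\<xi> t) y)"
      using \<delta>(2)[OF t] by (simp add: rho_denom_def)
    show "cI \<le> I (\<xi> t)"
      by (rule cI(2)[OF nc[OF t] sup_norm_leI]) (use M_bounds(1)[OF t] in auto)
    assume y: "0 < y"
    show "(\<xi> t has_real_derivative deriv (\<xi> t) y) (at y)" "(deriv (\<xi> t) has_real_derivative (deriv ^^ 2) (\<xi> t) y) (at y)"
      using C_posD[OF C2[OF t] y] .
    show "0 \<le> \<xi> t y" by (rule nonneg[OF t y])
    show "\<xi> t y \<le> M" "y * \<bar>deriv (\<xi> t) y\<bar> \<le> M" "y\<^sup>2 * \<bar>(deriv ^^ 2) (\<xi> t) y\<bar> \<le> M"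
      using M_bounds[OF t y] by auto
  next
    show "continuous_on ({0..} \<times> {0<..}) (\<lambda>(t, y). \<xi> t y)" using sol unfolding global_solution_def by blast
    fix t y :: real assume "0 < t" "0 < y"
    then have "(\<lambda>s. \<xi> s y) differentiable (at t)"
      and eq: "deriv (\<lambda>s. \<xi> s y) t - h y - deriv (\<xi> t) y + rho p h I dI (\<xi> t) * (\<xi> t y - y * deriv (\<xi> t) y) = 0"
      using sol unfolding global_solution_def by blast+
    then have "((\<lambda>s. \<xi> s y) has_real_derivative deriv (\<lambda>s. \<xi> s y) t) (at t)"
      by (simp add: DERIV_deriv_iff_real_differentiable)
    moreover have "deriv (\<lambda>s. \<xi> s y) t = h y + deriv (\<xi> t) y - rho p h I dI (\<xi> t) * (\<xi> t y - y * deriv (\<xi> t) y)"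
      using eq by simp
    ultimately show "((\<lambda>s. \<xi> s y) has_real_derivative
        h y + deriv (\<xi> t) y - rho p h I dI (\<xi> t) * (\<xi> t y - y * deriv (\<xi> t) y)) (at t)" by simp
  qed (fact p_pos h_lim(2) h_ineq h_decr2 H1 H2 h_int I_grad e0 C \<delta>(1) cI(1) init_decr)+
  obtain Cq where Cq: "\<And>t y. 0 \<le> t \<Longrightarrow> 0 < y \<Longrightarrow>
    \<bar>\<xi> t y - xi y\<bar> + y * \<bar>deriv (\<xi> t) y - xi1 y\<bar> + y\<^sup>2 * \<bar>(deriv ^^ 2) (\<xi> t) y + p * deriv h y / (p + y)\<bar> \<le> Cq * exp (-t/q)"
    by (rule convergence_rate[OF q]) blast
  have "wnorm 2 (\<lambda>y. \<xi> t y - xi_stat p h y) \<le> ereal (Cq * exp (- t / q))" if t: "0 \<le> t" for t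
    unfolding wnorm_2_le_iff
  proof (intro allI impI)
    fix y :: real assume y: "0 < y"
    let ?e = "\<lambda>y. \<xi> t y - xi_stat p h y"
    have d1: "deriv ?e z = deriv (\<xi> t) z - xi1 z" if "0 < z" for z
      unfolding xi1_def by (rule DERIV_imp_deriv[OF DERIV_diff[OF \<xi>_deriv[OF t that] xi_deriv[OF that]]])
    have "(deriv ?e has_real_derivative (deriv ^^ 2) (\<xi> t) y - (- p * deriv h y / (p + y))) (at y)"
      \<comment> \<open>The closed form of \<open>deriv ?e\<close> is known only for positive
        arguments, which is enough on the open half-line.\<close>
      by (rule has_field_derivative_transform_within_open[OF DERIV_diff[OF \<xi>1_deriv[OF t y] xi1_deriv[OF y]], where S = "{0<..}"])
        (use y d1 in auto)
    then have "(deriv ^^ 2) ?e y = (deriv ^^ 2) (\<xi> t) y + p * deriv h y / (p + y)"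
      by (simp add: numeral_2_eq_2 DERIV_imp_deriv)
    then show "\<bar>?e y\<bar> + y * \<bar>deriv ?e y\<bar> + y\<^sup>2 * \<bar>(deriv ^^ 2) ?e y\<bar> \<le> Cq * exp (- t / q)"
      using Cq[OF t y] d1[OF y] by simp
  qed
  then show "\<exists>C. \<forall>t\<ge>0. wnorm 2 (\<lambda>y. \<xi> t y - xi_stat p h y) \<le> ereal (C * exp (- t / q))" by blast
qed

end
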